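(* Let $\mathcal A^*$ be a simply connected Poincaré DGCA of degree $n$ and of Hodge type over $\mathbb F$. Then $\mathcal A^*$ is equivalent to a finite dimensional non-degenerate Poincaré DGCA of degree $n$ and of Hodge type.
   Context: $\mathbb F$ is a fixed field of characteristic $0$. A DGCA is a (unital) differential graded commutative algebra over $\mathbb F$ with differential $d$ of degree $+1$; $\mathcal A^*_d=\ker d$. Two DGCAs are equivalent if they are connected by a zig-zag of DGCA quasi-isomorphisms. A DGCA is simply connected if $H^0\cong\mathbb F$ and $H^1=0$. A Poincaré algebra of degree $n$ is a finite dimensional graded commutative algebra $H^*=\bigoplus_{k=0}^nH^k$ with a linear functional $\int\in(H^n)^\vee$ such that the pairing $\langle\alpha^k,\beta^l\rangle=\int\alpha^k\beta^l$ if $k+l=n$, and $0$ otherwise, is non-degenerate. A Poincaré DGCA of degree $n$ is a DGCA $\mathcal A^*=\bigoplus_{k=0}^n\mathcal A^k$ whose cohomology ring is a Poincaré algebra of degree $n$; it carries the induced pairing $\langle\alpha^k,\beta^l\rangle=\int[\alpha^k\beta^l]$ if $k+l=n$, and $0$ otherwise. $\mathcal A^*$ is called non-degenerate if this pairing on $\mathcal A^*$ is non-degenerate (i.e. $\langle\alpha,\mathcal A^*\rangle=0$ implies $\alpha=0$). A harmonic subspace is a graded subspace $\mathcal H^*\subseteq\mathcal A^*_d$ complementary to $d\mathcal A^{*-1}$ in $\mathcal A^*_d$. A Hodge type decomposition is a direct sum decomposition $\mathcal A^*=d\mathcal A^{*-1}\oplus\mathcal H^*\oplus\mathcal B^*$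 with $\mathcal H^*$ a harmonic subspace and $\langle\mathcal H^*\oplus\mathcal B^*,\mathcal B^*\rangle=0$; $\mathcal A^*$ is of Hodge type if such a decomposition exists. *)

theory Defs
  imports "Jordan_Normal_Form.Missing_VectorSpace" "HOL-Algebra.QuotRing"
begin

section \<open>Graded commutative algebras\<close>

text \<open>
  A graded algebra is a ring and a vector space on one and the same carrier (the total space
  \<open>A\<^sup>*\<close>), together with the family \<open>homog A k\<close> of its homogeneous pieces \<open>A\<^sup>k\<close>. The grading is by
  the natural numbers.
\<close>

record ('f, 'a) graded_algebra = "('f, 'a) module" +
  homog :: "nat \<Rightarrow> 'a set"

definition homogeneous_parts ::
  "('f, 'a, 'x) graded_algebra_scheme \<Rightarrow> 'a \<Rightarrow> (nat \<Rightarrow> 'a) \<Rightarrow> bool" where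
  "homogeneous_parts A x c \<longleftrightarrow>
     (\<forall>k. c k \<in> homog A k) \<and> finite {k. c k \<noteq> \<zero>\<^bsub>A\<^esub>} \<and>
     x = (\<Oplus>\<^bsub>A\<^esub>k\<in>{k. c k \<noteq> \<zero>\<^bsub>A\<^esub>}. c k)"

definition part :: "('f, 'a, 'x) graded_algebra_scheme \<Rightarrow> 'a \<Rightarrow> nat \<Rightarrow> 'a" where
  "part A x = (THE c. homogeneous_parts A x c)"

locale graded_commutative_algebra = vectorspace F A + ring A
  for F :: "('f, 'm) ring_scheme" and A :: "('f, 'a, 'x) graded_algebra_scheme" +
  assumes homog_subspace: "subspace F (homog A k) A"
    and ex1_homogeneous_parts: "x \<in> carrier A \<Longrightarrow> \<exists>!c. homogeneous_parts A x c"
    and smult_mult_left: "\<lbrakk>a \<in> carrier F; x \<in> carrier A; y \<in> carrier A\<rbrakk> \<Longrightarrow>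
          (a \<odot>\<^bsub>A\<^esub> x) \<otimes>\<^bsub>A\<^esub> y = a \<odot>\<^bsub>A\<^esub> (x \<otimes>\<^bsub>A\<^esub> y)"
    and smult_mult_right: "\<lbrakk>a \<in> carrier F; x \<in> carrier A; y \<in> carrier A\<rbrakk> \<Longrightarrow>
          x \<otimes>\<^bsub>A\<^esub> (a \<odot>\<^bsub>A\<^esub> y) = a \<odot>\<^bsub>A\<^esub> (x \<otimes>\<^bsub>A\<^esub> y)"
    and one_homog: "\<one>\<^bsub>A\<^esub> \<in> homog A 0"
    and mult_homog: "\<lbrakk>x \<in> homog A k; y \<in> homog A l\<rbrakk> \<Longrightarrow> x \<otimes>\<^bsub>A\<^esub> y \<in> homog A (k + l)"
    and graded_commutative: "\<lbrakk>x \<in> homog A k; y \<in> homog A l\<rbrakk> \<Longrightarrow>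
          x \<otimes>\<^bsub>A\<^esub> y = (if even (k * l) then y \<otimes>\<^bsub>A\<^esub> x else \<ominus>\<^bsub>A\<^esub> (y \<otimes>\<^bsub>A\<^esub> x))"

definition graded_subspace ::
  "('f, 'm) ring_scheme \<Rightarrow> ('f, 'a, 'x) graded_algebra_scheme \<Rightarrow> 'a set \<Rightarrow> bool" where
  "graded_subspace F A W \<longleftrightarrow> subspace F W A \<and> (\<forall>x\<in>W. \<forall>k. part A x k \<in> W)"

definition internal_sum :: "('a, 'x) ring_scheme \<Rightarrow> 'a set \<Rightarrow> 'a set \<Rightarrow> 'a set \<Rightarrow> bool" where
  "internal_sum A U V S \<longleftrightarrow> U \<inter> V = {\<zero>\<^bsub>A\<^esub>} \<and> U <+>\<^bsub>A\<^esub> V = S"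

text \<open>
  The bilinear pairing determined by a functional \<open>\<phi>\<close> on the degree \<open>n\<close> piece: for homogeneous
  arguments of degrees \<open>k\<close> and \<open>l\<close> it is \<open>\<phi> (\<alpha> \<beta>)\<close> if \<open>k + l = n\<close>, and zero otherwise.
\<close>

definition pairing ::
  "('f, 'm) ring_scheme \<Rightarrow> nat \<Rightarrow> ('f, 'a, 'x) graded_algebra_scheme \<Rightarrow> ('a \<Rightarrow> 'f) \<Rightarrow>
   'a \<Rightarrow> 'a \<Rightarrow> 'f" where
  "pairing F n A \<phi> \<alpha> \<beta> = (\<Oplus>\<^bsub>F\<^esub>k\<in>{..n}. \<phi> (part A \<alpha> k \<otimes>\<^bsub>A\<^esub> part A \<beta> (n - k)))"

definition nondegenerate_pairing ::
  "('f, 'm) ring_scheme \<Rightarrow> nat \<Rightarrow> ('f, 'a, 'x) graded_algebra_scheme \<Rightarrow> ('a \<Rightarrow> 'f) \<Rightarrow> bool" where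
  "nondegenerate_pairing F n A \<phi> \<longleftrightarrow>
     (\<forall>\<alpha>\<in>carrier A. (\<forall>\<beta>\<in>carrier A. pairing F n A \<phi> \<alpha> \<beta> = \<zero>\<^bsub>F\<^esub>) \<longrightarrow> \<alpha> = \<zero>\<^bsub>A\<^esub>)"

text \<open>
  A functional on \<open>H\<^sup>n\<close> is a function on the whole type \<open>'a\<close>; its values outside \<open>homog H n\<close> are
  irrelevant.
\<close>

locale poincare_algebra = graded_commutative_algebra F H
  for F :: "('f, 'm) ring_scheme" and n :: nat
    and H :: "('f, 'a, 'x) graded_algebra_scheme" and \<phi> :: "'a \<Rightarrow> 'f" +
  assumes finite_dimensional: "vectorspace.fin_dim F H"
    and homog_above: "k > n \<Longrightarrow> homog H k = {\<zero>\<^bsub>H\<^esub>}"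
    and integral_closed: "x \<in> homog H n \<Longrightarrow> \<phi> x \<in> carrier F"
    and integral_add: "\<lbrakk>x \<in> homog H n; y \<in> homog H n\<rbrakk> \<Longrightarrow> \<phi> (x \<oplus>\<^bsub>H\<^esub> y) = \<phi> x \<oplus>\<^bsub>F\<^esub> \<phi> y"
    and integral_smult: "\<lbrakk>a \<in> carrier F; x \<in> homog H n\<rbrakk> \<Longrightarrow> \<phi> (a \<odot>\<^bsub>H\<^esub> x) = a \<otimes>\<^bsub>F\<^esub> \<phi> x"
    and nondegenerate: "nondegenerate_pairing F n H \<phi>"


section \<open>Differential graded commutative algebras and their cohomology\<close>

record ('f, 'a) dga = "('f, 'a) graded_algebra" +
  diff :: "'a \<Rightarrow> 'a"

locale dgca = graded_commutative_algebra F A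
  for F :: "('f, 'm) ring_scheme" and A :: "('f, 'a, 'x) dga_scheme" +
  assumes diff_linear: "linear_map F A A (diff A)"
    and diff_homog: "x \<in> homog A k \<Longrightarrow> diff A x \<in> homog A (Suc k)"
    and diff_diff: "x \<in> carrier A \<Longrightarrow> diff A (diff A x) = \<zero>\<^bsub>A\<^esub>"
    and leibniz: "\<lbrakk>x \<in> homog A k; y \<in> carrier A\<rbrakk> \<Longrightarrow>
          diff A (x \<otimes>\<^bsub>A\<^esub> y) =
            (if even k then (diff A x \<otimes>\<^bsub>A\<^esub> y) \<oplus>\<^bsub>A\<^esub> (x \<otimes>\<^bsub>A\<^esub> diff A y)
             else (diff A x \<otimes>\<^bsub>A\<^esub> y) \<ominus>\<^bsub>A\<^esub> (x \<otimes>\<^bsub>A\<^esub> diff A y))"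

definition cocycles :: "('f, 'a, 'x) dga_scheme \<Rightarrow> 'a set" where
  "cocycles A = {x \<in> carrier A. diff A x = \<zero>\<^bsub>A\<^esub>}"

definition coboundaries :: "('f, 'a, 'x) dga_scheme \<Rightarrow> 'a set" where
  "coboundaries A = diff A ` carrier A"

definition coh_class :: "('f, 'a, 'x) dga_scheme \<Rightarrow> 'a \<Rightarrow> 'a set" where
  "coh_class A x = coboundaries A +>\<^bsub>A\<^esub> x"

text \<open>
  The cohomology algebra: the quotient ring of the subring of cocycles by the ideal of coboundaries,
  with the induced scalar multiplication and grading.
\<close>

definition cohomology :: "('f, 'a, 'x) dga_scheme \<Rightarrow> ('f, 'a set) graded_algebra" where
  "cohomology A =
    (let Q = (A\<lparr>carrier := cocycles A\<rparr>) Quot (coboundaries A)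
     in \<lparr>carrier = carrier Q, mult = mult Q, one = one Q, zero = zero Q, add = add Q,
         smult = (\<lambda>a X. \<Union>x\<in>X. coh_class A (a \<odot>\<^bsub>A\<^esub> x)),
         homog = (\<lambda>k. coh_class A ` (cocycles A \<inter> homog A k))\<rparr>)"

definition simply_connected ::
  "('f, 'm) ring_scheme \<Rightarrow> ('f, 'a, 'x) dga_scheme \<Rightarrow> bool" where
  "simply_connected F A \<longleftrightarrow>
     (\<exists>h \<in> ring_iso F ((cohomology A)\<lparr>carrier := homog (cohomology A) 0\<rparr>).
        \<forall>a\<in>carrier F. \<forall>b\<in>carrier F. h (a \<otimes>\<^bsub>F\<^esub> b) = a \<odot>\<^bsub>cohomology A\<^esub> h b) \<and>
     homog (cohomology A) 1 = {\<zero>\<^bsub>cohomology A\<^esub>}"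


section \<open>Quasi-isomorphisms and equivalence\<close>

definition dgca_hom :: "('f, 'm) ring_scheme \<Rightarrow> ('f, 'a, 'x) dga_scheme \<Rightarrow>
    ('f, 'b, 'y) dga_scheme \<Rightarrow> ('a \<Rightarrow> 'b) \<Rightarrow> bool" where
  "dgca_hom F A B f \<longleftrightarrow>
     dgca F A \<and> dgca F B \<and> f \<in> ring_hom A B \<and>
     (\<forall>a\<in>carrier F. \<forall>x\<in>carrier A. f (a \<odot>\<^bsub>A\<^esub> x) = a \<odot>\<^bsub>B\<^esub> f x) \<and>
     (\<forall>k. f ` homog A k \<subseteq> homog B k) \<and>
     (\<forall>x\<in>carrier A. f (diff A x) = diff B (f x))"

definition cohomology_map :: "('f, 'b, 'y) dga_scheme \<Rightarrow> ('a \<Rightarrow> 'b) \<Rightarrow> 'a set \<Rightarrow> 'b set" where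
  "cohomology_map B f X = (\<Union>x\<in>X. coh_class B (f x))"

definition quasi_isomorphism :: "('f, 'm) ring_scheme \<Rightarrow> ('f, 'a, 'x) dga_scheme \<Rightarrow>
    ('f, 'b, 'y) dga_scheme \<Rightarrow> ('a \<Rightarrow> 'b) \<Rightarrow> bool" where
  "quasi_isomorphism F A B f \<longleftrightarrow>
     dgca_hom F A B f \<and>
     bij_betw (cohomology_map B f) (carrier (cohomology A)) (carrier (cohomology B))"

text \<open>
  Zig-zags of quasi-isomorphisms. All algebras in a zig-zag have their carriers in one type \<open>'a\<close>.
  This is no restriction as soon as \<open>'a\<close> is infinite and at least as large as the field (it is both
  if it carries a nonzero algebra over a field of characteristic zero): in any zig-zag between
  algebras on \<open>'a\<close>, each intermediate algebra can be replaced by a subalgebra of cardinality at most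
  that of \<open>'a\<close>, closed up so that the restricted maps are still quasi-isomorphisms.
\<close>

inductive dgca_equivalent ::
  "('f, 'm) ring_scheme \<Rightarrow> ('f, 'a) dga \<Rightarrow> ('f, 'a) dga \<Rightarrow> bool" for F where
  refl: "dgca F A \<Longrightarrow> dgca_equivalent F A A"
| forward: "\<lbrakk>dgca_equivalent F A B; quasi_isomorphism F B C f\<rbrakk> \<Longrightarrow> dgca_equivalent F A C"
| backward: "\<lbrakk>dgca_equivalent F A B; quasi_isomorphism F C B f\<rbrakk> \<Longrightarrow> dgca_equivalent F A C"


section \<open>Poincare DGCAs and Hodge type\<close>

text \<open>
  The functional \<open>\<iota>\<close> on the top cohomology is part of the structure. As \<open>A\<^sup>n\<^sup>+\<^sup>1 = 0\<close>, every
  element of degree \<open>n\<close> is a cocycle, so the induced pairing \<open>\<integral>[\<alpha> \<beta>]\<close> on \<open>A\<close> makes sense.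
\<close>

locale poincare_dgca = dgca F A
  for F :: "('f, 'm) ring_scheme" and n :: nat
    and A :: "('f, 'a, 'x) dga_scheme" and \<iota> :: "'a set \<Rightarrow> 'f" +
  assumes homog_above: "k > n \<Longrightarrow> homog A k = {\<zero>\<^bsub>A\<^esub>}"
    and cohomology_poincare: "poincare_algebra F n (cohomology A) \<iota>"

definition poincare_pairing :: "('f, 'm) ring_scheme \<Rightarrow> nat \<Rightarrow> ('f, 'a, 'x) dga_scheme \<Rightarrow>
    ('a set \<Rightarrow> 'f) \<Rightarrow> 'a \<Rightarrow> 'a \<Rightarrow> 'f" where
  "poincare_pairing F n A \<iota> = pairing F n A (\<lambda>x. \<iota> (coh_class A x))"

definition nondegenerate_dgca ::
  "('f, 'm) ring_scheme \<Rightarrow> nat \<Rightarrow> ('f, 'a, 'x) dga_scheme \<Rightarrow> ('a set \<Rightarrow> 'f) \<Rightarrow> bool" where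
  "nondegenerate_dgca F n A \<iota> \<longleftrightarrow> nondegenerate_pairing F n A (\<lambda>x. \<iota> (coh_class A x))"

definition harmonic_subspace ::
  "('f, 'm) ring_scheme \<Rightarrow> ('f, 'a, 'x) dga_scheme \<Rightarrow> 'a set \<Rightarrow> bool" where
  "harmonic_subspace F A W \<longleftrightarrow>
     graded_subspace F A W \<and> W \<subseteq> cocycles A \<and> internal_sum A (coboundaries A) W (cocycles A)"

definition hodge_decomposition :: "('f, 'm) ring_scheme \<Rightarrow> nat \<Rightarrow> ('f, 'a, 'x) dga_scheme \<Rightarrow>
    ('a set \<Rightarrow> 'f) \<Rightarrow> 'a set \<Rightarrow> 'a set \<Rightarrow> bool" where
  "hodge_decomposition F n A \<iota> W B \<longleftrightarrow>
     harmonic_subspace F A W \<and> graded_subspace F A B \<and>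
     internal_sum A (coboundaries A <+>\<^bsub>A\<^esub> W) B (carrier A) \<and>
     (\<forall>x \<in> W <+>\<^bsub>A\<^esub> B. \<forall>b\<in>B. poincare_pairing F n A \<iota> x b = \<zero>\<^bsub>F\<^esub>)"

definition hodge_type ::
  "('f, 'm) ring_scheme \<Rightarrow> nat \<Rightarrow> ('f, 'a, 'x) dga_scheme \<Rightarrow> ('a set \<Rightarrow> 'f) \<Rightarrow> bool" where
  "hodge_type F n A \<iota> \<longleftrightarrow> (\<exists>W B. hodge_decomposition F n A \<iota> W B)"

end

theory Submission
  imports Defs
begin

text \<open>
  Let \<open>\<delta>\<close> be the inverse of \<open>d\<close> from the exact elements to the summand \<open>B\<close> of a Hodge decomposition,
  extended by zero, and let \<open>C\<close> be the smallest subalgebra containing the harmonic elements and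
  closed under \<open>\<delta>\<close>. It is closed under \<open>d\<close>, and
  \<open>x = d (\<delta> x) + \<pi> x + \<delta> (d x)\<close> with \<open>\<pi>\<close> the harmonic projection
  shows that the inclusion \<open>C \<subseteq> A\<close> is a quasi-isomorphism. By simple connectedness all generators of
  positive degree have degree at least \<open>2\<close>, so a product or \<open>\<delta>\<close> of a product of generators has
  larger degree than its factors; hence there are finitely many generators up to degree \<open>n\<close>.

  The radical of the pairing on \<open>C\<close> is an ideal closed under \<open>d\<close> and, because \<open>\<delta>\<close> is adjoint to
  itself up to sign, also under \<open>\<delta>\<close>. It contains no nonzero harmonic element since the pairing on
  cohomology is nondegenerate, so it is acyclic. Thus \<open>C\<close> modulo its radical is still
  quasi-isomorphic to \<open>A\<close>, nondegenerate, and inherits the Hodge decomposition.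
\<close>

section \<open>Homogeneous parts\<close>

text \<open>Closure of \<open>C\<close> under \<open>d\<close> is not built in and
  \<open>\<delta>\<close> obeys no product rule: for a product z of generators, d
  (\<open>\<delta>\<close> z) is rewritten by the Hodge identity as z minus \<open>\<pi>\<close> z
  minus \<open>\<delta>\<close> (d z). This needs all of \<open>W\<close> inside \<open>C\<close>
  and an induction hypothesis for the factors of z. Applying \<open>\<delta>\<close> to products is
  enough, since it kills harmonic elements and its own values, which lie in \<open>B\<close>. A
  harmonic element of degree 1 would spoil the growth of degrees but must vanish; one of degree 0 is
  a scalar multiple of the unit and adds nothing to the span. The radical is taken inside
  \<open>C\<close>, where fewer test elements are available than in \<open>A\<close>. It still meets
  \<open>W\<close> trivially, because the harmonic elements that detect a given harmonic element all
  lie in \<open>C\<close>. No signs are computed: every argument with the pairing only asks whether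
  an integral vanishes, so adjointness becomes a chain of equivalences between vanishing statements.
  Cohomology, subalgebra and quotient are all images of a graded subalgebra under a map with graded
  kernel, so their algebra laws are proved once.\<close>

lemma (in abelian_group) minus_eq_zero_iff:
  assumes "x \<in> carrier G" "y \<in> carrier G"
  shows "x \<ominus> y = \<zero> \<longleftrightarrow> x = y"
  using assms by (metis a_minus_def a_inv_closed minus_equality minus_minus r_neg)

context graded_commutative_algebra
begin

lemma homog_closed [simp, intro]: "x \<in> homog A k \<Longrightarrow> x \<in> carrier A"
  using homog_subspace[of k] unfolding subspace_def submodule_def by blast

lemma homog_zero [simp, intro]: "\<zero>\<^bsub>A\<^esub> \<in> homog A k"
  using homog_subspace[of k] unfolding subspace_def submodule_def by blast

lemma homog_add [simp, intro]: "x \<in> homog A k \<Longrightarrow> y \<in> homog A k \<Longrightarrow> x \<oplus>\<^bsub>A\<^esub> y \<in> homog A k"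
  using homog_subspace[of k] unfolding subspace_def submodule_def by blast

lemma homog_smult [simp, intro]: "a \<in> carrier F \<Longrightarrow> x \<in> homog A k \<Longrightarrow> a \<odot>\<^bsub>A\<^esub> x \<in> homog A k"
  using homog_subspace[of k] unfolding subspace_def submodule_def by blast

lemma homog_minus [simp, intro]: "x \<in> homog A k \<Longrightarrow> \<ominus>\<^bsub>A\<^esub> x \<in> homog A k"
  using homog_smult[of "\<ominus>\<^bsub>F\<^esub> \<one>\<^bsub>F\<^esub>" x k] by (simp add: smult_l_minus)

lemma homog_diff [simp, intro]: "x \<in> homog A k \<Longrightarrow> y \<in> homog A k \<Longrightarrow> x \<ominus>\<^bsub>A\<^esub> y \<in> homog A k"
  by (simp add: a_minus_def)

lemma homogeneous_parts_part: "x \<in> carrier A \<Longrightarrow> homogeneous_parts A x (part A x)"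
  unfolding part_def by (rule theI'[OF ex1_homogeneous_parts])

text \<open>The index set \<open>S\<close> may exceed the support of \<open>c\<close>, so a sum can
  be recognised as the homogeneous decomposition without first trimming its vanishing terms.\<close>

lemma part_eqI:
  assumes c: "\<And>k. c k \<in> homog A k" and S: "finite S" "\<And>k. k \<notin> S \<Longrightarrow> c k = \<zero>\<^bsub>A\<^esub>"
    and x: "x = (\<Oplus>\<^bsub>A\<^esub>k\<in>S. c k)"
  shows "part A x = c"
proof -
  have "(\<Oplus>\<^bsub>A\<^esub>k\<in>S. c k) = (\<Oplus>\<^bsub>A\<^esub>k\<in>{k. c k \<noteq> \<zero>\<^bsub>A\<^esub>}. c k)"
    using S c by (intro add.finprod_mono_neutral_cong_right) auto
  moreover have "finite {k. c k \<noteq> \<zero>\<^bsub>A\<^esub>}"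
    using S by (elim finite_subset[rotated]) auto
  ultimately have "homogeneous_parts A x c"
    using c x by (auto simp: homogeneous_parts_def)
  moreover have "x \<in> carrier A"
    using x c by (auto intro!: add.finprod_closed)
  ultimately show ?thesis
    unfolding part_def using ex1_homogeneous_parts by (metis the1_equality)
qed

lemma part_homog [simp, intro]: "x \<in> carrier A \<Longrightarrow> part A x k \<in> homog A k"
  using homogeneous_parts_part unfolding homogeneous_parts_def by blast

lemma part_closed [simp, intro]: "x \<in> carrier A \<Longrightarrow> part A x k \<in> carrier A"
  using part_homog homog_closed by blast

lemma finite_parts: "x \<in> carrier A \<Longrightarrow> finite {k. part A x k \<noteq> \<zero>\<^bsub>A\<^esub>}"
  using homogeneous_parts_part unfolding homogeneous_parts_def by blast

lemma finsum_parts: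
  assumes x: "x \<in> carrier A" and S: "finite S" "\<And>k. k \<notin> S \<Longrightarrow> part A x k = \<zero>\<^bsub>A\<^esub>"
  shows "(\<Oplus>\<^bsub>A\<^esub>k\<in>S. part A x k) = x"
proof -
  have "(\<Oplus>\<^bsub>A\<^esub>k\<in>S. part A x k) = (\<Oplus>\<^bsub>A\<^esub>k\<in>{k. part A x k \<noteq> \<zero>\<^bsub>A\<^esub>}. part A x k)"
    using S x by (intro add.finprod_mono_neutral_cong_right) auto
  then show ?thesis
    using homogeneous_parts_part[OF x] unfolding homogeneous_parts_def by metis
qed

lemma part_homogeneous:
  assumes "x \<in> homog A j"
  shows "part A x = (\<lambda>k. if k = j then x else \<zero>\<^bsub>A\<^esub>)"
  using assms by (intro part_eqI[where S = "{j}"]) auto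

lemma part_same [simp]: "x \<in> homog A j \<Longrightarrow> part A x j = x"
  and part_other: "x \<in> homog A j \<Longrightarrow> k \<noteq> j \<Longrightarrow> part A x k = \<zero>\<^bsub>A\<^esub>"
  by (simp_all add: part_homogeneous)

lemma part_zero [simp]: "part A \<zero>\<^bsub>A\<^esub> k = \<zero>\<^bsub>A\<^esub>"
  using part_homogeneous[OF homog_zero] by simp

lemma part_add [simp]:
  assumes "x \<in> carrier A" "y \<in> carrier A"
  shows "part A (x \<oplus>\<^bsub>A\<^esub> y) k = part A x k \<oplus>\<^bsub>A\<^esub> part A y k"
proof -
  let ?S = "{k. part A x k \<noteq> \<zero>\<^bsub>A\<^esub>} \<union> {k. part A y k \<noteq> \<zero>\<^bsub>A\<^esub>}"
  have "(\<Oplus>\<^bsub>A\<^esub>k\<in>?S. part A x k \<oplus>\<^bsub>A\<^esub> part A y k) = (\<Oplus>\<^bsub>A\<^esub>k\<in>?S. part A x k) \<oplus>\<^bsub>A\<^esub> (\<Oplus>\<^bsub>A\<^esub>k\<in>?S. part A y k)"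
    using assms by (intro finsum_addf) auto
  also have "\<dots> = x \<oplus>\<^bsub>A\<^esub> y"
    using assms by (intro arg_cong2[where f = "add A"] finsum_parts) (auto simp: finite_parts)
  finally have "part A (x \<oplus>\<^bsub>A\<^esub> y) = (\<lambda>k. part A x k \<oplus>\<^bsub>A\<^esub> part A y k)"
    using assms by (intro part_eqI[where S = ?S]) (auto simp: finite_parts)
  then show ?thesis by simp
qed

text \<open>\<open>P\<close> is required of the parts of the given \<open>x\<close> only, not of all
  homogeneous elements. This suits properties known on a graded subset containing \<open>x\<close>,
  such as the radical; \<open>homog_induct\<close> is the version for properties of all
  elements.\<close>

lemma graded_induct:
  assumes x: "x \<in> carrier A" and P: "\<And>k. P (part A x k)"
    and add: "\<And>y z. y \<in> carrier A \<Longrightarrow> z \<in> carrier A \<Longrightarrow> P y \<Longrightarrow> P z \<Longrightarrow> P (y \<oplus>\<^bsub>A\<^esub> z)"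
  shows "P x"
proof -
  \<comment> \<open>Some part vanishes because only finitely many do not; hence \<open>P\<close> at
    zero is already an instance of the hypothesis.\<close>
  obtain j where "part A x j = \<zero>\<^bsub>A\<^esub>"
    using ex_new_if_finite[OF infinite_UNIV_nat finite_parts[OF x]] by auto
  then have 0: "P \<zero>\<^bsub>A\<^esub>"
    using P[of j] by simp
  have "P (\<Oplus>\<^bsub>A\<^esub>k\<in>S. part A x k)" if "finite S" for S
    using that by (induction S rule: finite_induct) (auto intro!: add P finsum_closed simp: 0 Pi_def x)
  then show ?thesis
    using finsum_parts[OF x, of "{k. part A x k \<noteq> \<zero>\<^bsub>A\<^esub>}"] finite_parts[OF x] by fastforce
qed

lemma homog_induct [consumes 1, case_names homog add]:
  assumes "x \<in> carrier A" and "\<And>k y. y \<in> homog A k \<Longrightarrow> P y"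
    and "\<And>y z. y \<in> carrier A \<Longrightarrow> z \<in> carrier A \<Longrightarrow> P y \<Longrightarrow> P z \<Longrightarrow> P (y \<oplus>\<^bsub>A\<^esub> z)"
  shows "P x"
  using assms by (intro graded_induct[of x P]) auto

lemma part_smult [simp]:
  assumes "a \<in> carrier F" "x \<in> carrier A"
  shows "part A (a \<odot>\<^bsub>A\<^esub> x) k = a \<odot>\<^bsub>A\<^esub> part A x k"
  using assms(2)
proof (induction rule: homog_induct)
  case (homog j y)
  then show ?case
    using assms(1) by (cases "k = j") (auto simp: part_other[of _ j] homog_smult)
next
  case (add y z)
  then show ?case
    using assms(1) by (simp add: smult_r_distr)
qed

lemma part_minus [simp]: "x \<in> carrier A \<Longrightarrow> part A (\<ominus>\<^bsub>A\<^esub> x) k = \<ominus>\<^bsub>A\<^esub> part A x k"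
  using part_smult[of "\<ominus>\<^bsub>F\<^esub> \<one>\<^bsub>F\<^esub>" x k] by (simp add: smult_l_minus)

lemma part_diff [simp]:
  "x \<in> carrier A \<Longrightarrow> y \<in> carrier A \<Longrightarrow> part A (x \<ominus>\<^bsub>A\<^esub> y) k = part A x k \<ominus>\<^bsub>A\<^esub> part A y k"
  by (simp add: a_minus_def)

lemma homogI:
  assumes "x \<in> carrier A" "\<And>k. k \<noteq> j \<Longrightarrow> part A x k = \<zero>\<^bsub>A\<^esub>"
  shows "x \<in> homog A j"
proof -
  have "(\<Oplus>\<^bsub>A\<^esub>k\<in>{j}. part A x k) = x"
    using assms by (intro finsum_parts) auto
  then show ?thesis
    using assms part_homog[of x j] by simp
qed

end

section \<open>Images of graded subalgebras\<close>

lemma (in graded_commutative_algebra) subspace_iff: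
  "subspace F S A \<longleftrightarrow> S \<subseteq> carrier A \<and> \<zero>\<^bsub>A\<^esub> \<in> S \<and> (\<forall>x\<in>S. \<forall>y\<in>S. x \<oplus>\<^bsub>A\<^esub> y \<in> S) \<and>
     (\<forall>a\<in>carrier F. \<forall>x\<in>S. a \<odot>\<^bsub>A\<^esub> x \<in> S)"
proof -
  have "vectorspace F A" "module F A" by unfold_locales
  then show ?thesis
    by (auto simp: subspace_def submodule_def)
qed

definition graded_subalgebra ::
  "('f, 'm) ring_scheme \<Rightarrow> ('f, 'a, 'x) graded_algebra_scheme \<Rightarrow> 'a set \<Rightarrow> bool" where
  "graded_subalgebra F A C \<longleftrightarrow>
     graded_subspace F A C \<and> \<one>\<^bsub>A\<^esub> \<in> C \<and> (\<forall>x\<in>C. \<forall>y\<in>C. x \<otimes>\<^bsub>A\<^esub> y \<in> C)"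

text \<open>The common pattern behind cohomology, subalgebras and quotients: \<open>f\<close> is
  constrained on \<open>C\<close> only, and nothing about \<open>K\<close> is assumed beyond its
  operations being induced by \<open>f\<close>. All laws of \<open>K\<close> are then inherited. The
  assumption \<open>kernel_part\<close> says that the kernel is graded, which keeps the sum of the
  images of the homogeneous pieces direct.\<close>

locale graded_image = graded_commutative_algebra F A
  for F :: "('f, 'm) ring_scheme" and A :: "('f, 'a, 'x) graded_algebra_scheme"
    and C :: "'a set" and K :: "('f, 'b, 'y) graded_algebra_scheme" and f :: "'a \<Rightarrow> 'b" +
  assumes subalgebra: "graded_subalgebra F A C"
    and carrier_image: "carrier K = f ` C"
    and image_add: "x \<in> C \<Longrightarrow> y \<in> C \<Longrightarrow> f (x \<oplus>\<^bsub>A\<^esub> y) = f x \<oplus>\<^bsub>K\<^esub> f y"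
    and image_mult: "x \<in> C \<Longrightarrow> y \<in> C \<Longrightarrow> f (x \<otimes>\<^bsub>A\<^esub> y) = f x \<otimes>\<^bsub>K\<^esub> f y"
    and image_smult: "a \<in> carrier F \<Longrightarrow> x \<in> C \<Longrightarrow> f (a \<odot>\<^bsub>A\<^esub> x) = a \<odot>\<^bsub>K\<^esub> f x"
    and image_one: "f \<one>\<^bsub>A\<^esub> = \<one>\<^bsub>K\<^esub>"
    and image_zero: "f \<zero>\<^bsub>A\<^esub> = \<zero>\<^bsub>K\<^esub>"
    and image_homog: "homog K k = f ` (C \<inter> homog A k)"
    and kernel_part: "x \<in> C \<Longrightarrow> f x = \<zero>\<^bsub>K\<^esub> \<Longrightarrow> f (part A x k) = \<zero>\<^bsub>K\<^esub>"
begin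

lemma sub_carrier: "C \<subseteq> carrier A"
  and sub_zero [simp, intro]: "\<zero>\<^bsub>A\<^esub> \<in> C"
  and sub_one [simp, intro]: "\<one>\<^bsub>A\<^esub> \<in> C"
  and sub_add [simp, intro]: "x \<in> C \<Longrightarrow> y \<in> C \<Longrightarrow> x \<oplus>\<^bsub>A\<^esub> y \<in> C"
  and sub_mult [simp, intro]: "x \<in> C \<Longrightarrow> y \<in> C \<Longrightarrow> x \<otimes>\<^bsub>A\<^esub> y \<in> C"
  and sub_smult [simp, intro]: "a \<in> carrier F \<Longrightarrow> x \<in> C \<Longrightarrow> a \<odot>\<^bsub>A\<^esub> x \<in> C"
  and sub_part [simp, intro]: "x \<in> C \<Longrightarrow> part A x k \<in> C"
  using subalgebra unfolding graded_subalgebra_def graded_subspace_def subspace_iff by auto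

lemma sub_closed [simp, intro]: "x \<in> C \<Longrightarrow> x \<in> carrier A"
  using sub_carrier by auto

lemma sub_minus [simp, intro]: "x \<in> C \<Longrightarrow> \<ominus>\<^bsub>A\<^esub> x \<in> C"
  using sub_smult[of "\<ominus>\<^bsub>F\<^esub> \<one>\<^bsub>F\<^esub>" x] by (simp add: smult_l_minus)

lemma sub_diff [simp, intro]: "x \<in> C \<Longrightarrow> y \<in> C \<Longrightarrow> x \<ominus>\<^bsub>A\<^esub> y \<in> C"
  by (simp add: a_minus_def)

lemma image_closed [simp, intro]: "x \<in> C \<Longrightarrow> f x \<in> carrier K"
  by (simp add: carrier_image)

lemma vectorspace_image: "vectorspace F K"
proof -
  have neg: "\<exists>v\<in>C. f u \<oplus>\<^bsub>K\<^esub> f v = \<zero>\<^bsub>K\<^esub>" if "u \<in> C" for u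
    using that by (intro bexI[of _ "\<ominus>\<^bsub>A\<^esub> u"]) (auto simp: image_add[symmetric] image_zero r_neg)
  note sym = image_add[symmetric] image_smult[symmetric] image_zero[symmetric]
  show ?thesis
  proof (rule vs_criteria[OF field_axioms])
    show "\<forall>v\<in>carrier K. \<exists>v'\<in>carrier K. v \<oplus>\<^bsub>K\<^esub> v' = \<zero>\<^bsub>K\<^esub>"
      using neg by (auto simp: carrier_image)
  qed (auto simp: carrier_image sym a_ac smult_assoc1 smult_l_distr smult_r_distr)
qed

lemma ring_image: "ring K"
proof (rule ringI)
  show "abelian_group K"
    using vectorspace_image by (simp add: vectorspace_def module_def)
  show "Group.monoid K"
    by (rule monoidI)
      (auto simp: carrier_image image_mult[symmetric] image_one[symmetric] m_assoc)
qed (auto simp: carrier_image image_add[symmetric] image_mult[symmetric] l_distr r_distr)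

lemma image_minus: "x \<in> C \<Longrightarrow> f (\<ominus>\<^bsub>A\<^esub> x) = \<ominus>\<^bsub>K\<^esub> f x"
proof -
  interpret K: ring K by (rule ring_image)
  assume "x \<in> C"
  then show ?thesis
    by (intro K.minus_equality[symmetric]) (auto simp: image_add[symmetric] image_zero l_neg)
qed

lemma image_diff: "x \<in> C \<Longrightarrow> y \<in> C \<Longrightarrow> f (x \<ominus>\<^bsub>A\<^esub> y) = f x \<ominus>\<^bsub>K\<^esub> f y"
  by (simp add: a_minus_def image_add image_minus)

lemma image_finsum:
  assumes "finite S" "\<And>k. k \<in> S \<Longrightarrow> u k \<in> C"
  shows "(\<Oplus>\<^bsub>A\<^esub>k\<in>S. u k) \<in> C" "f (\<Oplus>\<^bsub>A\<^esub>k\<in>S. u k) = (\<Oplus>\<^bsub>K\<^esub>k\<in>S. f (u k))"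
proof -
  interpret K: ring K by (rule ring_image)
  have "(\<Oplus>\<^bsub>A\<^esub>k\<in>S. u k) \<in> C \<and> f (\<Oplus>\<^bsub>A\<^esub>k\<in>S. u k) = (\<Oplus>\<^bsub>K\<^esub>k\<in>S. f (u k))"
    using assms
  proof (induction S rule: finite_induct)
    case empty
    then show ?case by (simp add: image_zero)
  next
    case (insert k S)
    then show ?case by (auto simp: image_add Pi_def)
  qed
  then show "(\<Oplus>\<^bsub>A\<^esub>k\<in>S. u k) \<in> C" "f (\<Oplus>\<^bsub>A\<^esub>k\<in>S. u k) = (\<Oplus>\<^bsub>K\<^esub>k\<in>S. f (u k))" by auto
qed

text \<open>Existence pushes the decomposition of \<open>x\<close> forward. For uniqueness, a
  decomposition in \<open>K\<close> is lifted to an element y of \<open>C\<close> with the same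
  image as \<open>x\<close>; their difference lies in the kernel, and since the kernel is graded all
  parts of y and \<open>x\<close> have equal images.\<close>

lemma homogeneous_parts_image_iff:
  assumes x: "x \<in> C"
  shows "homogeneous_parts K (f x) c \<longleftrightarrow> c = (\<lambda>k. f (part A x k))"
proof -
  interpret K: ring K by (rule ring_image)
  show ?thesis
  proof
    assume c: "homogeneous_parts K (f x) c"
    let ?S = "{k. c k \<noteq> \<zero>\<^bsub>K\<^esub>}"
    \<comment> \<open>The lift is taken to be zero wherever \<open>c\<close> is zero; otherwise the
      lifted family could have infinite support and no sum.\<close>
    have "\<exists>u. u \<in> C \<inter> homog A k \<and> f u = c k \<and> (c k = \<zero>\<^bsub>K\<^esub> \<longrightarrow> u = \<zero>\<^bsub>A\<^esub>)" for k
    proof (cases "c k = \<zero>\<^bsub>K\<^esub>")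
      case True
      then show ?thesis by (auto intro!: exI[of _ "\<zero>\<^bsub>A\<^esub>"] simp: image_zero)
    next
      case False
      then show ?thesis using c unfolding homogeneous_parts_def image_homog by fastforce
    qed
    then obtain u where u: "\<And>k. u k \<in> C" "\<And>k. u k \<in> homog A k" "\<And>k. f (u k) = c k"
      "\<And>k. c k = \<zero>\<^bsub>K\<^esub> \<Longrightarrow> u k = \<zero>\<^bsub>A\<^esub>"
      by (metis IntE)
    define y where "y = (\<Oplus>\<^bsub>A\<^esub>k\<in>?S. u k)"
    have fin: "finite ?S" using c by (simp add: homogeneous_parts_def)
    have y: "y \<in> C" "f y = (\<Oplus>\<^bsub>K\<^esub>k\<in>?S. c k)"
      unfolding y_def using image_finsum[of ?S u] fin u by auto
    have py: "part A y = u"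
      using u fin by (intro part_eqI[where S = ?S]) (auto simp: y_def)
    have "f y = f x"
      using c y(2) by (simp add: homogeneous_parts_def)
    then have "f (y \<ominus>\<^bsub>A\<^esub> x) = \<zero>\<^bsub>K\<^esub>"
      using x y(1) K.minus_eq_zero_iff[of "f x" "f x"] by (simp add: image_diff)
    then have "f (part A (y \<ominus>\<^bsub>A\<^esub> x) k) = \<zero>\<^bsub>K\<^esub>" for k
      using x y by (intro kernel_part) auto
    then have "c k \<ominus>\<^bsub>K\<^esub> f (part A x k) = \<zero>\<^bsub>K\<^esub>" for k
      using x y u by (simp add: py image_diff)
    then show "c = (\<lambda>k. f (part A x k))"
      using u x by (intro ext) (metis K.minus_eq_zero_iff image_closed sub_part)
  next
    assume c: "c = (\<lambda>k. f (part A x k))"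
    let ?S = "{k. part A x k \<noteq> \<zero>\<^bsub>A\<^esub>}"
    have fin: "finite ?S" using x by (auto intro: finite_parts)
    have sub: "{k. c k \<noteq> \<zero>\<^bsub>K\<^esub>} \<subseteq> ?S" by (auto simp: c image_zero)
    have "(\<Oplus>\<^bsub>A\<^esub>k\<in>?S. part A x k) = x"
      using fin x by (intro finsum_parts) auto
    moreover have "f (\<Oplus>\<^bsub>A\<^esub>k\<in>?S. part A x k) = (\<Oplus>\<^bsub>K\<^esub>k\<in>?S. f (part A x k))"
      using fin x by (intro image_finsum(2)) auto
    ultimately have "f x = (\<Oplus>\<^bsub>K\<^esub>k\<in>?S. c k)"
      unfolding c by argo
    also have "\<dots> = (\<Oplus>\<^bsub>K\<^esub>k\<in>{k. c k \<noteq> \<zero>\<^bsub>K\<^esub>}. c k)"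
      using fin sub x by (intro K.add.finprod_mono_neutral_cong_right) (auto simp: c)
    finally show "homogeneous_parts K (f x) c"
      using finite_subset[OF sub fin] x by (auto simp: homogeneous_parts_def c image_homog)
  qed
qed

lemma part_image [simp]:
  assumes "x \<in> C"
  shows "part K (f x) k = f (part A x k)"
proof -
  have "homogeneous_parts K (f x) = (\<lambda>c. c = (\<lambda>k. f (part A x k)))"
    using assms homogeneous_parts_image_iff by blast
  then show ?thesis
    by (simp add: part_def[of K])
qed

lemma graded_commutative_image: "graded_commutative_algebra F K"
proof -
  interpret K: ring K by (rule ring_image)
  interpret KV: vectorspace F K by (rule vectorspace_image)
  have 1: "subspace F (homog K k) K" for k
  proof -
    have "\<exists>z\<in>C \<inter> homog A k. f x \<oplus>\<^bsub>K\<^esub> f y = f z" if "x \<in> C \<inter> homog A k" "y \<in> C \<inter> homog A k" for x y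
      using that by (intro bexI[of _ "x \<oplus>\<^bsub>A\<^esub> y"]) (auto simp: image_add)
    moreover have "\<exists>z\<in>C \<inter> homog A k. a \<odot>\<^bsub>K\<^esub> f x = f z" if "a \<in> carrier F" "x \<in> C \<inter> homog A k" for a x
      using that by (intro bexI[of _ "a \<odot>\<^bsub>A\<^esub> x"]) (auto simp: image_smult)
    moreover have "\<exists>z\<in>C \<inter> homog A k. \<zero>\<^bsub>K\<^esub> = f z"
      by (intro bexI[of _ "\<zero>\<^bsub>A\<^esub>"]) (auto simp: image_zero)
    ultimately show ?thesis
      unfolding subspace_def submodule_def image_homog
      by (simp add: image_iff KV.vectorspace_axioms KV.module_axioms) blast
  qed
  have 2: "\<exists>!c. homogeneous_parts K u c" if "u \<in> carrier K" for u
    using that by (auto simp: carrier_image homogeneous_parts_image_iff)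
  have 3: "u \<otimes>\<^bsub>K\<^esub> v = (if even (k * l) then v \<otimes>\<^bsub>K\<^esub> u else \<ominus>\<^bsub>K\<^esub> (v \<otimes>\<^bsub>K\<^esub> u))"
    if uv: "u \<in> homog K k" "v \<in> homog K l" for u v k l
  proof -
    from uv obtain x y where xy: "x \<in> C" "x \<in> homog A k" "u = f x" "y \<in> C" "y \<in> homog A l" "v = f y"
      unfolding image_homog by blast
    have "f (x \<otimes>\<^bsub>A\<^esub> y) = f (if even (k * l) then y \<otimes>\<^bsub>A\<^esub> x else \<ominus>\<^bsub>A\<^esub> (y \<otimes>\<^bsub>A\<^esub> x))"
      using graded_commutative[of x k y l] xy by simp
    then show ?thesis
      using xy by (simp add: image_mult image_minus split: if_splits)
  qed
  have 4: "u \<otimes>\<^bsub>K\<^esub> v \<in> homog K (k + l)" if uv: "u \<in> homog K k" "v \<in> homog K l" for u v k l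
  proof -
    from uv obtain x y where xy: "x \<in> C" "x \<in> homog A k" "u = f x" "y \<in> C" "y \<in> homog A l" "v = f y"
      unfolding image_homog by blast
    then show ?thesis
      using mult_homog[of x k y l] by (simp add: image_homog image_mult[symmetric])
  qed
  have 5: "\<one>\<^bsub>K\<^esub> \<in> homog K 0"
    using one_homog by (simp add: image_homog image_one[symmetric])
  have 6: "(a \<odot>\<^bsub>K\<^esub> u) \<otimes>\<^bsub>K\<^esub> v = a \<odot>\<^bsub>K\<^esub> (u \<otimes>\<^bsub>K\<^esub> v)" "u \<otimes>\<^bsub>K\<^esub> (a \<odot>\<^bsub>K\<^esub> v) = a \<odot>\<^bsub>K\<^esub> (u \<otimes>\<^bsub>K\<^esub> v)"
    if uv: "a \<in> carrier F" "u \<in> carrier K" "v \<in> carrier K" for a u v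
    using uv by (auto simp: carrier_image image_mult[symmetric] image_smult[symmetric]
        smult_mult_left smult_mult_right)
  show ?thesis
    by (rule graded_commutative_algebra.intro[OF KV.vectorspace_axioms K.ring_axioms],
        rule graded_commutative_algebra_axioms.intro) (fact 1 2 6 5 4 3)+
qed

end

section \<open>Differentials and the cohomology algebra\<close>

context dgca
begin

lemma differential_closed [simp, intro]: "x \<in> carrier A \<Longrightarrow> diff A x \<in> carrier A"
  and differential_add [simp]:
    "x \<in> carrier A \<Longrightarrow> y \<in> carrier A \<Longrightarrow> diff A (x \<oplus>\<^bsub>A\<^esub> y) = diff A x \<oplus>\<^bsub>A\<^esub> diff A y"
  and differential_smult [simp]:
    "a \<in> carrier F \<Longrightarrow> x \<in> carrier A \<Longrightarrow> diff A (a \<odot>\<^bsub>A\<^esub> x) = a \<odot>\<^bsub>A\<^esub> diff A x"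
  using diff_linear by (auto simp: linear_map_def mod_hom_def mod_hom_axioms_def module_hom_def)

lemma differential_zero [simp]: "diff A \<zero>\<^bsub>A\<^esub> = \<zero>\<^bsub>A\<^esub>"
  using differential_smult[of "\<zero>\<^bsub>F\<^esub>" "\<zero>\<^bsub>A\<^esub>"] by simp

lemma differential_minus [simp]: "x \<in> carrier A \<Longrightarrow> diff A (\<ominus>\<^bsub>A\<^esub> x) = \<ominus>\<^bsub>A\<^esub> diff A x"
  using differential_smult[of "\<ominus>\<^bsub>F\<^esub> \<one>\<^bsub>F\<^esub>" x] by (simp add: smult_l_minus)

lemma differential_diff [simp]:
  "x \<in> carrier A \<Longrightarrow> y \<in> carrier A \<Longrightarrow> diff A (x \<ominus>\<^bsub>A\<^esub> y) = diff A x \<ominus>\<^bsub>A\<^esub> diff A y"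
  by (simp add: a_minus_def)

text \<open>Degree 0 stands apart because nothing has degree -1. The first claim is used later to
  see that an exact element of degree 0 vanishes.\<close>

lemma part_differential:
  assumes "x \<in> carrier A"
  shows "part A (diff A x) 0 = \<zero>\<^bsub>A\<^esub>" "part A (diff A x) (Suc k) = diff A (part A x k)"
proof -
  have "part A (diff A x) 0 = \<zero>\<^bsub>A\<^esub> \<and> (\<forall>k. part A (diff A x) (Suc k) = diff A (part A x k))"
    using assms
  proof (induction rule: homog_induct)
    case (homog j y)
    then show ?case
      using diff_homog[of y j] by (auto simp: part_homogeneous[of _ "Suc j"] part_homogeneous[of _ j])
  qed auto
  then show "part A (diff A x) 0 = \<zero>\<^bsub>A\<^esub>" "part A (diff A x) (Suc k) = diff A (part A x k)"
    by auto
qed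

lemma cocyclesI: "x \<in> carrier A \<Longrightarrow> diff A x = \<zero>\<^bsub>A\<^esub> \<Longrightarrow> x \<in> cocycles A"
  by (simp add: cocycles_def)

lemma cocycles_closed [simp, intro]: "x \<in> cocycles A \<Longrightarrow> x \<in> carrier A"
  unfolding cocycles_def by blast

lemma cocycle_differential [simp]: "x \<in> cocycles A \<Longrightarrow> diff A x = \<zero>\<^bsub>A\<^esub>"
  unfolding cocycles_def by blast

lemma coboundaries_closed [simp, intro]: "x \<in> coboundaries A \<Longrightarrow> x \<in> carrier A"
  by (auto simp: coboundaries_def)

lemma coboundaries_cocycles [intro]: "x \<in> coboundaries A \<Longrightarrow> x \<in> cocycles A"
  by (rule cocyclesI) (auto simp: coboundaries_def diff_diff)

lemma differential_coboundary [simp, intro]: "x \<in> carrier A \<Longrightarrow> diff A x \<in> coboundaries A"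
  by (auto simp: coboundaries_def)

lemma coboundaries_zero [simp, intro]: "\<zero>\<^bsub>A\<^esub> \<in> coboundaries A"
  using differential_coboundary[of "\<zero>\<^bsub>A\<^esub>"] by simp

lemma coboundaries_add [intro]:
  "x \<in> coboundaries A \<Longrightarrow> y \<in> coboundaries A \<Longrightarrow> x \<oplus>\<^bsub>A\<^esub> y \<in> coboundaries A"
  unfolding coboundaries_def by (auto simp: differential_add[symmetric] simp del: differential_add)

lemma coboundaries_smult [intro]:
  "a \<in> carrier F \<Longrightarrow> x \<in> coboundaries A \<Longrightarrow> a \<odot>\<^bsub>A\<^esub> x \<in> coboundaries A"
  unfolding coboundaries_def by (auto simp: differential_smult[symmetric] simp del: differential_smult)

lemma coboundaries_minus [intro]: "x \<in> coboundaries A \<Longrightarrow> \<ominus>\<^bsub>A\<^esub> x \<in> coboundaries A"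
  using coboundaries_smult[of "\<ominus>\<^bsub>F\<^esub> \<one>\<^bsub>F\<^esub>" x] by (simp add: smult_l_minus)

lemma coboundaries_diff [intro]:
  "x \<in> coboundaries A \<Longrightarrow> y \<in> coboundaries A \<Longrightarrow> x \<ominus>\<^bsub>A\<^esub> y \<in> coboundaries A"
  unfolding a_minus_def by auto

lemma coboundaries_part [intro]:
  assumes "x \<in> coboundaries A"
  shows "part A x k \<in> coboundaries A"
proof -
  obtain u where "u \<in> carrier A" "x = diff A u"
    using assms by (auto simp: coboundaries_def)
  then show ?thesis
    by (cases k) (auto simp: part_differential)
qed

lemma cocycles_part [simp, intro]: "x \<in> cocycles A \<Longrightarrow> part A x k \<in> cocycles A"
  using part_differential(2)[of x k] by (intro cocyclesI) simp_all

lemma differential_one [simp]: "diff A \<one>\<^bsub>A\<^esub> = \<zero>\<^bsub>A\<^esub>"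
proof -
  have "diff A \<one>\<^bsub>A\<^esub> = diff A \<one>\<^bsub>A\<^esub> \<oplus>\<^bsub>A\<^esub> diff A \<one>\<^bsub>A\<^esub>"
    using leibniz[OF one_homog, of "\<one>\<^bsub>A\<^esub>"] by simp
  then show ?thesis
    by (metis add.l_cancel_one differential_closed one_closed)
qed

text \<open>The Leibniz rule is available only for a homogeneous left factor, hence the reduction to
  the parts of \<open>x\<close>.\<close>

lemma cocycles_mult [simp, intro]:
  assumes x: "x \<in> cocycles A" and y: "y \<in> cocycles A"
  shows "x \<otimes>\<^bsub>A\<^esub> y \<in> cocycles A"
proof -
  have "diff A (x \<otimes>\<^bsub>A\<^esub> y) = \<zero>\<^bsub>A\<^esub>"
  proof (rule graded_induct[of x])
    fix k
    show "diff A (part A x k \<otimes>\<^bsub>A\<^esub> y) = \<zero>\<^bsub>A\<^esub>"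
      using x y leibniz[of "part A x k" k y] by (simp add: a_minus_def)
  qed (use x y in \<open>auto simp: l_distr\<close>)
  then show ?thesis
    using x y by (intro cocyclesI) auto
qed

lemma coboundary_mult_cocycle [intro]:
  assumes x: "x \<in> coboundaries A" and y: "y \<in> cocycles A"
  shows "x \<otimes>\<^bsub>A\<^esub> y \<in> coboundaries A"
proof -
  obtain u where u: "u \<in> carrier A" "x = diff A u"
    using x by (auto simp: coboundaries_def)
  have "diff A (u \<otimes>\<^bsub>A\<^esub> y) = diff A u \<otimes>\<^bsub>A\<^esub> y"
    using u(1)
  proof (induction rule: homog_induct)
    case (homog k z)
    then show ?case
      using y leibniz[of z k y] by (simp add: a_minus_def)
  qed (use y in \<open>auto simp: l_distr\<close>)
  then show ?thesis
    using u y differential_coboundary[of "u \<otimes>\<^bsub>A\<^esub> y"] by simp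
qed

text \<open>Here the sign in the Leibniz rule depends on the degree of the cocycle, so the product
  with \<open>x\<close> need not be the differential of \<open>x\<close> times \<open>u\<close>.
  Each part of \<open>x\<close> is treated alone, and its sign is absorbed because coboundaries are
  closed under negation.\<close>

lemma cocycle_mult_coboundary [intro]:
  assumes x: "x \<in> cocycles A" and y: "y \<in> coboundaries A"
  shows "x \<otimes>\<^bsub>A\<^esub> y \<in> coboundaries A"
proof -
  obtain u where u: "u \<in> carrier A" "y = diff A u"
    using y by (auto simp: coboundaries_def)
  show ?thesis
  proof (rule graded_induct[of x])
    fix k
    let ?z = "part A x k"
    have "diff A (?z \<otimes>\<^bsub>A\<^esub> u) = (if even k then ?z \<otimes>\<^bsub>A\<^esub> y else \<ominus>\<^bsub>A\<^esub> (?z \<otimes>\<^bsub>A\<^esub> y))"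
      using x u leibniz[of ?z k u] by (simp add: a_minus_def)
    then have "?z \<otimes>\<^bsub>A\<^esub> y = (if even k then diff A (?z \<otimes>\<^bsub>A\<^esub> u) else \<ominus>\<^bsub>A\<^esub> diff A (?z \<otimes>\<^bsub>A\<^esub> u))"
      using x y by (auto split: if_splits)
    then show "?z \<otimes>\<^bsub>A\<^esub> y \<in> coboundaries A"
      using x u by auto
  qed (use x y in \<open>auto simp: l_distr\<close>)
qed

section \<open>Cohomology classes as cosets, and the operations on them\<close>

lemma coh_class_iff:
  assumes x: "x \<in> carrier A"
  shows "y \<in> coh_class A x \<longleftrightarrow> y \<in> carrier A \<and> y \<ominus>\<^bsub>A\<^esub> x \<in> coboundaries A"
proof -
  have "y \<in> coh_class A x \<longleftrightarrow> (\<exists>b\<in>coboundaries A. y = b \<oplus>\<^bsub>A\<^esub> x)"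
    by (auto simp: coh_class_def a_r_coset_def r_coset_def)
  also have "\<dots> \<longleftrightarrow> y \<in> carrier A \<and> y \<ominus>\<^bsub>A\<^esub> x \<in> coboundaries A"
  proof safe
    fix b assume b: "b \<in> coboundaries A"
    then have "b \<in> carrier A" by simp
    then have "(b \<oplus>\<^bsub>A\<^esub> x) \<ominus>\<^bsub>A\<^esub> x = b" using x by algebra
    then show "(b \<oplus>\<^bsub>A\<^esub> x) \<ominus>\<^bsub>A\<^esub> x \<in> coboundaries A" using b by simp
    show "b \<oplus>\<^bsub>A\<^esub> x \<in> carrier A" using b x by simp
  next
    assume y: "y \<in> carrier A" "y \<ominus>\<^bsub>A\<^esub> x \<in> coboundaries A"
    then have "y = (y \<ominus>\<^bsub>A\<^esub> x) \<oplus>\<^bsub>A\<^esub> x" using x by algebra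
    then show "\<exists>b\<in>coboundaries A. y = b \<oplus>\<^bsub>A\<^esub> x" using y by blast
  qed
  finally show ?thesis .
qed

lemma coh_class_self [simp, intro]: "x \<in> carrier A \<Longrightarrow> x \<in> coh_class A x"
  by (simp add: coh_class_iff a_minus_def r_neg)

lemma coh_class_eq_iff:
  assumes x: "x \<in> carrier A" and y: "y \<in> carrier A"
  shows "coh_class A x = coh_class A y \<longleftrightarrow> x \<ominus>\<^bsub>A\<^esub> y \<in> coboundaries A"
proof
  assume "coh_class A x = coh_class A y"
  then show "x \<ominus>\<^bsub>A\<^esub> y \<in> coboundaries A"
    using x y coh_class_self coh_class_iff by blast
next
  assume b: "x \<ominus>\<^bsub>A\<^esub> y \<in> coboundaries A"
  have "z \<in> coh_class A x \<longleftrightarrow> z \<in> coh_class A y" for z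
  proof (cases "z \<in> carrier A")
    case True
    have 1: "z \<ominus>\<^bsub>A\<^esub> y = (z \<ominus>\<^bsub>A\<^esub> x) \<oplus>\<^bsub>A\<^esub> (x \<ominus>\<^bsub>A\<^esub> y)" and 2: "z \<ominus>\<^bsub>A\<^esub> x = (z \<ominus>\<^bsub>A\<^esub> y) \<ominus>\<^bsub>A\<^esub> (x \<ominus>\<^bsub>A\<^esub> y)"
      using True x y by algebra+
    have "z \<ominus>\<^bsub>A\<^esub> x \<in> coboundaries A \<longleftrightarrow> z \<ominus>\<^bsub>A\<^esub> y \<in> coboundaries A"
      using coboundaries_add[OF _ b, folded 1] coboundaries_diff[OF _ b, folded 2] 1 2 by metis
    then show ?thesis
      using x y by (simp add: coh_class_iff)
  qed (use x y in \<open>simp add: coh_class_iff\<close>)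
  then show "coh_class A x = coh_class A y"
    by blast
qed

lemma coh_class_zero: "coh_class A \<zero>\<^bsub>A\<^esub> = coboundaries A"
  using coh_class_iff[of "\<zero>\<^bsub>A\<^esub>"] by (auto simp: a_minus_def)

text \<open>Scalar multiplication, products of cosets and \<open>cohomology_map\<close> are all
  defined as unions over a class; each is evaluated by showing that the family is constant on the
  class.\<close>

lemma coh_class_Union:
  assumes "x \<in> carrier A"
    and "\<And>y. y \<in> carrier A \<Longrightarrow> y \<ominus>\<^bsub>A\<^esub> x \<in> coboundaries A \<Longrightarrow> g y = g x"
  shows "(\<Union>y\<in>coh_class A x. g y) = g x"
  using assms coh_class_self[of x] by (auto simp: coh_class_iff)

lemma cohomology_simps [simp]:
  "carrier (cohomology A) = coh_class A ` cocycles A"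
  "homog (cohomology A) k = coh_class A ` (cocycles A \<inter> homog A k)"
  "\<zero>\<^bsub>cohomology A\<^esub> = coh_class A \<zero>\<^bsub>A\<^esub>"
  "\<one>\<^bsub>cohomology A\<^esub> = coh_class A \<one>\<^bsub>A\<^esub>"
  unfolding cohomology_def Let_def FactRing_def coh_class_zero
  by (auto simp: A_RCOSETS_def RCOSETS_def a_r_coset_def r_coset_def coh_class_def)

lemma cohomology_add [simp]:
  assumes x: "x \<in> carrier A" and y: "y \<in> carrier A"
  shows "coh_class A x \<oplus>\<^bsub>cohomology A\<^esub> coh_class A y = coh_class A (x \<oplus>\<^bsub>A\<^esub> y)"
proof -
  have "coh_class A x \<oplus>\<^bsub>cohomology A\<^esub> coh_class A y =
      (\<Union>u\<in>coh_class A x. \<Union>v\<in>coh_class A y. {u \<oplus>\<^bsub>A\<^esub> v})"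
    by (simp add: cohomology_def Let_def FactRing_def set_add_def set_mult_def)
  also have "\<dots> = coh_class A (x \<oplus>\<^bsub>A\<^esub> y)"
  proof (intro equalityI subsetI)
    fix z assume "z \<in> (\<Union>u\<in>coh_class A x. \<Union>v\<in>coh_class A y. {u \<oplus>\<^bsub>A\<^esub> v})"
    then obtain u v where uv: "u \<in> coh_class A x" "v \<in> coh_class A y" "z = u \<oplus>\<^bsub>A\<^esub> v" by auto
    then have "z \<ominus>\<^bsub>A\<^esub> (x \<oplus>\<^bsub>A\<^esub> y) = (u \<ominus>\<^bsub>A\<^esub> x) \<oplus>\<^bsub>A\<^esub> (v \<ominus>\<^bsub>A\<^esub> y)"
      using x y by (auto simp: coh_class_iff) algebra
    then show "z \<in> coh_class A (x \<oplus>\<^bsub>A\<^esub> y)"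
      using uv x y by (auto simp: coh_class_iff)
  next
    fix z assume z: "z \<in> coh_class A (x \<oplus>\<^bsub>A\<^esub> y)"
    then have zc: "z \<in> carrier A" and zb: "z \<ominus>\<^bsub>A\<^esub> (x \<oplus>\<^bsub>A\<^esub> y) \<in> coboundaries A"
      using x y by (auto simp: coh_class_iff)
    \<comment> \<open>Every element of the class of the sum is split with the representative
      \<open>y\<close> itself as second summand; the first summand then falls into the class of
      \<open>x\<close>.\<close>
    have 1: "z = (z \<ominus>\<^bsub>A\<^esub> y) \<oplus>\<^bsub>A\<^esub> y" and 2: "(z \<ominus>\<^bsub>A\<^esub> y) \<ominus>\<^bsub>A\<^esub> x = z \<ominus>\<^bsub>A\<^esub> (x \<oplus>\<^bsub>A\<^esub> y)"
      using zc x y by algebra+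
    have "z \<ominus>\<^bsub>A\<^esub> y \<in> coh_class A x"
      using 2 zc zb x y by (simp add: coh_class_iff)
    then show "z \<in> (\<Union>u\<in>coh_class A x. \<Union>v\<in>coh_class A y. {u \<oplus>\<^bsub>A\<^esub> v})"
      using 1 coh_class_self[OF y] by blast
  qed
  finally show ?thesis .
qed

lemma cohomology_mult [simp]:
  assumes x: "x \<in> cocycles A" and y: "y \<in> cocycles A"
  shows "coh_class A x \<otimes>\<^bsub>cohomology A\<^esub> coh_class A y = coh_class A (x \<otimes>\<^bsub>A\<^esub> y)"
proof -
  have "coh_class A x \<otimes>\<^bsub>cohomology A\<^esub> coh_class A y =
      (\<Union>u\<in>coh_class A x. \<Union>v\<in>coh_class A y. coh_class A (u \<otimes>\<^bsub>A\<^esub> v))"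
    by (simp add: cohomology_def Let_def FactRing_def rcoset_mult_def coh_class_def a_r_coset_def r_coset_def)
  \<comment> \<open>The representatives are exchanged one at a time: \<open>v\<close> by
    \<open>y\<close> while \<open>u\<close> stays arbitrary, which requires \<open>u\<close> to be a
    cocycle, and afterwards \<open>u\<close> by \<open>x\<close>.\<close>
  also have "\<dots> = (\<Union>u\<in>coh_class A x. coh_class A (u \<otimes>\<^bsub>A\<^esub> y))"
  proof (intro SUP_cong refl coh_class_Union)
    fix u v assume uv: "u \<in> coh_class A x" "v \<in> carrier A" "v \<ominus>\<^bsub>A\<^esub> y \<in> coboundaries A"
    have u: "u \<in> carrier A" using uv x by (simp add: coh_class_iff)
    have "u \<ominus>\<^bsub>A\<^esub> x \<in> cocycles A"
      using uv x by (auto simp: coh_class_iff)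
    then have "diff A (u \<ominus>\<^bsub>A\<^esub> x) = \<zero>\<^bsub>A\<^esub>"
      by (rule cocycle_differential)
    then have "u \<in> cocycles A"
      using u x by (intro cocyclesI) (simp_all add: a_minus_def)
    then have "u \<otimes>\<^bsub>A\<^esub> (v \<ominus>\<^bsub>A\<^esub> y) \<in> coboundaries A" using uv by auto
    moreover have "u \<otimes>\<^bsub>A\<^esub> (v \<ominus>\<^bsub>A\<^esub> y) = u \<otimes>\<^bsub>A\<^esub> v \<ominus>\<^bsub>A\<^esub> u \<otimes>\<^bsub>A\<^esub> y"
      using u uv y by (simp add: a_minus_def r_distr r_minus)
    ultimately show "coh_class A (u \<otimes>\<^bsub>A\<^esub> v) = coh_class A (u \<otimes>\<^bsub>A\<^esub> y)"
      using u uv y by (simp add: coh_class_eq_iff)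
  qed (use y in auto)
  also have "\<dots> = coh_class A (x \<otimes>\<^bsub>A\<^esub> y)"
  proof (intro coh_class_Union)
    fix u assume u: "u \<in> carrier A" "u \<ominus>\<^bsub>A\<^esub> x \<in> coboundaries A"
    have "(u \<ominus>\<^bsub>A\<^esub> x) \<otimes>\<^bsub>A\<^esub> y = u \<otimes>\<^bsub>A\<^esub> y \<ominus>\<^bsub>A\<^esub> x \<otimes>\<^bsub>A\<^esub> y"
      using u x y by (simp add: a_minus_def l_distr l_minus)
    then show "coh_class A (u \<otimes>\<^bsub>A\<^esub> y) = coh_class A (x \<otimes>\<^bsub>A\<^esub> y)"
      using u x y coboundary_mult_cocycle[of "u \<ominus>\<^bsub>A\<^esub> x" y] by (simp add: coh_class_eq_iff)
  qed (use x in auto)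
  finally show ?thesis .
qed

lemma cohomology_smult [simp]:
  assumes a: "a \<in> carrier F" and x: "x \<in> carrier A"
  shows "a \<odot>\<^bsub>cohomology A\<^esub> coh_class A x = coh_class A (a \<odot>\<^bsub>A\<^esub> x)"
proof -
  have "a \<odot>\<^bsub>A\<^esub> u \<ominus>\<^bsub>A\<^esub> a \<odot>\<^bsub>A\<^esub> x = a \<odot>\<^bsub>A\<^esub> (u \<ominus>\<^bsub>A\<^esub> x)" if "u \<in> carrier A" for u
    using that a x by (simp add: a_minus_def smult_r_distr smult_r_minus)
  then show ?thesis
    using a x coh_class_Union[of x "\<lambda>u. coh_class A (a \<odot>\<^bsub>A\<^esub> u)"]
    by (simp add: cohomology_def Let_def coh_class_eq_iff coboundaries_smult)
qed

lemma graded_subalgebra_cocycles: "graded_subalgebra F A (cocycles A)"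
  unfolding graded_subalgebra_def graded_subspace_def subspace_iff
  by (auto intro!: cocyclesI)

text \<open>The kernel of the class map is the set of coboundaries, and this is graded because the
  parts of an exact element are exact.\<close>

lemma cohomology_image: "graded_image F A (cocycles A) (cohomology A) (coh_class A)"
proof (intro graded_image.intro graded_image_axioms.intro graded_commutative_algebra_axioms
    graded_subalgebra_cocycles)
  fix x k
  assume "x \<in> cocycles A" "coh_class A x = \<zero>\<^bsub>cohomology A\<^esub>"
  then have "x \<in> coboundaries A"
    using coh_class_eq_iff[of x "\<zero>\<^bsub>A\<^esub>"] by (simp add: a_minus_def)
  then show "coh_class A (part A x k) = \<zero>\<^bsub>cohomology A\<^esub>"
    using coh_class_eq_iff[of "part A x k" "\<zero>\<^bsub>A\<^esub>"] by (auto simp: a_minus_def)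
qed auto

sublocale cohomology: graded_image F A "cocycles A" "cohomology A" "coh_class A"
  by (rule cohomology_image)

end

section \<open>Subquotients\<close>

locale dgca_image = dgca F A + graded_image F A C K f
  for F :: "('f, 'm) ring_scheme" and A :: "('f, 'a, 'x) dga_scheme"
    and C :: "'a set" and K :: "('f, 'b, 'y) dga_scheme" and f :: "'a \<Rightarrow> 'b" +
  assumes sub_differential [simp, intro]: "x \<in> C \<Longrightarrow> diff A x \<in> C"
    and image_differential: "x \<in> C \<Longrightarrow> f (diff A x) = diff K (f x)"
begin

lemma dgca_image: "dgca F K"
proof -
  interpret K: graded_commutative_algebra F K by (rule graded_commutative_image)
  note sym = image_add[symmetric] image_mult[symmetric] image_smult[symmetric]
    image_differential[symmetric]
  have "diff K \<in> module_hom F K K"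
    by (auto simp: module_hom_def carrier_image sym)
  then have 1: "linear_map F K K (diff K)"
    by (intro linear_map.intro mod_hom.intro mod_hom_axioms.intro K.vectorspace_axioms K.module_axioms)
  have 2: "diff K u \<in> homog K (Suc k)" if "u \<in> homog K k" for u k
    using that diff_homog by (auto simp: image_homog sym)
  have 3: "diff K (diff K u) = \<zero>\<^bsub>K\<^esub>" if "u \<in> carrier K" for u
    using that by (auto simp: carrier_image sym diff_diff image_zero)
  have 4: "diff K (u \<otimes>\<^bsub>K\<^esub> v) = (if even k then (diff K u \<otimes>\<^bsub>K\<^esub> v) \<oplus>\<^bsub>K\<^esub> (u \<otimes>\<^bsub>K\<^esub> diff K v)
       else (diff K u \<otimes>\<^bsub>K\<^esub> v) \<ominus>\<^bsub>K\<^esub> (u \<otimes>\<^bsub>K\<^esub> diff K v))"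
    if uv: "u \<in> homog K k" "v \<in> carrier K" for u v k
  proof -
    obtain x y where xy: "x \<in> C" "x \<in> homog A k" "u = f x" "y \<in> C" "v = f y"
      using uv unfolding image_homog carrier_image by blast
    have "f (diff A (x \<otimes>\<^bsub>A\<^esub> y)) = f (if even k then (diff A x \<otimes>\<^bsub>A\<^esub> y) \<oplus>\<^bsub>A\<^esub> (x \<otimes>\<^bsub>A\<^esub> diff A y)
       else (diff A x \<otimes>\<^bsub>A\<^esub> y) \<ominus>\<^bsub>A\<^esub> (x \<otimes>\<^bsub>A\<^esub> diff A y))"
      using leibniz[of x k y] xy by simp
    then show ?thesis
      using xy by (simp add: image_add image_mult image_diff image_differential split: if_splits)
  qed
  show ?thesis
    by (rule dgca.intro[OF K.graded_commutative_algebra_axioms], rule dgca_axioms.intro)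
      (fact 1 2 3 4)+
qed

end

text \<open>
  The carrier of the quotient of \<open>C\<close> consists of representatives chosen by \<open>p\<close> instead of cosets, so
  that it stays in the type \<open>'a\<close>; for \<open>p = (\<lambda>x. x)\<close> this is the subalgebra \<open>C\<close> itself.
\<close>

definition subquotient :: "('f, 'a, 'x) dga_scheme \<Rightarrow> 'a set \<Rightarrow> ('a \<Rightarrow> 'a) \<Rightarrow> ('f, 'a) dga" where
  "subquotient A C p =
     \<lparr>carrier = p ` C, mult = (\<lambda>x y. p (x \<otimes>\<^bsub>A\<^esub> y)), one = p \<one>\<^bsub>A\<^esub>, zero = p \<zero>\<^bsub>A\<^esub>,
      add = (\<lambda>x y. p (x \<oplus>\<^bsub>A\<^esub> y)), smult = (\<lambda>a x. p (a \<odot>\<^bsub>A\<^esub> x)),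
      homog = (\<lambda>k. p ` (C \<inter> homog A k)), diff = (\<lambda>x. p (diff A x))\<rparr>"

lemma subquotient_simps [simp]:
  "carrier (subquotient A C p) = p ` C"
  "x \<otimes>\<^bsub>subquotient A C p\<^esub> y = p (x \<otimes>\<^bsub>A\<^esub> y)"
  "\<one>\<^bsub>subquotient A C p\<^esub> = p \<one>\<^bsub>A\<^esub>"
  "\<zero>\<^bsub>subquotient A C p\<^esub> = p \<zero>\<^bsub>A\<^esub>"
  "x \<oplus>\<^bsub>subquotient A C p\<^esub> y = p (x \<oplus>\<^bsub>A\<^esub> y)"
  "a \<odot>\<^bsub>subquotient A C p\<^esub> x = p (a \<odot>\<^bsub>A\<^esub> x)"
  "homog (subquotient A C p) k = p ` (C \<inter> homog A k)"
  "diff (subquotient A C p) x = p (diff A x)"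
  by (simp_all add: subquotient_def)

text \<open>\<open>p\<close> selects representatives modulo the differential ideal \<open>N\<close>
  of \<open>C\<close>. Each operation of the subquotient is an operation of \<open>A\<close>
  followed by \<open>p\<close>, so compatibility always comes down to a congruence modulo
  \<open>N\<close>, settled by \<open>p_eqI\<close>.\<close>

lemma (in dgca) subquotient_image:
  assumes C: "graded_subalgebra F A C" and dC: "\<And>x. x \<in> C \<Longrightarrow> diff A x \<in> C"
    and N: "graded_subspace F A N" "N \<subseteq> C" and dN: "\<And>x. x \<in> N \<Longrightarrow> diff A x \<in> N"
    and NC: "\<And>x y. x \<in> N \<Longrightarrow> y \<in> C \<Longrightarrow> x \<otimes>\<^bsub>A\<^esub> y \<in> N"
    and CN: "\<And>x y. x \<in> C \<Longrightarrow> y \<in> N \<Longrightarrow> x \<otimes>\<^bsub>A\<^esub> y \<in> N"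
    and p_closed: "\<And>x. x \<in> C \<Longrightarrow> p x \<in> C" and p_N: "\<And>x. x \<in> C \<Longrightarrow> p x \<ominus>\<^bsub>A\<^esub> x \<in> N"
    and p_eqI: "\<And>x y. x \<in> C \<Longrightarrow> y \<in> C \<Longrightarrow> x \<ominus>\<^bsub>A\<^esub> y \<in> N \<Longrightarrow> p x = p y"
  shows "dgca_image F A C (subquotient A C p) p"
proof -
  have sub: "C \<subseteq> carrier A" "\<zero>\<^bsub>A\<^esub> \<in> C" "\<one>\<^bsub>A\<^esub> \<in> C"
    and closed: "\<And>x y. x \<in> C \<Longrightarrow> y \<in> C \<Longrightarrow> x \<oplus>\<^bsub>A\<^esub> y \<in> C" "\<And>x y. x \<in> C \<Longrightarrow> y \<in> C \<Longrightarrow> x \<otimes>\<^bsub>A\<^esub> y \<in> C"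
      "\<And>a x. a \<in> carrier F \<Longrightarrow> x \<in> C \<Longrightarrow> a \<odot>\<^bsub>A\<^esub> x \<in> C" "\<And>x k. x \<in> C \<Longrightarrow> part A x k \<in> C"
    using C unfolding graded_subalgebra_def graded_subspace_def subspace_iff by auto
  have N0: "\<zero>\<^bsub>A\<^esub> \<in> N"
    and N_closed: "\<And>x y. x \<in> N \<Longrightarrow> y \<in> N \<Longrightarrow> x \<oplus>\<^bsub>A\<^esub> y \<in> N"
      "\<And>a x. a \<in> carrier F \<Longrightarrow> x \<in> N \<Longrightarrow> a \<odot>\<^bsub>A\<^esub> x \<in> N" "\<And>x k. x \<in> N \<Longrightarrow> part A x k \<in> N"
    using N unfolding graded_subspace_def subspace_iff by auto
  have cl: "x \<in> C \<Longrightarrow> x \<in> carrier A" "x \<in> C \<Longrightarrow> p x \<in> carrier A" for x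
    using sub p_closed by auto
  have N_minus: "\<ominus>\<^bsub>A\<^esub> x \<in> N" if "x \<in> N" for x
    using N_closed(2)[of "\<ominus>\<^bsub>F\<^esub> \<one>\<^bsub>F\<^esub>" x] that N sub by (auto simp: smult_l_minus)
  have p_N': "x \<ominus>\<^bsub>A\<^esub> p x \<in> N" if "x \<in> C" for x
  proof -
    have "x \<ominus>\<^bsub>A\<^esub> p x = \<ominus>\<^bsub>A\<^esub> (p x \<ominus>\<^bsub>A\<^esub> x)"
      using that cl[OF that] by algebra
    then show ?thesis using p_N[OF that] N_minus by simp
  qed
  \<comment> \<open>The kernel of \<open>p\<close> is contained in \<open>N\<close>; as
    \<open>p\<close> need not send zero to zero, the condition compares with the representative of
    zero.\<close>
  have zero: "x \<in> N" if "x \<in> C" "p x = p \<zero>\<^bsub>A\<^esub>" for x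
  proof -
    have "x = (x \<ominus>\<^bsub>A\<^esub> p x) \<oplus>\<^bsub>A\<^esub> (p \<zero>\<^bsub>A\<^esub> \<ominus>\<^bsub>A\<^esub> \<zero>\<^bsub>A\<^esub>)"
      using that cl[OF that(1)] cl(2)[OF sub(2)] by (simp add: a_minus_def a_assoc l_neg)
    then show ?thesis
      using p_N'[OF that(1)] p_N[OF sub(2)] N_closed(1) by metis
  qed
  have add: "p (x \<oplus>\<^bsub>A\<^esub> y) = p (p x \<oplus>\<^bsub>A\<^esub> p y)" if "x \<in> C" "y \<in> C" for x y
  proof (rule p_eqI)
    have "(x \<oplus>\<^bsub>A\<^esub> y) \<ominus>\<^bsub>A\<^esub> (p x \<oplus>\<^bsub>A\<^esub> p y) = (x \<ominus>\<^bsub>A\<^esub> p x) \<oplus>\<^bsub>A\<^esub> (y \<ominus>\<^bsub>A\<^esub> p y)"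
      using that[THEN cl(1)] that[THEN cl(2)] by algebra
    then show "(x \<oplus>\<^bsub>A\<^esub> y) \<ominus>\<^bsub>A\<^esub> (p x \<oplus>\<^bsub>A\<^esub> p y) \<in> N"
      using that p_N' N_closed(1) by simp
  qed (use that closed p_closed in auto)
  have mult: "p (x \<otimes>\<^bsub>A\<^esub> y) = p (p x \<otimes>\<^bsub>A\<^esub> p y)" if "x \<in> C" "y \<in> C" for x y
  proof (rule p_eqI)
    \<comment> \<open>Changing one factor at a time uses \<open>N\<close> once as a right and once
      as a left ideal.\<close>
    have "x \<otimes>\<^bsub>A\<^esub> y \<ominus>\<^bsub>A\<^esub> p x \<otimes>\<^bsub>A\<^esub> p y = (x \<ominus>\<^bsub>A\<^esub> p x) \<otimes>\<^bsub>A\<^esub> y \<oplus>\<^bsub>A\<^esub> p x \<otimes>\<^bsub>A\<^esub> (y \<ominus>\<^bsub>A\<^esub> p y)"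
      using that[THEN cl(1)] that[THEN cl(2)]
      by (simp add: a_minus_def l_distr r_distr l_minus r_minus a_assoc r_neg1)
    then show "x \<otimes>\<^bsub>A\<^esub> y \<ominus>\<^bsub>A\<^esub> p x \<otimes>\<^bsub>A\<^esub> p y \<in> N"
      using that p_N' N_closed(1) NC CN p_closed by simp
  qed (use that closed p_closed in auto)
  have smult: "p (a \<odot>\<^bsub>A\<^esub> x) = p (a \<odot>\<^bsub>A\<^esub> p x)" if "a \<in> carrier F" "x \<in> C" for a x
  proof (rule p_eqI)
    have "a \<odot>\<^bsub>A\<^esub> x \<ominus>\<^bsub>A\<^esub> a \<odot>\<^bsub>A\<^esub> p x = a \<odot>\<^bsub>A\<^esub> (x \<ominus>\<^bsub>A\<^esub> p x)"
      using that(1) cl[OF that(2)] by (simp add: a_minus_def smult_r_distr smult_r_minus)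
    then show "a \<odot>\<^bsub>A\<^esub> x \<ominus>\<^bsub>A\<^esub> a \<odot>\<^bsub>A\<^esub> p x \<in> N"
      using that p_N' N_closed(2) by simp
  qed (use that closed p_closed in auto)
  have differential: "p (diff A x) = p (diff A (p x))" if "x \<in> C" for x
  proof (rule p_eqI)
    show "diff A x \<ominus>\<^bsub>A\<^esub> diff A (p x) \<in> N"
      using dN[OF p_N'[OF that]] cl[OF that] by simp
  qed (use that dC p_closed in auto)
  have part: "p (part A x k) = p \<zero>\<^bsub>A\<^esub>" if "x \<in> C" "p x = p \<zero>\<^bsub>A\<^esub>" for x k
    using N_closed(3)[OF zero[OF that], of k] that closed sub cl[OF that(1)]
    by (intro p_eqI) (auto simp: a_minus_def)
  show ?thesis
    by (intro dgca_image.intro graded_image.intro graded_image_axioms.intro dgca_image_axioms.intro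
        dgca_axioms graded_commutative_algebra_axioms C)
      (simp_all add: add mult smult differential part dC)
qed

lemma (in dgca) restriction_image:
  assumes C: "graded_subalgebra F A C" and dC: "\<And>x. x \<in> C \<Longrightarrow> diff A x \<in> C"
  shows "dgca_image F A C (subquotient A C (\<lambda>x. x)) (\<lambda>x. x)"
proof -
  have sub: "C \<subseteq> carrier A" "\<zero>\<^bsub>A\<^esub> \<in> C"
    using C unfolding graded_subalgebra_def graded_subspace_def subspace_iff by auto
  then show ?thesis
    by (intro subquotient_image[where N = "{\<zero>\<^bsub>A\<^esub>}"] C dC)
      (auto simp: graded_subspace_def subspace_iff a_minus_def r_neg minus_eq_zero_iff[unfolded a_minus_def] subsetD)
qed

text \<open>Source and target are both images of subalgebras of the same \<open>A\<close>, so a map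
  that agrees with the two projections respects all structure. It yields both the inclusion of the
  small algebra and the projection to the quotient.\<close>

lemma dgca_homI:
  assumes "dgca_image F A C K f" "dgca_image F A C' K' f'" "C \<subseteq> C'"
    and "\<And>x. x \<in> C \<Longrightarrow> g (f x) = f' x"
  shows "dgca_hom F K K' g"
proof -
  interpret K: dgca_image F A C K f by fact
  interpret K': dgca_image F A C' K' f' by fact
  note sym = K.image_add[symmetric] K.image_mult[symmetric] K.image_smult[symmetric]
    K.image_differential[symmetric] K.image_one[symmetric]
  show ?thesis
    unfolding dgca_hom_def
  proof (intro conjI ballI allI)
    show "g \<in> ring_hom K K'"
      using assms(3,4) by (intro ring_hom_memI)
        (auto simp: K.carrier_image sym K'.image_add K'.image_mult K'.image_one K'.carrier_image subset_iff)
    show "g ` homog K k \<subseteq> homog K' k" for k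
      using assms(3,4) by (auto simp: K.image_homog K'.image_homog)
  qed (use assms(3,4) in \<open>auto simp: K.dgca_image K'.dgca_image K.carrier_image sym
        K'.image_smult K'.image_differential subset_iff\<close>)
qed

section \<open>Transport of Poincare structures along quasi-isomorphisms\<close>

text \<open>Presents \<open>A\<close> as an image of itself, so that \<open>dgca_homI\<close> also
  covers maps into \<open>A\<close>.\<close>

lemma (in dgca) identity_image: "dgca_image F A (carrier A) A (\<lambda>x. x)"
  by (intro dgca_image.intro graded_image.intro graded_image_axioms.intro dgca_image_axioms.intro
      dgca_axioms graded_commutative_algebra_axioms)
    (auto simp: graded_subalgebra_def graded_subspace_def subspace_iff)

text \<open>Replaces spans by a quantification over subspaces, which can be carried along a linear
  map by taking images or preimages of the subspaces.\<close>

lemma (in vectorspace) fin_dim_iff: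
  "fin_dim \<longleftrightarrow> (\<exists>S. finite S \<and> S \<subseteq> carrier V \<and>
     (\<forall>W. VectorSpace.subspace K W V \<longrightarrow> S \<subseteq> W \<longrightarrow> carrier V \<subseteq> W))"
proof -
  have "span S = carrier V \<longleftrightarrow> (\<forall>W. VectorSpace.subspace K W V \<longrightarrow> S \<subseteq> W \<longrightarrow> carrier V \<subseteq> W)"
    if S: "S \<subseteq> carrier V" for S
    using span_is_subspace[OF S] in_own_span[OF S] span_is_subset2[OF S] span_is_subset[of S]
    by (metis VectorSpace.subspace_def subset_antisym)
  then show ?thesis
    unfolding fin_dim_def by (simp cong: conj_cong)
qed

definition graded_iso :: "('f, 'm) ring_scheme \<Rightarrow> ('f, 'a, 'x) graded_algebra_scheme \<Rightarrow>
    ('f, 'b, 'y) graded_algebra_scheme \<Rightarrow> ('a \<Rightarrow> 'b) \<Rightarrow> bool" where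
  "graded_iso F H K g \<longleftrightarrow>
     bij_betw g (carrier H) (carrier K) \<and> g \<in> ring_hom H K \<and>
     (\<forall>a\<in>carrier F. \<forall>x\<in>carrier H. g (a \<odot>\<^bsub>H\<^esub> x) = a \<odot>\<^bsub>K\<^esub> g x) \<and>
     (\<forall>k. g ` homog H k \<subseteq> homog K k)"

locale graded_isomorphism = H: graded_commutative_algebra F H + K: graded_commutative_algebra F K
  for F :: "('f, 'm) ring_scheme" and H :: "('f, 'a, 'x) graded_algebra_scheme"
    and K :: "('f, 'b, 'y) graded_algebra_scheme" +
  fixes g :: "'a \<Rightarrow> 'b"
  assumes graded_iso: "graded_iso F H K g"
begin

lemma iso_closed [simp, intro]: "x \<in> carrier H \<Longrightarrow> g x \<in> carrier K"
  and iso_add [simp]: "x \<in> carrier H \<Longrightarrow> y \<in> carrier H \<Longrightarrow> g (x \<oplus>\<^bsub>H\<^esub> y) = g x \<oplus>\<^bsub>K\<^esub> g y"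
  and iso_mult [simp]: "x \<in> carrier H \<Longrightarrow> y \<in> carrier H \<Longrightarrow> g (x \<otimes>\<^bsub>H\<^esub> y) = g x \<otimes>\<^bsub>K\<^esub> g y"
  and iso_one [simp]: "g \<one>\<^bsub>H\<^esub> = \<one>\<^bsub>K\<^esub>"
  and iso_smult [simp]: "a \<in> carrier F \<Longrightarrow> x \<in> carrier H \<Longrightarrow> g (a \<odot>\<^bsub>H\<^esub> x) = a \<odot>\<^bsub>K\<^esub> g x"
  and iso_homog [simp, intro]: "x \<in> homog H k \<Longrightarrow> g x \<in> homog K k"
  using graded_iso unfolding graded_iso_def
  by (auto simp: ring_hom_add ring_hom_mult ring_hom_one ring_hom_closed image_subset_iff)

lemma iso_zero [simp]: "g \<zero>\<^bsub>H\<^esub> = \<zero>\<^bsub>K\<^esub>"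
  using iso_smult[of "\<zero>\<^bsub>F\<^esub>" "\<zero>\<^bsub>H\<^esub>"] by simp

lemma iso_inj: "inj_on g (carrier H)"
  and iso_surj: "g ` carrier H = carrier K"
  using graded_iso unfolding graded_iso_def bij_betw_def by auto

lemma iso_eq_iff: "x \<in> carrier H \<Longrightarrow> y \<in> carrier H \<Longrightarrow> g x = g y \<longleftrightarrow> x = y"
  using iso_inj by (auto simp: inj_on_def)

lemma iso_eq_zero_iff: "x \<in> carrier H \<Longrightarrow> g x = \<zero>\<^bsub>K\<^esub> \<longleftrightarrow> x = \<zero>\<^bsub>H\<^esub>"
  using iso_eq_iff[of x "\<zero>\<^bsub>H\<^esub>"] by simp

lemma part_iso [simp]:
  assumes "x \<in> carrier H"
  shows "part K (g x) k = g (part H x k)"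
  using assms
proof (induction rule: H.homog_induct)
  case (homog j y)
  then have "g y \<in> homog K j" by auto
  then show ?case
    using homog by (simp add: H.part_homogeneous[of _ j] K.part_homogeneous[of _ j])
qed simp

text \<open>Only the grading needs an argument, since a bijection respecting degrees could a priori
  have an inverse that does not. If the image of \<open>x\<close> has degree \<open>k\<close>, the
  other parts of \<open>x\<close> are sent to zero and vanish by injectivity.\<close>

lemma inverse_iso: "graded_iso F K H (inv_into (carrier H) g)"
proof -
  let ?g = "inv_into (carrier H) g"
  have inv: "?g (g x) = x" if "x \<in> carrier H" for x
    using iso_inj that by (rule inv_into_f_f)
  have surj: "\<exists>x\<in>carrier H. u = g x" if "u \<in> carrier K" for u
    using that iso_surj by auto
  have "bij_betw ?g (carrier K) (carrier H)"
    using iso_inj iso_surj by (simp add: bij_betw_inv_into bij_betw_def[of g])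
  moreover have "?g \<in> ring_hom K H"
    using surj by (intro ring_hom_memI)
      (auto simp: inv simp flip: iso_add iso_mult iso_one dest!: surj)
  moreover have "?g (a \<odot>\<^bsub>K\<^esub> u) = a \<odot>\<^bsub>H\<^esub> ?g u" if "a \<in> carrier F" "u \<in> carrier K" for a u
    using that by (auto simp: inv simp flip: iso_smult dest!: surj)
  moreover have "?g u \<in> homog H k" if u: "u \<in> homog K k" for u k
  proof -
    obtain x where x: "x \<in> carrier H" "u = g x"
      using surj u by blast
    have "part H x j = \<zero>\<^bsub>H\<^esub>" if "j \<noteq> k" for j
      using K.part_other[OF u that] x by (simp add: iso_eq_zero_iff)
    then show ?thesis
      using x by (simp add: inv H.homogI)
  qed
  ultimately show ?thesis
    unfolding graded_iso_def by auto
qed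

text \<open>The functional is composed with \<open>g\<close>, and the pairing is preserved because
  \<open>g\<close> commutes with products and parts. Spanning sets are transported backwards along
  \<open>g\<close>.\<close>

lemma poincare_pullback:
  assumes "poincare_algebra F n K \<phi>"
  shows "poincare_algebra F n H (\<lambda>x. \<phi> (g x))"
proof -
  interpret P: poincare_algebra F n K \<phi> by fact
  obtain S where S: "finite S" "S \<subseteq> carrier K"
    "\<And>W. VectorSpace.subspace F W K \<Longrightarrow> S \<subseteq> W \<Longrightarrow> carrier K \<subseteq> W"
    using P.finite_dimensional unfolding K.fin_dim_iff by blast
  let ?g = "inv_into (carrier H) g"
  have gS: "?g u \<in> carrier H" "g (?g u) = u" if "u \<in> carrier K" for u
    using that iso_surj by (auto intro: inv_into_into f_inv_into_f)
  have "carrier H \<subseteq> W" if W: "VectorSpace.subspace F W H" "?g ` S \<subseteq> W" for W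
  proof -
    have "VectorSpace.subspace F (g ` W) K"
      using W(1) unfolding H.subspace_iff K.subspace_iff
      by (auto simp: image_iff subset_iff simp flip: iso_add iso_smult iso_zero)
    moreover have "S \<subseteq> g ` W"
    proof
      fix u assume u: "u \<in> S"
      then have "?g u \<in> W" using W(2) by blast
      then show "u \<in> g ` W" using gS(2)[of u] u S(2) by (metis image_eqI subsetD)
    qed
    ultimately have "carrier K \<subseteq> g ` W"
      by (rule S(3))
    moreover have "W \<subseteq> carrier H"
      using W(1) unfolding H.subspace_iff by blast
    ultimately show ?thesis
    proof (intro subsetI)
      fix x assume x: "x \<in> carrier H" and sub: "carrier K \<subseteq> g ` W" "W \<subseteq> carrier H"
      then obtain w where "w \<in> W" "g x = g w" by blast
      then show "x \<in> W" using x sub iso_eq_iff[of x w] by auto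
    qed
  qed
  then have "H.fin_dim"
    unfolding H.fin_dim_iff using S gS by (intro exI[of _ "?g ` S"]) auto
  moreover have "homog H k = {\<zero>\<^bsub>H\<^esub>}" if "k > n" for k
  proof -
    have "x = \<zero>\<^bsub>H\<^esub>" if "x \<in> homog H k" for x
      using iso_homog[OF that] iso_eq_zero_iff[of x] that P.homog_above[OF \<open>k > n\<close>] by simp
    then show ?thesis by auto
  qed
  moreover have "nondegenerate_pairing F n H (\<lambda>x. \<phi> (g x))"
  proof -
    have "pairing F n H (\<lambda>x. \<phi> (g x)) x y = pairing F n K \<phi> (g x) (g y)"
      if "x \<in> carrier H" "y \<in> carrier H" for x y
      using that by (simp add: pairing_def)
    then show ?thesis
      using P.nondegenerate iso_eq_zero_iff iso_closed
      unfolding nondegenerate_pairing_def iso_surj[symmetric] by (simp add: image_iff)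
  qed
  ultimately show ?thesis
    using P.integral_closed P.integral_add P.integral_smult
    by (intro poincare_algebra.intro poincare_algebra_axioms.intro H.graded_commutative_algebra_axioms)
      auto
qed

end

section \<open>Morphisms, quasi-isomorphisms and the functional on top cohomology\<close>

locale dgca_morphism = A: dgca F A + B: dgca F B
  for F :: "('f, 'm) ring_scheme" and A :: "('f, 'a, 'x) dga_scheme"
    and B :: "('f, 'b, 'y) dga_scheme" +
  fixes f :: "'a \<Rightarrow> 'b"
  assumes hom: "dgca_hom F A B f"
begin

lemma hom_closed [simp, intro]: "x \<in> carrier A \<Longrightarrow> f x \<in> carrier B"
  and hom_add [simp]: "x \<in> carrier A \<Longrightarrow> y \<in> carrier A \<Longrightarrow> f (x \<oplus>\<^bsub>A\<^esub> y) = f x \<oplus>\<^bsub>B\<^esub> f y"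
  and hom_mult [simp]: "x \<in> carrier A \<Longrightarrow> y \<in> carrier A \<Longrightarrow> f (x \<otimes>\<^bsub>A\<^esub> y) = f x \<otimes>\<^bsub>B\<^esub> f y"
  and hom_one [simp]: "f \<one>\<^bsub>A\<^esub> = \<one>\<^bsub>B\<^esub>"
  and hom_smult [simp]: "a \<in> carrier F \<Longrightarrow> x \<in> carrier A \<Longrightarrow> f (a \<odot>\<^bsub>A\<^esub> x) = a \<odot>\<^bsub>B\<^esub> f x"
  and hom_homog [simp, intro]: "x \<in> homog A k \<Longrightarrow> f x \<in> homog B k"
  and hom_differential: "x \<in> carrier A \<Longrightarrow> f (diff A x) = diff B (f x)"
  using hom unfolding dgca_hom_def
  by (auto simp: ring_hom_add ring_hom_mult ring_hom_one ring_hom_closed image_subset_iff)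

lemma hom_zero [simp]: "f \<zero>\<^bsub>A\<^esub> = \<zero>\<^bsub>B\<^esub>"
  using hom_smult[of "\<zero>\<^bsub>F\<^esub>" "\<zero>\<^bsub>A\<^esub>"] by simp

lemma hom_minus [simp]: "x \<in> carrier A \<Longrightarrow> f (\<ominus>\<^bsub>A\<^esub> x) = \<ominus>\<^bsub>B\<^esub> f x"
  using hom_smult[of "\<ominus>\<^bsub>F\<^esub> \<one>\<^bsub>F\<^esub>" x] by (simp add: A.smult_l_minus B.smult_l_minus)

lemma hom_diff [simp]: "x \<in> carrier A \<Longrightarrow> y \<in> carrier A \<Longrightarrow> f (x \<ominus>\<^bsub>A\<^esub> y) = f x \<ominus>\<^bsub>B\<^esub> f y"
  by (simp add: a_minus_def)

lemma hom_cocycles [simp, intro]: "x \<in> cocycles A \<Longrightarrow> f x \<in> cocycles B"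
  by (intro B.cocyclesI) (simp_all flip: hom_differential)

lemma hom_coboundaries [intro]: "x \<in> coboundaries A \<Longrightarrow> f x \<in> coboundaries B"
  unfolding coboundaries_def by (auto simp: hom_differential)

lemma cohomology_map_class [simp]:
  assumes "x \<in> cocycles A"
  shows "cohomology_map B f (coh_class A x) = coh_class B (f x)"
  unfolding cohomology_map_def
proof (rule A.coh_class_Union)
  fix y assume y: "y \<in> carrier A" "y \<ominus>\<^bsub>A\<^esub> x \<in> coboundaries A"
  then have "f y \<ominus>\<^bsub>B\<^esub> f x \<in> coboundaries B"
    using hom_coboundaries[OF y(2)] assms by simp
  then show "coh_class B (f y) = coh_class B (f x)"
    using assms y by (simp add: B.coh_class_eq_iff)
qed (use assms in auto)

text \<open>Trades cosets for elements: injectivity needs to be checked only at the zero class, and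
  surjectivity becomes solvability up to a coboundary.\<close>

lemma quasi_isomorphismI:
  assumes inj: "\<And>x. x \<in> cocycles A \<Longrightarrow> f x \<in> coboundaries B \<Longrightarrow> x \<in> coboundaries A"
    and surj: "\<And>y. y \<in> cocycles B \<Longrightarrow> \<exists>x\<in>cocycles A. y \<ominus>\<^bsub>B\<^esub> f x \<in> coboundaries B"
  shows "quasi_isomorphism F A B f"
  unfolding quasi_isomorphism_def
proof (intro conjI hom bij_betwI')
  fix X Y assume "X \<in> carrier (cohomology A)" "Y \<in> carrier (cohomology A)"
  then obtain x y where xy: "x \<in> cocycles A" "X = coh_class A x" "y \<in> cocycles A" "Y = coh_class A y"
    by auto
  have "x \<ominus>\<^bsub>A\<^esub> y \<in> cocycles A"
    using xy by (intro A.cocyclesI) (simp_all add: a_minus_def)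
  then have "f x \<ominus>\<^bsub>B\<^esub> f y \<in> coboundaries B \<longleftrightarrow> x \<ominus>\<^bsub>A\<^esub> y \<in> coboundaries A"
    using inj[of "x \<ominus>\<^bsub>A\<^esub> y"] hom_coboundaries[of "x \<ominus>\<^bsub>A\<^esub> y"] xy by auto
  then show "cohomology_map B f X = cohomology_map B f Y \<longleftrightarrow> X = Y"
    using xy by (simp add: A.coh_class_eq_iff B.coh_class_eq_iff)
next
  fix X assume "X \<in> carrier (cohomology A)"
  then show "cohomology_map B f X \<in> carrier (cohomology B)"
    by auto
next
  fix Y assume "Y \<in> carrier (cohomology B)"
  then obtain y where y: "y \<in> cocycles B" "Y = coh_class B y"
    by auto
  then obtain x where "x \<in> cocycles A" "y \<ominus>\<^bsub>B\<^esub> f x \<in> coboundaries B"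
    using surj by blast
  then show "\<exists>X\<in>carrier (cohomology A). Y = cohomology_map B f X"
    using y by (auto simp: B.coh_class_eq_iff)
qed

lemma quasi_isomorphism_graded_iso:
  assumes "quasi_isomorphism F A B f"
  shows "graded_isomorphism F (cohomology A) (cohomology B) (cohomology_map B f)"
proof -
  have "cohomology_map B f \<in> ring_hom (cohomology A) (cohomology B)"
    by (intro ring_hom_memI) auto
  then have "graded_iso F (cohomology A) (cohomology B) (cohomology_map B f)"
    using assms unfolding graded_iso_def quasi_isomorphism_def by auto
  then show ?thesis
    by (intro graded_isomorphism.intro graded_isomorphism_axioms.intro
        A.cohomology.graded_commutative_image B.cohomology.graded_commutative_image)
qed

end

text \<open>The values of the transported functional are recorded together with its existence, since
  the pairings have to be compared later. This version serves the inclusion of the small algebra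
  into \<open>A\<close>.\<close>

lemma quasi_isomorphism_poincare_source:
  assumes f: "quasi_isomorphism F A B f" and "poincare_algebra F n (cohomology B) \<iota>"
  shows "\<exists>\<kappa>. poincare_algebra F n (cohomology A) \<kappa> \<and>
     (\<forall>x\<in>cocycles A. \<kappa> (coh_class A x) = \<iota> (coh_class B (f x)))"
proof -
  interpret dgca_morphism F A B f
    using f by (intro dgca_morphism.intro dgca_morphism_axioms.intro)
      (auto simp: quasi_isomorphism_def dgca_hom_def)
  interpret graded_isomorphism F "cohomology A" "cohomology B" "cohomology_map B f"
    using f by (rule quasi_isomorphism_graded_iso)
  show ?thesis
    using poincare_pullback[OF assms(2)]
    by (intro exI[of _ "\<lambda>X. \<iota> (cohomology_map B f X)"]) auto
qed

text \<open>Here the functional travels with the arrow, through the inverse of the map on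
  cohomology. It serves the projection onto the quotient.\<close>

lemma quasi_isomorphism_poincare_target:
  assumes f: "quasi_isomorphism F A B f" and "poincare_algebra F n (cohomology A) \<iota>"
  shows "\<exists>\<kappa>. poincare_algebra F n (cohomology B) \<kappa> \<and>
     (\<forall>x\<in>cocycles A. \<kappa> (coh_class B (f x)) = \<iota> (coh_class A x))"
proof -
  interpret dgca_morphism F A B f
    using f by (intro dgca_morphism.intro dgca_morphism_axioms.intro)
      (auto simp: quasi_isomorphism_def dgca_hom_def)
  interpret g: graded_isomorphism F "cohomology A" "cohomology B" "cohomology_map B f"
    using f by (rule quasi_isomorphism_graded_iso)
  let ?h = "inv_into (carrier (cohomology A)) (cohomology_map B f)"
  interpret h: graded_isomorphism F "cohomology B" "cohomology A" ?h
    by (intro graded_isomorphism.intro graded_isomorphism_axioms.intro g.inverse_iso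
        A.cohomology.graded_commutative_image B.cohomology.graded_commutative_image)
  have "?h (coh_class B (f x)) = coh_class A x" if "x \<in> cocycles A" for x
    using inv_into_f_f[OF g.iso_inj, of "coh_class A x"] that by simp
  then show ?thesis
    using h.poincare_pullback[OF assms(2)]
    by (intro exI[of _ "\<lambda>X. \<iota> (?h X)"]) auto
qed

text \<open>Turns the sum over degree splittings into a single value of \<open>\<phi>\<close> on the
  product. Both sides are additive in each argument, and for homogeneous arguments at most one
  splitting contributes.\<close>

lemma (in graded_commutative_algebra) pairing_eq:
  assumes \<phi>: "\<And>x. x \<in> homog A n \<Longrightarrow> \<phi> x \<in> carrier F"
    "\<And>x y. x \<in> homog A n \<Longrightarrow> y \<in> homog A n \<Longrightarrow> \<phi> (x \<oplus>\<^bsub>A\<^esub> y) = \<phi> x \<oplus>\<^bsub>F\<^esub> \<phi> y"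
    "\<phi> \<zero>\<^bsub>A\<^esub> = \<zero>\<^bsub>F\<^esub>"
    and x: "x \<in> carrier A" and y: "y \<in> carrier A"
  shows "pairing F n A \<phi> x y = \<phi> (part A (x \<otimes>\<^bsub>A\<^esub> y) n)"
proof -
  \<comment> \<open>\<open>\<phi>\<close> is controlled on degree \<open>n\<close> only, so every
    summand must first be placed there; \<open>k \<le> n\<close> makes the truncated difference
    harmless.\<close>
  have degree: "part A x k \<otimes>\<^bsub>A\<^esub> part A y (n - k) \<in> homog A n"
    if "x \<in> carrier A" "y \<in> carrier A" "k \<le> n" for x y k
    using mult_homog[of "part A x k" k "part A y (n - k)" "n - k"] that by simp
  have summand: "\<phi> (part A x k \<otimes>\<^bsub>A\<^esub> part A y (n - k)) \<in> carrier F"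
    if "x \<in> carrier A" "y \<in> carrier A" "k \<le> n" for x y k
    using degree[OF that] \<phi> by simp
  have hom: "pairing F n A \<phi> x y = \<phi> (part A (x \<otimes>\<^bsub>A\<^esub> y) n)"
    if x: "x \<in> homog A i" and y: "y \<in> homog A j" for x y i j
  proof (cases "i + j = n")
    case True
    have "pairing F n A \<phi> x y = (\<Oplus>\<^bsub>F\<^esub>k\<in>{..n}. if k = i then \<phi> (x \<otimes>\<^bsub>A\<^esub> y) else \<zero>\<^bsub>F\<^esub>)"
      unfolding pairing_def using x y True mult_homog[OF x y]
      by (intro R.finsum_cong') (auto simp: part_homogeneous[of _ i] part_homogeneous[of _ j] \<phi>)
    also have "\<dots> = \<phi> (x \<otimes>\<^bsub>A\<^esub> y)"
      using True mult_homog[OF x y] \<phi>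
      by (intro R.add.finprod_singleton_swap) auto
    finally show ?thesis
      using True mult_homog[OF x y] by simp
  next
    case False
    have "pairing F n A \<phi> x y = (\<Oplus>\<^bsub>F\<^esub>k\<in>{..n}. \<zero>\<^bsub>F\<^esub>)"
      unfolding pairing_def using x y False
      by (intro R.finsum_cong') (auto simp: part_homogeneous[of _ i] part_homogeneous[of _ j] \<phi>)
    then show ?thesis
      using False part_other[OF mult_homog[OF x y], of n] \<phi> by simp
  qed
  show ?thesis
    using x
  proof (induction rule: homog_induct)
    case (homog i x)
    show ?case
      using y
    proof (induction rule: homog_induct)
      case (homog j y)
      then show ?case using hom \<open>x \<in> homog A i\<close> by blast
    next
      case (add y z)
      have "pairing F n A \<phi> x (y \<oplus>\<^bsub>A\<^esub> z) =
          (\<Oplus>\<^bsub>F\<^esub>k\<in>{..n}. \<phi> (part A x k \<otimes>\<^bsub>A\<^esub> part A y (n - k)) \<oplus>\<^bsub>F\<^esub> \<phi> (part A x k \<otimes>\<^bsub>A\<^esub> part A z (n - k)))"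
        unfolding pairing_def using homog add degree summand
        by (intro R.finsum_cong') (auto simp: r_distr \<phi>)
      also have "\<dots> = pairing F n A \<phi> x y \<oplus>\<^bsub>F\<^esub> pairing F n A \<phi> x z"
        unfolding pairing_def using homog add summand by (intro R.finsum_addf) auto
      finally have "pairing F n A \<phi> x (y \<oplus>\<^bsub>A\<^esub> z) = pairing F n A \<phi> x y \<oplus>\<^bsub>F\<^esub> pairing F n A \<phi> x z" .
      then show ?case
        using homog add by (simp add: r_distr \<phi>)
    qed
  next
    case (add x z)
    have "pairing F n A \<phi> (x \<oplus>\<^bsub>A\<^esub> z) y =
        (\<Oplus>\<^bsub>F\<^esub>k\<in>{..n}. \<phi> (part A x k \<otimes>\<^bsub>A\<^esub> part A y (n - k)) \<oplus>\<^bsub>F\<^esub> \<phi> (part A z k \<otimes>\<^bsub>A\<^esub> part A y (n - k)))"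
      unfolding pairing_def using y add degree summand
      by (intro R.finsum_cong') (auto simp: l_distr \<phi>)
    also have "\<dots> = pairing F n A \<phi> x y \<oplus>\<^bsub>F\<^esub> pairing F n A \<phi> z y"
      unfolding pairing_def using y add summand by (intro R.finsum_addf) auto
    finally have "pairing F n A \<phi> (x \<oplus>\<^bsub>A\<^esub> z) y = pairing F n A \<phi> x y \<oplus>\<^bsub>F\<^esub> pairing F n A \<phi> z y" .
    then show ?case
      using y add by (simp add: l_distr \<phi>)
  qed
qed

section \<open>The Hodge decomposition\<close>

locale hodge_dgca = poincare_dgca F n A \<iota>
  for F :: "('f, 'm) ring_scheme" and n :: nat
    and A :: "('f, 'a, 'x) dga_scheme" and \<iota> :: "'a set \<Rightarrow> 'f" +
  fixes W B :: "'a set"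
  assumes hodge_decomposition: "hodge_decomposition F n A \<iota> W B"
begin

lemma harmonic_subset: "W \<subseteq> carrier A"
  and harmonic_zero [simp, intro]: "\<zero>\<^bsub>A\<^esub> \<in> W"
  and harmonic_add [intro]: "x \<in> W \<Longrightarrow> y \<in> W \<Longrightarrow> x \<oplus>\<^bsub>A\<^esub> y \<in> W"
  and harmonic_smult [intro]: "a \<in> carrier F \<Longrightarrow> x \<in> W \<Longrightarrow> a \<odot>\<^bsub>A\<^esub> x \<in> W"
  and harmonic_part [intro]: "x \<in> W \<Longrightarrow> part A x k \<in> W"
  and complement_subset: "B \<subseteq> carrier A"
  and complement_zero [simp, intro]: "\<zero>\<^bsub>A\<^esub> \<in> B"
  and complement_add [intro]: "x \<in> B \<Longrightarrow> y \<in> B \<Longrightarrow> x \<oplus>\<^bsub>A\<^esub> y \<in> B"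
  and complement_smult [intro]: "a \<in> carrier F \<Longrightarrow> x \<in> B \<Longrightarrow> a \<odot>\<^bsub>A\<^esub> x \<in> B"
  and complement_part [intro]: "x \<in> B \<Longrightarrow> part A x k \<in> B"
  using hodge_decomposition
  unfolding hodge_decomposition_def harmonic_subspace_def graded_subspace_def subspace_iff by auto

lemma harmonic_closed [simp, intro]: "x \<in> W \<Longrightarrow> x \<in> carrier A"
  and complement_closed [simp, intro]: "x \<in> B \<Longrightarrow> x \<in> carrier A"
  using harmonic_subset complement_subset by auto

lemma complement_minus [intro]: "x \<in> B \<Longrightarrow> \<ominus>\<^bsub>A\<^esub> x \<in> B"
  using complement_smult[of "\<ominus>\<^bsub>F\<^esub> \<one>\<^bsub>F\<^esub>" x] by (simp add: smult_l_minus)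

lemma harmonic_cocycle [simp, intro]: "x \<in> W \<Longrightarrow> x \<in> cocycles A"
  using hodge_decomposition unfolding hodge_decomposition_def harmonic_subspace_def by auto

lemma harmonic_coboundary: "x \<in> W \<Longrightarrow> x \<in> coboundaries A \<Longrightarrow> x = \<zero>\<^bsub>A\<^esub>"
  using hodge_decomposition
  unfolding hodge_decomposition_def harmonic_subspace_def internal_sum_def by auto

lemma complement_exact: "b \<in> B \<Longrightarrow> w \<in> W \<Longrightarrow> u \<in> carrier A \<Longrightarrow> b = diff A u \<oplus>\<^bsub>A\<^esub> w \<Longrightarrow> b = \<zero>\<^bsub>A\<^esub>"
  using hodge_decomposition
  unfolding hodge_decomposition_def internal_sum_def set_add_def set_mult_def coboundaries_def
  by fastforce

lemma cocycles_decomposition: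
  assumes "x \<in> cocycles A"
  shows "\<exists>u\<in>carrier A. \<exists>w\<in>W. x = diff A u \<oplus>\<^bsub>A\<^esub> w"
proof -
  have "x \<in> coboundaries A <+>\<^bsub>A\<^esub> W"
    using hodge_decomposition assms
    unfolding hodge_decomposition_def harmonic_subspace_def internal_sum_def by auto
  then show ?thesis
    unfolding set_add_def set_mult_def coboundaries_def by auto
qed

lemma carrier_decomposition:
  assumes "x \<in> carrier A"
  shows "\<exists>u\<in>carrier A. \<exists>w\<in>W. \<exists>b\<in>B. x = diff A u \<oplus>\<^bsub>A\<^esub> w \<oplus>\<^bsub>A\<^esub> b"
proof -
  have "x \<in> coboundaries A <+>\<^bsub>A\<^esub> W <+>\<^bsub>A\<^esub> B"
    using hodge_decomposition assms unfolding hodge_decomposition_def internal_sum_def by auto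
  then show ?thesis
    unfolding set_add_def set_mult_def coboundaries_def by auto
qed

text \<open>The exact component is recorded through a primitive in \<open>B\<close> rather than by
  its value. As \<open>d\<close> is injective on \<open>B\<close>, this primitive is unique, and it
  is the future \<open>\<delta> x\<close>.\<close>

definition hodge_components :: "'a \<Rightarrow> 'a \<Rightarrow> 'a \<Rightarrow> 'a \<Rightarrow> bool" where
  "hodge_components x b w b' \<longleftrightarrow> b \<in> B \<and> w \<in> W \<and> b' \<in> B \<and> x = diff A b \<oplus>\<^bsub>A\<^esub> w \<oplus>\<^bsub>A\<^esub> b'"

lemma hodge_components_closed:
  "hodge_components x b w b' \<Longrightarrow> x \<in> carrier A"
  by (auto simp: hodge_components_def)

text \<open>The decomposition is applied twice: the primitive of the exact component is itself
  decomposed, and only its component in \<open>B\<close> survives \<open>d\<close>.\<close>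

lemma ex_hodge_components:
  assumes "x \<in> carrier A"
  shows "\<exists>b w b'. hodge_components x b w b'"
proof -
  obtain u w b' where x: "u \<in> carrier A" "w \<in> W" "b' \<in> B" "x = diff A u \<oplus>\<^bsub>A\<^esub> w \<oplus>\<^bsub>A\<^esub> b'"
    using carrier_decomposition[OF assms] by auto
  obtain v z b where u: "v \<in> carrier A" "z \<in> W" "b \<in> B" "u = diff A v \<oplus>\<^bsub>A\<^esub> z \<oplus>\<^bsub>A\<^esub> b"
    using carrier_decomposition[OF x(1)] by auto
  have "diff A u = diff A b"
    using u by (simp add: diff_diff)
  then show ?thesis
    using x u unfolding hodge_components_def by auto
qed

lemma hodge_components_add:
  assumes "hodge_components x b w b'" "hodge_components y c v c'"
  shows "hodge_components (x \<oplus>\<^bsub>A\<^esub> y) (b \<oplus>\<^bsub>A\<^esub> c) (w \<oplus>\<^bsub>A\<^esub> v) (b' \<oplus>\<^bsub>A\<^esub> c')"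
  using assms unfolding hodge_components_def by (auto simp: a_ac)

lemma hodge_components_smult:
  assumes "a \<in> carrier F" "hodge_components x b w b'"
  shows "hodge_components (a \<odot>\<^bsub>A\<^esub> x) (a \<odot>\<^bsub>A\<^esub> b) (a \<odot>\<^bsub>A\<^esub> w) (a \<odot>\<^bsub>A\<^esub> b')"
  using assms unfolding hodge_components_def by (auto simp: smult_r_distr)

text \<open>The three components fall in turn: \<open>b'\<close> lies in \<open>B\<close> and is
  exact plus harmonic, then \<open>w\<close> is harmonic and exact, and finally \<open>b\<close> is
  a cocycle in \<open>B\<close>, again exact plus harmonic.\<close>

lemma hodge_components_zero:
  assumes "hodge_components \<zero>\<^bsub>A\<^esub> b w b'"
  shows "b = \<zero>\<^bsub>A\<^esub>" "w = \<zero>\<^bsub>A\<^esub>" "b' = \<zero>\<^bsub>A\<^esub>"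
proof -
  have c: "b \<in> B" "w \<in> W" "b' \<in> B" and sum: "diff A b \<oplus>\<^bsub>A\<^esub> w \<oplus>\<^bsub>A\<^esub> b' = \<zero>\<^bsub>A\<^esub>"
    using assms by (auto simp: hodge_components_def)
  have "\<ominus>\<^bsub>A\<^esub> b' = diff A b \<oplus>\<^bsub>A\<^esub> w"
    using sum c by (metis add.m_closed complement_closed differential_closed harmonic_closed minus_equality)
  then have "\<ominus>\<^bsub>A\<^esub> b' = \<zero>\<^bsub>A\<^esub>"
    using c complement_exact[OF complement_minus[of b'] _ complement_closed[of b]] by blast
  then show b': "b' = \<zero>\<^bsub>A\<^esub>"
    using c by (metis complement_closed minus_minus minus_zero)
  have "w \<oplus>\<^bsub>A\<^esub> diff A b = \<zero>\<^bsub>A\<^esub>"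
    using sum c b' by (simp add: a_comm)
  then have "w = diff A (\<ominus>\<^bsub>A\<^esub> b)"
    using c by (simp add: minus_equality[symmetric])
  then show w: "w = \<zero>\<^bsub>A\<^esub>"
    using c by (intro harmonic_coboundary) auto
  have "b \<in> cocycles A"
    using sum c b' w by (intro cocyclesI) auto
  then obtain u v where "u \<in> carrier A" "v \<in> W" "b = diff A u \<oplus>\<^bsub>A\<^esub> v"
    using cocycles_decomposition by blast
  then show "b = \<zero>\<^bsub>A\<^esub>"
    using c complement_exact by blast
qed

lemma hodge_components_unique:
  assumes x: "hodge_components x b w b'" and y: "hodge_components x c v c'"
  shows "b = c" "w = v" "b' = c'"
proof -
  have m: "\<ominus>\<^bsub>F\<^esub> \<one>\<^bsub>F\<^esub> \<in> carrier F" by simp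
  have "hodge_components (x \<oplus>\<^bsub>A\<^esub> \<ominus>\<^bsub>F\<^esub> \<one>\<^bsub>F\<^esub> \<odot>\<^bsub>A\<^esub> x) (b \<oplus>\<^bsub>A\<^esub> \<ominus>\<^bsub>F\<^esub> \<one>\<^bsub>F\<^esub> \<odot>\<^bsub>A\<^esub> c)
      (w \<oplus>\<^bsub>A\<^esub> \<ominus>\<^bsub>F\<^esub> \<one>\<^bsub>F\<^esub> \<odot>\<^bsub>A\<^esub> v) (b' \<oplus>\<^bsub>A\<^esub> \<ominus>\<^bsub>F\<^esub> \<one>\<^bsub>F\<^esub> \<odot>\<^bsub>A\<^esub> c')"
    using hodge_components_add[OF x hodge_components_smult[OF m y]] .
  then have "hodge_components \<zero>\<^bsub>A\<^esub> (b \<ominus>\<^bsub>A\<^esub> c) (w \<ominus>\<^bsub>A\<^esub> v) (b' \<ominus>\<^bsub>A\<^esub> c')"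
    using x y hodge_components_closed[OF x]
    by (simp add: smult_l_minus a_minus_def r_neg hodge_components_def)
  from hodge_components_zero[OF this] show "b = c" "w = v" "b' = c'"
    using x y by (simp_all add: minus_eq_zero_iff hodge_components_def)
qed

definition codifferential :: "'a \<Rightarrow> 'a" ("\<delta>") where
  "codifferential x = (THE b. \<exists>w b'. hodge_components x b w b')"

definition harmonic_part_of :: "'a \<Rightarrow> 'a" ("\<pi>") where
  "harmonic_part_of x = (THE w. \<exists>b b'. hodge_components x b w b')"

text \<open>For the last claim, \<open>d\<close> kills the first two components, so
  \<open>d x\<close> is the differential of \<open>b'\<close>, and \<open>b'\<close> already lies in
  \<open>B\<close>.\<close>

lemma hodge_components_eq:
  assumes x: "hodge_components x b w b'"
  shows "\<delta> x = b" "\<pi> x = w" "\<delta> (diff A x) = b'"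
proof -
  have 1: "\<delta> x = b" if "hodge_components x b w b'" for x b w b'
    unfolding codifferential_def using that hodge_components_unique by (intro the_equality) blast+
  then show "\<delta> x = b" using x .
  show "\<pi> x = w"
    unfolding harmonic_part_of_def using x hodge_components_unique by (intro the_equality) blast+
  have "diff A x = diff A b'"
    using x by (auto simp: hodge_components_def diff_diff)
  then have "hodge_components (diff A x) b' \<zero>\<^bsub>A\<^esub> \<zero>\<^bsub>A\<^esub>"
    using x by (auto simp: hodge_components_def)
  then show "\<delta> (diff A x) = b'" by (rule 1)
qed

lemma hodge_components_canonical:
  "x \<in> carrier A \<Longrightarrow> hodge_components x (\<delta> x) (\<pi> x) (\<delta> (diff A x))"
  using ex_hodge_components hodge_components_eq by metis

lemma codifferential_complement [simp, intro]: "x \<in> carrier A \<Longrightarrow> \<delta> x \<in> B"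
  and harmonic_part_harmonic [simp, intro]: "x \<in> carrier A \<Longrightarrow> \<pi> x \<in> W"
  and hodge_identity: "x \<in> carrier A \<Longrightarrow> x = diff A (\<delta> x) \<oplus>\<^bsub>A\<^esub> \<pi> x \<oplus>\<^bsub>A\<^esub> \<delta> (diff A x)"
  using hodge_components_canonical by (auto simp: hodge_components_def)

lemma codifferential_closed [simp, intro]: "x \<in> carrier A \<Longrightarrow> \<delta> x \<in> carrier A"
  and harmonic_part_closed [simp, intro]: "x \<in> carrier A \<Longrightarrow> \<pi> x \<in> carrier A"
  by auto

lemma
  assumes "x \<in> carrier A" "y \<in> carrier A"
  shows codifferential_add [simp]: "\<delta> (x \<oplus>\<^bsub>A\<^esub> y) = \<delta> x \<oplus>\<^bsub>A\<^esub> \<delta> y"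
    and harmonic_part_add [simp]: "\<pi> (x \<oplus>\<^bsub>A\<^esub> y) = \<pi> x \<oplus>\<^bsub>A\<^esub> \<pi> y"
  using hodge_components_eq(1,2)[OF hodge_components_add[OF
    hodge_components_canonical[OF assms(1)] hodge_components_canonical[OF assms(2)]]]
  by auto

lemma
  assumes "a \<in> carrier F" "x \<in> carrier A"
  shows codifferential_smult [simp]: "\<delta> (a \<odot>\<^bsub>A\<^esub> x) = a \<odot>\<^bsub>A\<^esub> \<delta> x"
    and harmonic_part_smult [simp]: "\<pi> (a \<odot>\<^bsub>A\<^esub> x) = a \<odot>\<^bsub>A\<^esub> \<pi> x"
  using hodge_components_eq(1,2)[OF hodge_components_smult[OF
    assms(1) hodge_components_canonical[OF assms(2)]]]
  by auto

lemma codifferential_zero [simp]: "\<delta> \<zero>\<^bsub>A\<^esub> = \<zero>\<^bsub>A\<^esub>"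
  and harmonic_part_zero [simp]: "\<pi> \<zero>\<^bsub>A\<^esub> = \<zero>\<^bsub>A\<^esub>"
  using hodge_components_eq[of "\<zero>\<^bsub>A\<^esub>" "\<zero>\<^bsub>A\<^esub>" "\<zero>\<^bsub>A\<^esub>" "\<zero>\<^bsub>A\<^esub>"] by (auto simp: hodge_components_def)

lemma codifferential_minus [simp]: "x \<in> carrier A \<Longrightarrow> \<delta> (\<ominus>\<^bsub>A\<^esub> x) = \<ominus>\<^bsub>A\<^esub> \<delta> x"
  and harmonic_part_minus [simp]: "x \<in> carrier A \<Longrightarrow> \<pi> (\<ominus>\<^bsub>A\<^esub> x) = \<ominus>\<^bsub>A\<^esub> \<pi> x"
  using codifferential_smult[of "\<ominus>\<^bsub>F\<^esub> \<one>\<^bsub>F\<^esub>" x] harmonic_part_smult[of "\<ominus>\<^bsub>F\<^esub> \<one>\<^bsub>F\<^esub>" x]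
  by (simp_all add: smult_l_minus)

lemma codifferential_diff [simp]:
    "x \<in> carrier A \<Longrightarrow> y \<in> carrier A \<Longrightarrow> \<delta> (x \<ominus>\<^bsub>A\<^esub> y) = \<delta> x \<ominus>\<^bsub>A\<^esub> \<delta> y"
  and harmonic_part_diff [simp]:
    "x \<in> carrier A \<Longrightarrow> y \<in> carrier A \<Longrightarrow> \<pi> (x \<ominus>\<^bsub>A\<^esub> y) = \<pi> x \<ominus>\<^bsub>A\<^esub> \<pi> y"
  by (simp_all add: a_minus_def)

lemma codifferential_harmonic [simp]: "w \<in> W \<Longrightarrow> \<delta> w = \<zero>\<^bsub>A\<^esub>"
  and harmonic_part_harmonic_eq [simp]: "w \<in> W \<Longrightarrow> \<pi> w = w"
  using hodge_components_eq[of w "\<zero>\<^bsub>A\<^esub>" w "\<zero>\<^bsub>A\<^esub>"] by (auto simp: hodge_components_def)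

lemma codifferential_of_complement [simp]: "b \<in> B \<Longrightarrow> \<delta> b = \<zero>\<^bsub>A\<^esub>"
  and harmonic_part_complement [simp]: "b \<in> B \<Longrightarrow> \<pi> b = \<zero>\<^bsub>A\<^esub>"
  and codifferential_differential [simp]: "b \<in> B \<Longrightarrow> \<delta> (diff A b) = b"
  using hodge_components_eq[of b "\<zero>\<^bsub>A\<^esub>" "\<zero>\<^bsub>A\<^esub>" b] by (auto simp: hodge_components_def)

lemma harmonic_part_differential [simp]: "x \<in> carrier A \<Longrightarrow> \<pi> (diff A x) = \<zero>\<^bsub>A\<^esub>"
proof -
  assume x: "x \<in> carrier A"
  then obtain b w b' where h: "hodge_components x b w b'"
    using ex_hodge_components by blast
  then have "diff A x = diff A b'"
    by (auto simp: hodge_components_def diff_diff)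
  then have "hodge_components (diff A x) b' \<zero>\<^bsub>A\<^esub> \<zero>\<^bsub>A\<^esub>"
    using h by (auto simp: hodge_components_def)
  then show ?thesis
    by (rule hodge_components_eq(2))
qed

lemma differential_codifferential_differential [simp]:
  assumes "x \<in> carrier A"
  shows "diff A (\<delta> (diff A x)) = diff A x"
  using hodge_identity[of "diff A x"] assms by (simp add: diff_diff)

lemma hodge_identity_cocycle: "x \<in> cocycles A \<Longrightarrow> x = diff A (\<delta> x) \<oplus>\<^bsub>A\<^esub> \<pi> x"
  using hodge_identity[of x] by simp

text \<open>Passing to the parts of matching degree gives a second Hodge decomposition of the same
  element, so uniqueness identifies the two.\<close>

lemma hodge_components_homog:
  assumes x: "x \<in> homog A k" "hodge_components x b w b'"
  shows "b \<in> homog A (k - 1)" "w \<in> homog A k" "b' \<in> homog A k"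
proof -
  have c: "b \<in> B" "w \<in> W" "b' \<in> B" "x = diff A b \<oplus>\<^bsub>A\<^esub> w \<oplus>\<^bsub>A\<^esub> b'"
    using x by (auto simp: hodge_components_def)
  have "part A x k = part A (diff A b) k \<oplus>\<^bsub>A\<^esub> part A w k \<oplus>\<^bsub>A\<^esub> part A b' k"
    using c by simp
  \<comment> \<open>For \<open>k = 0\<close> the truncated \<open>k - 1\<close> would pick the
    degree 0 part of \<open>b\<close>, whose differential has degree 1; zero is the correct
    primitive there.\<close>
  moreover have "part A (diff A b) k = diff A (if k = 0 then \<zero>\<^bsub>A\<^esub> else part A b (k - 1))"
    using c by (cases k) (auto simp: part_differential)
  ultimately have "x = diff A (if k = 0 then \<zero>\<^bsub>A\<^esub> else part A b (k - 1)) \<oplus>\<^bsub>A\<^esub> part A w k \<oplus>\<^bsub>A\<^esub> part A b' k"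
    using part_same[OF x(1)] by simp
  then have "hodge_components x (if k = 0 then \<zero>\<^bsub>A\<^esub> else part A b (k - 1)) (part A w k) (part A b' k)"
    unfolding hodge_components_def using c(1-3) by auto
  from hodge_components_unique[OF x(2) this]
  have *: "b = (if k = 0 then \<zero>\<^bsub>A\<^esub> else part A b (k - 1))" "w = part A w k" "b' = part A b' k" .
  show "b \<in> homog A (k - 1)"
    by (subst *) (use c(1) in auto)
  show "w \<in> homog A k" "b' \<in> homog A k"
    by (subst *, use c(2,3) in blast)+
qed

text \<open>
  In degree \<open>0\<close> the truncated subtraction does no harm, as \<open>\<delta>\<close> vanishes there.
\<close>

lemma codifferential_homog [simp, intro]: "x \<in> homog A k \<Longrightarrow> \<delta> x \<in> homog A (k - 1)"
  and harmonic_part_homog [simp, intro]: "x \<in> homog A k \<Longrightarrow> \<pi> x \<in> homog A k"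
  using hodge_components_homog[OF _ hodge_components_canonical] by auto

end

section \<open>The radical of the pairing\<close>

context hodge_dgca
begin

lemma top_cocycle: "x \<in> homog A n \<Longrightarrow> x \<in> cocycles A"
  using diff_homog[of x n] homog_above[of "Suc n"] by (intro cocyclesI) auto

text \<open>Cutting down to degree \<open>n\<close> extends the functional to a linear form on all
  of \<open>A\<close>; the pairing of two elements is then the integral of their product.\<close>

definition integral :: "'a \<Rightarrow> 'f" where
  "integral x = \<iota> (coh_class A (part A x n))"

lemma functional_closed: "x \<in> homog A n \<Longrightarrow> \<iota> (coh_class A x) \<in> carrier F"
  and functional_add: "x \<in> homog A n \<Longrightarrow> y \<in> homog A n \<Longrightarrow>
    \<iota> (coh_class A (x \<oplus>\<^bsub>A\<^esub> y)) = \<iota> (coh_class A x) \<oplus>\<^bsub>F\<^esub> \<iota> (coh_class A y)"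
  and functional_smult: "a \<in> carrier F \<Longrightarrow> x \<in> homog A n \<Longrightarrow>
    \<iota> (coh_class A (a \<odot>\<^bsub>A\<^esub> x)) = a \<otimes>\<^bsub>F\<^esub> \<iota> (coh_class A x)"
proof -
  interpret P: poincare_algebra F n "cohomology A" \<iota> by (rule cohomology_poincare)
  have cls: "coh_class A x \<in> homog (cohomology A) n" if "x \<in> homog A n" for x
    using that top_cocycle by simp
  show "\<iota> (coh_class A x) \<in> carrier F" if "x \<in> homog A n"
    using P.integral_closed cls that by blast
  show "\<iota> (coh_class A (x \<oplus>\<^bsub>A\<^esub> y)) = \<iota> (coh_class A x) \<oplus>\<^bsub>F\<^esub> \<iota> (coh_class A y)"
    if "x \<in> homog A n" "y \<in> homog A n"
    using P.integral_add[OF cls cls] that by simp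
  show "\<iota> (coh_class A (a \<odot>\<^bsub>A\<^esub> x)) = a \<otimes>\<^bsub>F\<^esub> \<iota> (coh_class A x)"
    if "a \<in> carrier F" "x \<in> homog A n"
    using P.integral_smult[OF _ cls] that by simp
qed

lemma functional_zero: "\<iota> (coh_class A \<zero>\<^bsub>A\<^esub>) = \<zero>\<^bsub>F\<^esub>"
  using functional_smult[of "\<zero>\<^bsub>F\<^esub>" "\<zero>\<^bsub>A\<^esub>"] functional_closed[of "\<zero>\<^bsub>A\<^esub>"] by simp

lemma integral_closed [simp, intro]: "x \<in> carrier A \<Longrightarrow> integral x \<in> carrier F"
  and integral_add [simp]: "x \<in> carrier A \<Longrightarrow> y \<in> carrier A \<Longrightarrow>
    integral (x \<oplus>\<^bsub>A\<^esub> y) = integral x \<oplus>\<^bsub>F\<^esub> integral y"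
  and integral_smult [simp]: "a \<in> carrier F \<Longrightarrow> x \<in> carrier A \<Longrightarrow>
    integral (a \<odot>\<^bsub>A\<^esub> x) = a \<otimes>\<^bsub>F\<^esub> integral x"
  and integral_zero [simp]: "integral \<zero>\<^bsub>A\<^esub> = \<zero>\<^bsub>F\<^esub>"
  by (simp_all add: integral_def functional_closed functional_add functional_smult functional_zero)

text \<open>Together with the next lemmas this lets signs be ignored: only the vanishing of
  integrals is ever compared.\<close>

lemma integral_minus_eq_zero [simp]:
  "x \<in> carrier A \<Longrightarrow> integral (\<ominus>\<^bsub>A\<^esub> x) = \<zero>\<^bsub>F\<^esub> \<longleftrightarrow> integral x = \<zero>\<^bsub>F\<^esub>"
proof -
  have *: "integral (\<ominus>\<^bsub>A\<^esub> x) = \<zero>\<^bsub>F\<^esub>" if "integral x = \<zero>\<^bsub>F\<^esub>" "x \<in> carrier A" for x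
    using integral_smult[of "\<ominus>\<^bsub>F\<^esub> \<one>\<^bsub>F\<^esub>" x] that by (simp add: smult_l_minus)
  assume "x \<in> carrier A"
  then show ?thesis
    using *[of x] *[of "\<ominus>\<^bsub>A\<^esub> x"] by auto
qed

lemma integral_coboundary:
  assumes "x \<in> coboundaries A"
  shows "integral x = \<zero>\<^bsub>F\<^esub>"
proof -
  have "coh_class A (part A x n) = coh_class A \<zero>\<^bsub>A\<^esub>"
    using assms coboundaries_part[OF assms, of n] by (simp add: coh_class_eq_iff a_minus_def)
  then show ?thesis
    by (simp add: integral_def functional_zero)
qed

lemma poincare_pairing_eq:
  "x \<in> carrier A \<Longrightarrow> y \<in> carrier A \<Longrightarrow> poincare_pairing F n A \<iota> x y = integral (x \<otimes>\<^bsub>A\<^esub> y)"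
  unfolding poincare_pairing_def integral_def
  by (rule pairing_eq) (auto simp: functional_closed functional_add functional_zero)

lemma integral_swap:
  assumes "x \<in> homog A k" "y \<in> homog A l"
  shows "integral (x \<otimes>\<^bsub>A\<^esub> y) = \<zero>\<^bsub>F\<^esub> \<longleftrightarrow> integral (y \<otimes>\<^bsub>A\<^esub> x) = \<zero>\<^bsub>F\<^esub>"
  using graded_commutative[OF assms] assms by (auto split: if_splits)

text \<open>Integration by parts: the integral of an exact element vanishes, so the two Leibniz
  terms cancel up to a sign, and one is zero exactly when the other is.\<close>

lemma integral_leibniz:
  assumes x: "x \<in> homog A k" and y: "y \<in> carrier A"
  shows "integral (diff A x \<otimes>\<^bsub>A\<^esub> y) = \<zero>\<^bsub>F\<^esub> \<longleftrightarrow> integral (x \<otimes>\<^bsub>A\<^esub> diff A y) = \<zero>\<^bsub>F\<^esub>"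
proof -
  have zero: "integral (diff A (x \<otimes>\<^bsub>A\<^esub> y)) = \<zero>\<^bsub>F\<^esub>"
    using x y by (intro integral_coboundary) auto
  show ?thesis
  proof (cases "even k")
    case True
    then have "integral (diff A x \<otimes>\<^bsub>A\<^esub> y) \<oplus>\<^bsub>F\<^esub> integral (x \<otimes>\<^bsub>A\<^esub> diff A y) = \<zero>\<^bsub>F\<^esub>"
      using zero x y leibniz[OF x y] by simp
    then show ?thesis
      using x y by (metis R.l_zero R.r_zero differential_closed homog_closed integral_closed m_closed)
  next
    case False
    then have "integral (diff A x \<otimes>\<^bsub>A\<^esub> y) \<oplus>\<^bsub>F\<^esub> integral (\<ominus>\<^bsub>A\<^esub> (x \<otimes>\<^bsub>A\<^esub> diff A y)) = \<zero>\<^bsub>F\<^esub>"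
      using zero x y leibniz[OF x y] by (simp add: a_minus_def)
    moreover have "integral (\<ominus>\<^bsub>A\<^esub> (x \<otimes>\<^bsub>A\<^esub> diff A y)) = \<zero>\<^bsub>F\<^esub> \<longleftrightarrow> integral (x \<otimes>\<^bsub>A\<^esub> diff A y) = \<zero>\<^bsub>F\<^esub>"
      using x y by (intro integral_minus_eq_zero) auto
    ultimately show ?thesis
      using x y by (metis R.l_zero R.r_zero a_inv_closed differential_closed homog_closed integral_closed m_closed)
  qed
qed

lemma integral_harmonic_complement: "w \<in> W \<Longrightarrow> b \<in> B \<Longrightarrow> integral (w \<otimes>\<^bsub>A\<^esub> b) = \<zero>\<^bsub>F\<^esub>"
  and integral_complement_complement: "b \<in> B \<Longrightarrow> c \<in> B \<Longrightarrow> integral (b \<otimes>\<^bsub>A\<^esub> c) = \<zero>\<^bsub>F\<^esub>"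
proof -
  have *: "integral ((w \<oplus>\<^bsub>A\<^esub> b) \<otimes>\<^bsub>A\<^esub> c) = \<zero>\<^bsub>F\<^esub>" if "w \<in> W" "b \<in> B" "c \<in> B" for w b c
  proof -
    have "w \<oplus>\<^bsub>A\<^esub> b \<in> W <+>\<^bsub>A\<^esub> B"
      using that unfolding set_add_def set_mult_def by auto
    then have "poincare_pairing F n A \<iota> (w \<oplus>\<^bsub>A\<^esub> b) c = \<zero>\<^bsub>F\<^esub>"
      using hodge_decomposition that unfolding hodge_decomposition_def by blast
    then show ?thesis
      using that by (simp add: poincare_pairing_eq)
  qed
  show "w \<in> W \<Longrightarrow> b \<in> B \<Longrightarrow> integral (w \<otimes>\<^bsub>A\<^esub> b) = \<zero>\<^bsub>F\<^esub>"
    using *[of w "\<zero>\<^bsub>A\<^esub>" b] by simp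
  show "b \<in> B \<Longrightarrow> c \<in> B \<Longrightarrow> integral (b \<otimes>\<^bsub>A\<^esub> c) = \<zero>\<^bsub>F\<^esub>"
    using *[of "\<zero>\<^bsub>A\<^esub>" b c] by simp
qed

lemma integral_degree:
  assumes "x \<in> homog A i" "y \<in> homog A j" "i + j \<noteq> n"
  shows "integral (x \<otimes>\<^bsub>A\<^esub> y) = \<zero>\<^bsub>F\<^esub>"
  unfolding integral_def using part_other[OF mult_homog[OF assms(1,2)], of n] assms(3)
  by (simp add: functional_zero)

lemma integral_homog_left:
  assumes x: "x \<in> homog A i" "i \<le> n" and y: "y \<in> carrier A"
  shows "integral (x \<otimes>\<^bsub>A\<^esub> y) = integral (x \<otimes>\<^bsub>A\<^esub> part A y (n - i))"
  using y
proof (induction rule: homog_induct)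
  case (homog j y)
  then show ?case
    using x integral_degree[OF x(1) homog] by (cases "j = n - i") (auto simp: part_other[of _ j])
next
  case (add y z)
  then show ?case using x by (simp add: r_distr)
qed

lemma integral_homog_right:
  assumes x: "y \<in> homog A (n - i)" "i \<le> n" and y: "x \<in> carrier A"
  shows "integral (x \<otimes>\<^bsub>A\<^esub> y) = integral (part A x i \<otimes>\<^bsub>A\<^esub> y)"
  using y
proof (induction rule: homog_induct)
  case (homog j z)
  then show ?case
    using x integral_degree[OF homog x(1)] by (cases "j = i") (auto simp: part_other[of _ j])
next
  case (add u z)
  then show ?case using x by (simp add: l_distr)
qed

text \<open>The projections to degrees \<open>i\<close> and \<open>n - i\<close> are adjoint to each
  other for the pairing; this is why the radical is graded.\<close>

lemma integral_part:
  assumes "x \<in> carrier A" "y \<in> carrier A" "i \<le> n"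
  shows "integral (part A x i \<otimes>\<^bsub>A\<^esub> y) = integral (x \<otimes>\<^bsub>A\<^esub> part A y (n - i))"
  using integral_homog_left[of "part A x i" i y] integral_homog_right[of "part A y (n - i)" i x] assms
  by simp

lemma part_above: "x \<in> carrier A \<Longrightarrow> k > n \<Longrightarrow> part A x k = \<zero>\<^bsub>A\<^esub>"
  using homog_above[of k] part_homog[of x k] by auto

lemma integral_hodge_left:
  assumes "x \<in> carrier A" "y \<in> carrier A"
  shows "integral (x \<otimes>\<^bsub>A\<^esub> y) =
    integral (diff A (\<delta> x) \<otimes>\<^bsub>A\<^esub> y) \<oplus>\<^bsub>F\<^esub> integral (\<pi> x \<otimes>\<^bsub>A\<^esub> y) \<oplus>\<^bsub>F\<^esub> integral (\<delta> (diff A x) \<otimes>\<^bsub>A\<^esub> y)"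
proof -
  have "integral (x \<otimes>\<^bsub>A\<^esub> y) = integral ((diff A (\<delta> x) \<oplus>\<^bsub>A\<^esub> \<pi> x \<oplus>\<^bsub>A\<^esub> \<delta> (diff A x)) \<otimes>\<^bsub>A\<^esub> y)"
    using hodge_identity[OF assms(1)] by argo
  then show ?thesis
    using assms by (simp add: l_distr)
qed

lemma integral_hodge_right:
  assumes "x \<in> carrier A" "y \<in> carrier A"
  shows "integral (x \<otimes>\<^bsub>A\<^esub> y) =
    integral (x \<otimes>\<^bsub>A\<^esub> diff A (\<delta> y)) \<oplus>\<^bsub>F\<^esub> integral (x \<otimes>\<^bsub>A\<^esub> \<pi> y) \<oplus>\<^bsub>F\<^esub> integral (x \<otimes>\<^bsub>A\<^esub> \<delta> (diff A y))"
proof -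
  have "integral (x \<otimes>\<^bsub>A\<^esub> y) = integral (x \<otimes>\<^bsub>A\<^esub> (diff A (\<delta> y) \<oplus>\<^bsub>A\<^esub> \<pi> y \<oplus>\<^bsub>A\<^esub> \<delta> (diff A y)))"
    using hodge_identity[OF assms(2)] by argo
  then show ?thesis
    using assms by (simp add: r_distr)
qed

text \<open>Harmonic test elements suffice: a cocycle is exact plus harmonic, and a product of the
  cocycle \<open>w\<close> with an exact element is exact, so it integrates to zero. Nondegeneracy
  on cohomology then makes \<open>w\<close> exact.\<close>

lemma harmonic_nondegenerate:
  assumes w: "w \<in> W" and zero: "\<And>v. v \<in> W \<Longrightarrow> integral (w \<otimes>\<^bsub>A\<^esub> v) = \<zero>\<^bsub>F\<^esub>"
  shows "w = \<zero>\<^bsub>A\<^esub>"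
proof -
  have nondegenerate: "nondegenerate_pairing F n (cohomology A) \<iota>"
    using cohomology_poincare by (simp add: poincare_algebra_def poincare_algebra_axioms_def)
  have "pairing F n (cohomology A) \<iota> (coh_class A w) Y = \<zero>\<^bsub>F\<^esub>"
    if Y: "Y \<in> carrier (cohomology A)" for Y
  proof -
    obtain y where y: "y \<in> cocycles A" "Y = coh_class A y"
      using Y by auto
    \<comment> \<open>Parts and products of classes are the classes of the parts and products of
      representatives, so the two sums agree term by term.\<close>
    have "pairing F n (cohomology A) \<iota> (coh_class A w) Y = poincare_pairing F n A \<iota> w y"
      unfolding poincare_pairing_def pairing_def using y w by simp
    also have "\<dots> = integral (w \<otimes>\<^bsub>A\<^esub> y)"
      using y(1) w by (intro poincare_pairing_eq) auto
    also have "\<dots> = integral (w \<otimes>\<^bsub>A\<^esub> diff A (\<delta> y)) \<oplus>\<^bsub>F\<^esub> integral (w \<otimes>\<^bsub>A\<^esub> \<pi> y)"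
      using integral_hodge_right[of w y] y(1) w by simp
    also have "integral (w \<otimes>\<^bsub>A\<^esub> diff A (\<delta> y)) = \<zero>\<^bsub>F\<^esub>"
      using y(1) w by (intro integral_coboundary cocycle_mult_coboundary) auto
    also have "integral (w \<otimes>\<^bsub>A\<^esub> \<pi> y) = \<zero>\<^bsub>F\<^esub>"
      using y(1) by (intro zero) auto
    also have "\<zero>\<^bsub>F\<^esub> \<oplus>\<^bsub>F\<^esub> \<zero>\<^bsub>F\<^esub> = \<zero>\<^bsub>F\<^esub>"
      by simp
    finally show ?thesis .
  qed
  then have "coh_class A w = coh_class A \<zero>\<^bsub>A\<^esub>"
    using nondegenerate w unfolding nondegenerate_pairing_def by simp
  then have "w \<in> coboundaries A"
    using w by (simp add: coh_class_eq_iff a_minus_def)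
  then show ?thesis
    using w by (rule harmonic_coboundary[rotated])
qed

end

locale hodge_subalgebra = hodge_dgca F n A \<iota> W B
  for F :: "('f, 'm) ring_scheme" and n :: nat and A :: "('f, 'a, 'x) dga_scheme"
    and \<iota> :: "'a set \<Rightarrow> 'f" and W B :: "'a set" +
  fixes C :: "'a set"
  assumes subalgebra: "graded_subalgebra F A C"
    and sub_differential [simp, intro]: "x \<in> C \<Longrightarrow> diff A x \<in> C"
    and sub_codifferential [simp, intro]: "x \<in> C \<Longrightarrow> \<delta> x \<in> C"
    and sub_harmonic [simp, intro]: "x \<in> W \<Longrightarrow> x \<in> C"
begin

lemma restriction: "dgca_image F A C (subquotient A C (\<lambda>x. x)) (\<lambda>x. x)"
  using subalgebra by (rule restriction_image) auto

sublocale sub: dgca_image F A C "subquotient A C (\<lambda>x. x)" "\<lambda>x. x"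
  by (rule restriction)

definition radical :: "'a set" where
  "radical = {x \<in> C. \<forall>y\<in>C. integral (x \<otimes>\<^bsub>A\<^esub> y) = \<zero>\<^bsub>F\<^esub>}"

lemma radicalI: "x \<in> C \<Longrightarrow> (\<And>y. y \<in> C \<Longrightarrow> integral (x \<otimes>\<^bsub>A\<^esub> y) = \<zero>\<^bsub>F\<^esub>) \<Longrightarrow> x \<in> radical"
  and radical_sub [simp, intro]: "x \<in> radical \<Longrightarrow> x \<in> C"
  and radicalD: "x \<in> radical \<Longrightarrow> y \<in> C \<Longrightarrow> integral (x \<otimes>\<^bsub>A\<^esub> y) = \<zero>\<^bsub>F\<^esub>"
  by (auto simp: radical_def)

lemma radical_closed [simp, intro]: "x \<in> radical \<Longrightarrow> x \<in> carrier A"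
  using sub.sub_closed by auto

lemma radical_zero [simp, intro]: "\<zero>\<^bsub>A\<^esub> \<in> radical"
  and radical_add [intro]: "x \<in> radical \<Longrightarrow> y \<in> radical \<Longrightarrow> x \<oplus>\<^bsub>A\<^esub> y \<in> radical"
  and radical_smult [intro]: "a \<in> carrier F \<Longrightarrow> x \<in> radical \<Longrightarrow> a \<odot>\<^bsub>A\<^esub> x \<in> radical"
  by (auto intro!: radicalI simp: l_distr radicalD smult_mult_left)

lemma radical_minus [intro]: "x \<in> radical \<Longrightarrow> \<ominus>\<^bsub>A\<^esub> x \<in> radical"
  using radical_smult[of "\<ominus>\<^bsub>F\<^esub> \<one>\<^bsub>F\<^esub>" x] by (simp add: smult_l_minus)

lemma radical_diff [intro]: "x \<in> radical \<Longrightarrow> y \<in> radical \<Longrightarrow> x \<ominus>\<^bsub>A\<^esub> y \<in> radical"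
  by (auto simp: a_minus_def)

lemma radical_part [intro]:
  assumes "x \<in> radical"
  shows "part A x k \<in> radical"
proof (cases "k \<le> n")
  case True
  then show ?thesis
    using assms by (intro radicalI) (auto simp: integral_part radicalD)
next
  case False
  then show ?thesis using assms by (simp add: part_above)
qed

lemma radical_graded: "graded_subspace F A radical"
  unfolding graded_subspace_def subspace_iff by auto

lemma radical_mult_right:
  assumes "x \<in> radical" "y \<in> C"
  shows "x \<otimes>\<^bsub>A\<^esub> y \<in> radical"
  using assms by (intro radicalI) (auto simp: m_assoc radicalD)

text \<open>Associativity gives only the right ideal property. Here the factors are exchanged by
  graded commutativity, after splitting both into homogeneous parts.\<close>

lemma radical_mult_left:
  assumes x: "x \<in> C" and y: "y \<in> radical"
  shows "x \<otimes>\<^bsub>A\<^esub> y \<in> radical"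
proof (rule graded_induct[of x])
  fix k
  show "part A x k \<otimes>\<^bsub>A\<^esub> y \<in> radical"
  proof (rule graded_induct[of y])
    fix l
    have "part A y l \<otimes>\<^bsub>A\<^esub> part A x k \<in> radical"
      using x y by (intro radical_mult_right) auto
    moreover have "part A x k \<otimes>\<^bsub>A\<^esub> part A y l =
        (if even (k * l) then part A y l \<otimes>\<^bsub>A\<^esub> part A x k else \<ominus>\<^bsub>A\<^esub> (part A y l \<otimes>\<^bsub>A\<^esub> part A x k))"
      using x y by (intro graded_commutative) auto
    ultimately show "part A x k \<otimes>\<^bsub>A\<^esub> part A y l \<in> radical"
      by auto
  qed (use x y in \<open>auto simp: r_distr\<close>)
qed (use x y in \<open>auto simp: l_distr\<close>)

lemma radical_differential [intro]:
  assumes x: "x \<in> radical"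
  shows "diff A x \<in> radical"
proof (rule graded_induct[of x])
  fix k
  have "integral (diff A (part A x k) \<otimes>\<^bsub>A\<^esub> y) = \<zero>\<^bsub>F\<^esub>" if "y \<in> C" for y
    using integral_leibniz[of "part A x k" k y] radicalD[OF radical_part[OF x], of "diff A y"] x that
    by auto
  then show "diff A (part A x k) \<in> radical"
    using x by (intro radicalI) auto
qed (use x in auto)

text \<open>The statement rests on moving \<open>\<delta>\<close> across the pairing: both the
  integral of z against \<open>\<delta> y\<close> and that of \<open>\<delta> z\<close> against
  \<open>y\<close> reduce to integrals involving only \<open>\<delta> z\<close>,
  \<open>\<delta> y\<close> and one \<open>d\<close>, because \<open>B\<close> is orthogonal to
  \<open>W\<close> and to \<open>B\<close>. Integration by parts connects the two.\<close>

lemma radical_codifferential [intro]: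
  assumes x: "x \<in> radical"
  shows "\<delta> x \<in> radical"
proof (rule graded_induct[of x])
  fix k
  let ?z = "part A x k"
  have z: "?z \<in> homog A k" "?z \<in> radical" "?z \<in> carrier A"
    using x by auto
  have homogeneous: "integral (\<delta> ?z \<otimes>\<^bsub>A\<^esub> y) = \<zero>\<^bsub>F\<^esub>" if y: "y \<in> C" "y \<in> homog A l" for y l
  proof -
    have yc: "y \<in> carrier A" using y by auto
    \<comment> \<open>Only some degree of each element is needed for swapping factors and
      integrating by parts, so the truncated values may stand.\<close>
    have dz: "\<delta> ?z \<in> homog A (k - 1)" and ddz: "diff A (\<delta> ?z) \<in> homog A (Suc (k - 1))"
      and dy: "\<delta> y \<in> homog A (l - 1)"
      using codifferential_homog[OF z(1)] diff_homog codifferential_homog[OF y(2)] by blast+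
    have "integral (?z \<otimes>\<^bsub>A\<^esub> \<delta> y) = \<zero>\<^bsub>F\<^esub>"
      using z y by (intro radicalD) auto
    \<comment> \<open>\<open>\<delta> y\<close> lies in \<open>B\<close>, so the harmonic and the
      \<open>B\<close> component of the left factor contribute nothing.\<close>
    moreover have "integral (?z \<otimes>\<^bsub>A\<^esub> \<delta> y) = integral (diff A (\<delta> ?z) \<otimes>\<^bsub>A\<^esub> \<delta> y)"
      using integral_hodge_left[of ?z "\<delta> y"] z(3) yc
      by (simp add: integral_harmonic_complement integral_complement_complement)
    ultimately have "integral (\<delta> y \<otimes>\<^bsub>A\<^esub> diff A (\<delta> ?z)) = \<zero>\<^bsub>F\<^esub>"
      using integral_swap[OF ddz dy] by simp
    then have "integral (diff A (\<delta> y) \<otimes>\<^bsub>A\<^esub> \<delta> ?z) = \<zero>\<^bsub>F\<^esub>"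
      using integral_leibniz[OF dy, of "\<delta> ?z"] z(3) by simp
    moreover have "integral (y \<otimes>\<^bsub>A\<^esub> \<delta> ?z) = integral (diff A (\<delta> y) \<otimes>\<^bsub>A\<^esub> \<delta> ?z)"
      using integral_hodge_left[of y "\<delta> ?z"] z(3) yc
      by (simp add: integral_harmonic_complement integral_complement_complement)
    ultimately show ?thesis
      using integral_swap[OF dz y(2)] by simp
  qed
  have "integral (\<delta> ?z \<otimes>\<^bsub>A\<^esub> y) = \<zero>\<^bsub>F\<^esub>" if y: "y \<in> C" for y
  proof (rule graded_induct[of y])
    show "integral (\<delta> ?z \<otimes>\<^bsub>A\<^esub> part A y l) = \<zero>\<^bsub>F\<^esub>" for l
      using y by (intro homogeneous[of _ l]) auto
  qed (use y z in \<open>auto simp: r_distr\<close>)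
  then show "\<delta> ?z \<in> radical"
    using z by (intro radicalI) auto
qed (use x in auto)

text \<open>By the Hodge identity the harmonic part is obtained from \<open>x\<close> with
  \<open>d\<close> and \<open>\<delta>\<close>, so it stays in the radical; all harmonic test
  elements lie in \<open>C\<close>, so it must vanish.\<close>

lemma radical_harmonic_part:
  assumes x: "x \<in> radical"
  shows "\<pi> x = \<zero>\<^bsub>A\<^esub>"
proof (rule harmonic_nondegenerate)
  have "\<pi> x = x \<ominus>\<^bsub>A\<^esub> diff A (\<delta> x) \<ominus>\<^bsub>A\<^esub> \<delta> (diff A x)"
  proof -
    have "x \<ominus>\<^bsub>A\<^esub> u \<ominus>\<^bsub>A\<^esub> v = w" if "u \<in> carrier A" "v \<in> carrier A" "w \<in> carrier A" "x = u \<oplus>\<^bsub>A\<^esub> w \<oplus>\<^bsub>A\<^esub> v" for u v w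
      unfolding that(4) using that(1-3) by algebra
    then show ?thesis
      using hodge_identity[of x] x by (metis codifferential_closed differential_closed harmonic_part_closed radical_closed)
  qed
  then have "\<pi> x \<in> radical"
    using x by auto
  then show "integral (\<pi> x \<otimes>\<^bsub>A\<^esub> v) = \<zero>\<^bsub>F\<^esub>" if "v \<in> W" for v
    using that by (auto intro: radicalD)
qed (use x in auto)

end

section \<open>The quotient by the radical\<close>

lemma set_add_iff: "z \<in> U <+>\<^bsub>G\<^esub> V \<longleftrightarrow> (\<exists>u\<in>U. \<exists>v\<in>V. z = u \<oplus>\<^bsub>G\<^esub> v)"
  by (simp add: set_add_def set_mult_def)

lemma (in graded_image) image_graded_subspace:
  assumes S: "graded_subspace F A S" "S \<subseteq> C"
  shows "graded_subspace F K (f ` S)"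
proof -
  interpret K: graded_commutative_algebra F K by (rule graded_commutative_image)
  have S': "\<zero>\<^bsub>A\<^esub> \<in> S" "\<And>x y. x \<in> S \<Longrightarrow> y \<in> S \<Longrightarrow> x \<oplus>\<^bsub>A\<^esub> y \<in> S"
    "\<And>a x. a \<in> carrier F \<Longrightarrow> x \<in> S \<Longrightarrow> a \<odot>\<^bsub>A\<^esub> x \<in> S" "\<And>x k. x \<in> S \<Longrightarrow> part A x k \<in> S"
    using S unfolding graded_subspace_def subspace_iff by auto
  have C: "x \<in> C" if "x \<in> S" for x using that S by auto
  have "f x \<oplus>\<^bsub>K\<^esub> f y \<in> f ` S" if "x \<in> S" "y \<in> S" for x y
    using that by (simp add: image_add[symmetric] C S')
  moreover have "a \<odot>\<^bsub>K\<^esub> f x \<in> f ` S" if "a \<in> carrier F" "x \<in> S" for a x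
    using that by (simp add: image_smult[symmetric] C S')
  moreover have "\<zero>\<^bsub>K\<^esub> \<in> f ` S"
    using S'(1) by (simp add: image_zero[symmetric])
  moreover have "part K (f x) k \<in> f ` S" if "x \<in> S" for x k
    using that by (simp add: C S')
  ultimately show ?thesis
    unfolding graded_subspace_def K.subspace_iff using C by auto
qed

lemma (in dgca) diff_self_coboundary: "x \<in> carrier A \<Longrightarrow> x \<ominus>\<^bsub>A\<^esub> x \<in> coboundaries A"
  by (simp add: a_minus_def r_neg)

context hodge_subalgebra
begin

text \<open>The predicate depends on \<open>x\<close> only modulo the radical, so congruent elements
  of \<open>C\<close> receive the very same representative.\<close>

definition rep :: "'a \<Rightarrow> 'a" where
  "rep x = (SOME y. y \<in> C \<and> y \<ominus>\<^bsub>A\<^esub> x \<in> radical)"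

lemma rep_spec:
  assumes "x \<in> C"
  shows "rep x \<in> C \<and> rep x \<ominus>\<^bsub>A\<^esub> x \<in> radical"
  unfolding rep_def by (rule someI[of _ x]) (use assms in \<open>simp add: a_minus_def r_neg\<close>)

lemma rep_sub [simp, intro]: "x \<in> C \<Longrightarrow> rep x \<in> C"
  and rep_radical: "x \<in> C \<Longrightarrow> rep x \<ominus>\<^bsub>A\<^esub> x \<in> radical"
  using rep_spec by auto

lemma radical_diff_swap:
  assumes "x \<in> carrier A" "y \<in> carrier A" "x \<ominus>\<^bsub>A\<^esub> y \<in> radical"
  shows "y \<ominus>\<^bsub>A\<^esub> x \<in> radical"
proof -
  have "y \<ominus>\<^bsub>A\<^esub> x = \<ominus>\<^bsub>A\<^esub> (x \<ominus>\<^bsub>A\<^esub> y)"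
    using assms(1,2) by algebra
  then show ?thesis
    using assms(3) by auto
qed

lemma radical_diff_trans:
  assumes "x \<in> carrier A" "y \<in> carrier A" "z \<in> carrier A" "x \<ominus>\<^bsub>A\<^esub> y \<in> radical" "y \<ominus>\<^bsub>A\<^esub> z \<in> radical"
  shows "x \<ominus>\<^bsub>A\<^esub> z \<in> radical"
proof -
  have "x \<ominus>\<^bsub>A\<^esub> z = (x \<ominus>\<^bsub>A\<^esub> y) \<oplus>\<^bsub>A\<^esub> (y \<ominus>\<^bsub>A\<^esub> z)"
    using assms(1-3) by algebra
  then show ?thesis
    using assms(4,5) by auto
qed

lemma rep_eq_iff:
  assumes x: "x \<in> C" and y: "y \<in> C"
  shows "rep x = rep y \<longleftrightarrow> x \<ominus>\<^bsub>A\<^esub> y \<in> radical"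
proof
  assume "rep x = rep y"
  then show "x \<ominus>\<^bsub>A\<^esub> y \<in> radical"
    using rep_radical[OF x] rep_radical[OF y] x y
    by (metis radical_diff_swap radical_diff_trans rep_sub sub.sub_closed)
next
  assume "x \<ominus>\<^bsub>A\<^esub> y \<in> radical"
  then have "z \<ominus>\<^bsub>A\<^esub> x \<in> radical \<longleftrightarrow> z \<ominus>\<^bsub>A\<^esub> y \<in> radical" if "z \<in> C" for z
    using that x y by (metis radical_diff_swap radical_diff_trans sub.sub_closed)
  then have "(\<lambda>z. z \<in> C \<and> z \<ominus>\<^bsub>A\<^esub> x \<in> radical) = (\<lambda>z. z \<in> C \<and> z \<ominus>\<^bsub>A\<^esub> y \<in> radical)"
    by blast
  then show "rep x = rep y"
    unfolding rep_def by simp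
qed

lemma rep_eq_zero_iff: "x \<in> C \<Longrightarrow> rep x = rep \<zero>\<^bsub>A\<^esub> \<longleftrightarrow> x \<in> radical"
  using rep_eq_iff[of x "\<zero>\<^bsub>A\<^esub>"] by (simp add: a_minus_def)

abbreviation small_dga :: "('f, 'a) dga" where
  "small_dga \<equiv> subquotient A C (\<lambda>x. x)"

abbreviation quotient_dga :: "('f, 'a) dga" where
  "quotient_dga \<equiv> subquotient A C rep"

lemma quotient_image: "dgca_image F A C quotient_dga rep"
  by (rule subquotient_image[where N = radical])
    (auto simp: subalgebra radical_graded radical_mult_left radical_mult_right rep_radical rep_eq_iff)

sublocale quot: dgca_image F A C quotient_dga rep
  by (rule quotient_image)

section \<open>The two quasi-isomorphisms\<close>

lemma small_cocycles_iff: "x \<in> cocycles small_dga \<longleftrightarrow> x \<in> C \<and> x \<in> cocycles A"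
  using sub.sub_closed[of x] unfolding cocycles_def subquotient_simps by auto

lemma small_coboundaries_iff: "x \<in> coboundaries small_dga \<longleftrightarrow> (\<exists>c\<in>C. x = diff A c)"
  unfolding coboundaries_def subquotient_simps by auto

lemma quotient_cocycles_iff: "x \<in> C \<Longrightarrow> rep x \<in> cocycles quotient_dga \<longleftrightarrow> diff A x \<in> radical"
  unfolding cocycles_def using quot.image_differential[of x] rep_eq_zero_iff[of "diff A x"] by simp

lemma quotient_coboundaries_iff: "x \<in> coboundaries quotient_dga \<longleftrightarrow> (\<exists>c\<in>C. x = rep (diff A c))"
  unfolding coboundaries_def using quot.image_differential by (force simp del: subquotient_simps(8) simp: image_iff)

lemma quotient_mem: "u \<in> carrier quotient_dga \<Longrightarrow> \<exists>x\<in>C. u = rep x"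
  by auto

text \<open>Harmonic elements represent every class and lie in \<open>C\<close>. Conversely, an
  element of \<open>C\<close> that is exact in \<open>A\<close> is the differential of its own
  \<open>\<delta>\<close>, which is again in \<open>C\<close>.\<close>

lemma inclusion_quasi_isomorphism: "quasi_isomorphism F small_dga A (\<lambda>x. x)"
proof -
  have m: "dgca_morphism F small_dga A (\<lambda>x. x)"
    by (intro dgca_morphism.intro dgca_morphism_axioms.intro dgca_axioms sub.dgca_image
        dgca_homI[OF restriction identity_image]) auto
  show ?thesis
  proof (rule dgca_morphism.quasi_isomorphismI[OF m])
    fix x assume x: "x \<in> cocycles small_dga" "x \<in> coboundaries A"
    then have "x \<in> C" "\<pi> x = \<zero>\<^bsub>A\<^esub>" "x \<in> cocycles A"
      using small_cocycles_iff by (auto simp: coboundaries_def)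
    then have "\<delta> x \<in> C" "x = diff A (\<delta> x)"
      using hodge_identity_cocycle[of x] by auto
    then show "x \<in> coboundaries small_dga"
      using small_coboundaries_iff by blast
  next
    fix y assume y: "y \<in> cocycles A"
    have "y \<ominus>\<^bsub>A\<^esub> \<pi> y = diff A (\<delta> y)"
    proof -
      have "(u \<oplus>\<^bsub>A\<^esub> v) \<ominus>\<^bsub>A\<^esub> v = u" if "u \<in> carrier A" "v \<in> carrier A" for u v
        using that by algebra
      then show ?thesis
        using hodge_identity_cocycle[OF y] y
        by (metis cocycles_closed codifferential_closed differential_closed harmonic_part_closed)
    qed
    then have "y \<ominus>\<^bsub>A\<^esub> \<pi> y \<in> coboundaries A" "\<pi> y \<in> cocycles small_dga"
      using y small_cocycles_iff by auto
    then show "\<exists>x\<in>cocycles small_dga. y \<ominus>\<^bsub>A\<^esub> x \<in> coboundaries A"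
      by blast
  qed
qed

text \<open>On the injective side, an element congruent to an exact one has vanishing harmonic part,
  because \<open>\<pi>\<close> kills both the radical and exact elements. On the surjective side, a
  cocycle modulo the radical is corrected to a genuine cocycle.\<close>

lemma projection_quasi_isomorphism: "quasi_isomorphism F small_dga quotient_dga rep"
proof -
  have m: "dgca_morphism F small_dga quotient_dga rep"
    by (intro dgca_morphism.intro dgca_morphism_axioms.intro quot.dgca_image sub.dgca_image
        dgca_homI[OF restriction quotient_image]) auto
  show ?thesis
  proof (rule dgca_morphism.quasi_isomorphismI[OF m])
    fix x assume x: "x \<in> cocycles small_dga" "rep x \<in> coboundaries quotient_dga"
    then have xC: "x \<in> C" "x \<in> cocycles A"
      using small_cocycles_iff by auto
    obtain c where c: "c \<in> C" "rep x = rep (diff A c)"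
      using x(2) quotient_coboundaries_iff by blast
    then have "x \<ominus>\<^bsub>A\<^esub> diff A c \<in> radical"
      using rep_eq_iff xC by blast
    then have "\<pi> x = \<zero>\<^bsub>A\<^esub>"
      using radical_harmonic_part[of "x \<ominus>\<^bsub>A\<^esub> diff A c"] xC c(1) by (simp add: a_minus_def)
    then have "\<delta> x \<in> C" "x = diff A (\<delta> x)"
      using hodge_identity_cocycle[of x] xC by auto
    then show "x \<in> coboundaries small_dga"
      using small_coboundaries_iff by blast
  next
    fix y assume y: "y \<in> cocycles quotient_dga"
    then obtain x where x: "x \<in> C" "y = rep x"
      using quotient_mem unfolding cocycles_def by blast
    then have dx: "diff A x \<in> radical"
      using y quotient_cocycles_iff by blast
    \<comment> \<open>The correction works since d \<open>\<delta>\<close> d equals d, and it leaves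
      the class unchanged since \<open>\<delta>\<close> preserves the radical.\<close>
    let ?x = "x \<ominus>\<^bsub>A\<^esub> \<delta> (diff A x)"
    have xC: "?x \<in> C"
      using x dx by auto
    have "diff A ?x = \<zero>\<^bsub>A\<^esub>"
      using x by (simp add: a_minus_def r_neg)
    with sub.sub_closed[OF xC] have "?x \<in> cocycles A"
      by (rule cocyclesI)
    then have "?x \<in> cocycles small_dga"
      using xC small_cocycles_iff by blast
    moreover have "y = rep ?x"
    proof -
      have "x \<ominus>\<^bsub>A\<^esub> ?x = \<delta> (diff A x)"
        using sub.sub_closed[OF x(1)] sub.sub_closed[OF sub_codifferential[OF sub_differential[OF x(1)]]]
        by algebra
      then show ?thesis
        using rep_eq_iff[OF x(1) xC] dx x(2) by auto
    qed
    moreover have "y \<ominus>\<^bsub>quotient_dga\<^esub> y \<in> coboundaries quotient_dga"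
      using x(1) unfolding x(2) by (intro dgca.diff_self_coboundary[OF quot.dgca_image]) simp
    ultimately show "\<exists>x\<in>cocycles small_dga. y \<ominus>\<^bsub>quotient_dga\<^esub> rep x \<in> coboundaries quotient_dga"
      by metis
  qed
qed

lemma ex_quotient_functional:
  "\<exists>\<kappa>. poincare_algebra F n (cohomology quotient_dga) \<kappa> \<and>
     (\<forall>x\<in>C. x \<in> cocycles A \<longrightarrow> \<kappa> (coh_class quotient_dga (rep x)) = \<iota> (coh_class A x))"
proof -
  obtain \<kappa>' where \<kappa>': "poincare_algebra F n (cohomology small_dga) \<kappa>'"
    "\<And>x. x \<in> cocycles small_dga \<Longrightarrow> \<kappa>' (coh_class small_dga x) = \<iota> (coh_class A x)"
    using quasi_isomorphism_poincare_source[OF inclusion_quasi_isomorphism cohomology_poincare] by blast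
  obtain \<kappa> where "poincare_algebra F n (cohomology quotient_dga) \<kappa>"
    "\<And>x. x \<in> cocycles small_dga \<Longrightarrow> \<kappa> (coh_class quotient_dga (rep x)) = \<kappa>' (coh_class small_dga x)"
    using quasi_isomorphism_poincare_target[OF projection_quasi_isomorphism \<kappa>'(1)] by blast
  then show ?thesis
    using \<kappa>'(2) small_cocycles_iff by auto
qed

text \<open>\<open>W\<close> lies in \<open>C\<close> as a whole, while \<open>B\<close> has to be
  cut down. In the second direct sum, exact plus harmonic is handled as the set of cocycles, which
  the first sum justifies.\<close>

lemma quotient_hodge_decomposition:
  assumes \<kappa>: "\<And>x y. x \<in> C \<Longrightarrow> y \<in> C \<Longrightarrow>
    poincare_pairing F n quotient_dga \<kappa> (rep x) (rep y) = integral (x \<otimes>\<^bsub>A\<^esub> y)"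
  shows "hodge_decomposition F n quotient_dga \<kappa> (rep ` W) (rep ` (B \<inter> C))"
proof -
  have graded: "graded_subspace F quotient_dga (rep ` W)" "graded_subspace F quotient_dga (rep ` (B \<inter> C))"
    by (rule quot.image_graded_subspace; auto simp: graded_subspace_def subspace_iff)+
  have W: "rep ` W \<subseteq> cocycles quotient_dga"
    by (auto simp: quotient_cocycles_iff)
  have rep_add: "rep x \<oplus>\<^bsub>quotient_dga\<^esub> rep y = rep (x \<oplus>\<^bsub>A\<^esub> y)" if "x \<in> C" "y \<in> C" for x y
    using quot.image_add[OF that] by simp
  have zero: "\<zero>\<^bsub>quotient_dga\<^esub> = rep \<zero>\<^bsub>A\<^esub>" by simp
  have int1: "coboundaries quotient_dga \<inter> rep ` W = {\<zero>\<^bsub>quotient_dga\<^esub>}"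
  proof (intro equalityI subsetI)
    fix u assume "u \<in> coboundaries quotient_dga \<inter> rep ` W"
    then obtain w c where u: "w \<in> W" "u = rep w" "c \<in> C" "rep w = rep (diff A c)"
      using quotient_coboundaries_iff by auto
    then have "w \<ominus>\<^bsub>A\<^esub> diff A c \<in> radical"
      using rep_eq_iff by blast
    then have "w = \<zero>\<^bsub>A\<^esub>"
      using radical_harmonic_part[of "w \<ominus>\<^bsub>A\<^esub> diff A c"] u by (simp add: a_minus_def)
    then show "u \<in> {\<zero>\<^bsub>quotient_dga\<^esub>}" using u by simp
  next
    fix u assume "u \<in> {\<zero>\<^bsub>quotient_dga\<^esub>}"
    then show "u \<in> coboundaries quotient_dga \<inter> rep ` W"
      unfolding zero using quotient_coboundaries_iff by (auto intro!: bexI[of _ "\<zero>\<^bsub>A\<^esub>"])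
  qed
  have sum1: "coboundaries quotient_dga <+>\<^bsub>quotient_dga\<^esub> rep ` W = cocycles quotient_dga"
  proof (intro equalityI subsetI)
    fix u assume "u \<in> coboundaries quotient_dga <+>\<^bsub>quotient_dga\<^esub> rep ` W"
    then obtain c w where u: "c \<in> C" "w \<in> W" "u = rep (diff A c) \<oplus>\<^bsub>quotient_dga\<^esub> rep w"
      unfolding set_add_iff using quotient_coboundaries_iff by auto
    then have "u = rep (diff A c \<oplus>\<^bsub>A\<^esub> w)" using rep_add by auto
    then show "u \<in> cocycles quotient_dga"
      using u by (simp only: quotient_cocycles_iff sub.sub_add sub_differential sub_harmonic)
        (simp add: diff_diff)
  next
    fix u assume u: "u \<in> cocycles quotient_dga"
    then obtain x where x: "x \<in> C" "u = rep x"
      using quotient_mem unfolding cocycles_def by blast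
    \<comment> \<open>The third term of the Hodge identity disappears in the quotient, leaving exact
      plus harmonic.\<close>
    then have dx: "\<delta> (diff A x) \<in> radical"
      using u quotient_cocycles_iff by auto
    have "x \<ominus>\<^bsub>A\<^esub> (diff A (\<delta> x) \<oplus>\<^bsub>A\<^esub> \<pi> x) = \<delta> (diff A x)"
    proof -
      have "(a \<oplus>\<^bsub>A\<^esub> b \<oplus>\<^bsub>A\<^esub> c) \<ominus>\<^bsub>A\<^esub> (a \<oplus>\<^bsub>A\<^esub> b) = c" if "a \<in> carrier A" "b \<in> carrier A" "c \<in> carrier A" for a b c
        using that by algebra
      then show ?thesis
        using hodge_identity[of x] x
        by (metis codifferential_closed differential_closed harmonic_part_closed sub.sub_closed)
    qed
    then have "rep x = rep (diff A (\<delta> x) \<oplus>\<^bsub>A\<^esub> \<pi> x)"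
      using x dx by (subst rep_eq_iff) auto
    then have "u = rep (diff A (\<delta> x)) \<oplus>\<^bsub>quotient_dga\<^esub> rep (\<pi> x)"
      using x rep_add by auto
    then show "u \<in> coboundaries quotient_dga <+>\<^bsub>quotient_dga\<^esub> rep ` W"
      unfolding set_add_iff using x quotient_coboundaries_iff by blast
  qed
  have int2: "cocycles quotient_dga \<inter> rep ` (B \<inter> C) = {\<zero>\<^bsub>quotient_dga\<^esub>}"
  proof (intro equalityI subsetI)
    fix u assume "u \<in> cocycles quotient_dga \<inter> rep ` (B \<inter> C)"
    then obtain b where b: "b \<in> B" "b \<in> C" "u = rep b" "diff A b \<in> radical"
      using quotient_cocycles_iff by auto
    \<comment> \<open>An element of \<open>B\<close> is recovered from its differential by
      \<open>\<delta>\<close>, which preserves the radical.\<close>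
    then have "b \<in> radical"
      using radical_codifferential[of "diff A b"] by simp
    then show "u \<in> {\<zero>\<^bsub>quotient_dga\<^esub>}" using b rep_eq_zero_iff by simp
  next
    fix u assume "u \<in> {\<zero>\<^bsub>quotient_dga\<^esub>}"
    then show "u \<in> cocycles quotient_dga \<inter> rep ` (B \<inter> C)"
      unfolding zero using quotient_cocycles_iff[of "\<zero>\<^bsub>A\<^esub>"] by auto
  qed
  have sum2: "cocycles quotient_dga <+>\<^bsub>quotient_dga\<^esub> rep ` (B \<inter> C) = carrier quotient_dga"
  proof (intro equalityI subsetI)
    fix u assume "u \<in> cocycles quotient_dga <+>\<^bsub>quotient_dga\<^esub> rep ` (B \<inter> C)"
    then obtain v b where u: "v \<in> cocycles quotient_dga" "b \<in> C" "u = v \<oplus>\<^bsub>quotient_dga\<^esub> rep b"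
      unfolding set_add_iff by auto
    then obtain x where "x \<in> C" "v = rep x"
      using quotient_mem unfolding cocycles_def by blast
    then show "u \<in> carrier quotient_dga"
      using u rep_add[of x b] by simp
  next
    fix u assume "u \<in> carrier quotient_dga"
    then obtain x where x: "x \<in> C" "u = rep x"
      using quotient_mem by blast
    have "rep x = rep (diff A (\<delta> x) \<oplus>\<^bsub>A\<^esub> \<pi> x) \<oplus>\<^bsub>quotient_dga\<^esub> rep (\<delta> (diff A x))"
    proof (subst rep_add)
      show "rep x = rep (diff A (\<delta> x) \<oplus>\<^bsub>A\<^esub> \<pi> x \<oplus>\<^bsub>A\<^esub> \<delta> (diff A x))"
        using hodge_identity[of x] x by simp
    qed (use x in auto)
    moreover have "rep (diff A (\<delta> x) \<oplus>\<^bsub>A\<^esub> \<pi> x) \<in> cocycles quotient_dga"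
      using x by (subst quotient_cocycles_iff) (auto simp: diff_diff)
    moreover have "\<delta> (diff A x) \<in> B \<inter> C"
      using x by auto
    ultimately show "u \<in> cocycles quotient_dga <+>\<^bsub>quotient_dga\<^esub> rep ` (B \<inter> C)"
      unfolding set_add_iff using x(2) by blast
  qed
  have orthogonal: "poincare_pairing F n quotient_dga \<kappa> u v = \<zero>\<^bsub>F\<^esub>"
    if uv: "u \<in> rep ` W <+>\<^bsub>quotient_dga\<^esub> rep ` (B \<inter> C)" "v \<in> rep ` (B \<inter> C)" for u v
  proof -
    obtain w b c where "w \<in> W" "b \<in> B" "b \<in> C" "u = rep w \<oplus>\<^bsub>quotient_dga\<^esub> rep b" "c \<in> B" "c \<in> C" "v = rep c"
      using uv unfolding set_add_iff by auto
    then show ?thesis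
      using rep_add[of w b] \<kappa>[of "w \<oplus>\<^bsub>A\<^esub> b" c]
      by (simp add: l_distr integral_harmonic_complement integral_complement_complement)
  qed
  show ?thesis
    unfolding hodge_decomposition_def harmonic_subspace_def internal_sum_def
    using graded W int1 sum1 int2 sum2 orthogonal by simp
qed

text \<open>The quotient pairing of two representatives equals the pairing of the original elements
  in \<open>A\<close>; nondegeneracy is then the definition of the radical.\<close>

lemma quotient_nondegenerate_hodge:
  "\<exists>\<kappa>. poincare_dgca F n quotient_dga \<kappa> \<and> nondegenerate_dgca F n quotient_dga \<kappa> \<and>
     hodge_type F n quotient_dga \<kappa>"
proof -
  obtain \<kappa> where \<kappa>: "poincare_algebra F n (cohomology quotient_dga) \<kappa>"
    "\<And>x. x \<in> C \<Longrightarrow> x \<in> cocycles A \<Longrightarrow> \<kappa> (coh_class quotient_dga (rep x)) = \<iota> (coh_class A x)"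
    using ex_quotient_functional by blast
  have pairing: "poincare_pairing F n quotient_dga \<kappa> (rep x) (rep y) = integral (x \<otimes>\<^bsub>A\<^esub> y)"
    if xy: "x \<in> C" "y \<in> C" for x y
  proof -
    \<comment> \<open>Agreement of the functionals is known only on cocycles; the products in
      question have degree \<open>n\<close> and are therefore cocycles.\<close>
    have summand: "\<kappa> (coh_class quotient_dga (part quotient_dga (rep x) k \<otimes>\<^bsub>quotient_dga\<^esub> part quotient_dga (rep y) (n - k))) =
        \<iota> (coh_class A (part A x k \<otimes>\<^bsub>A\<^esub> part A y (n - k)))"
      "\<iota> (coh_class A (part A x k \<otimes>\<^bsub>A\<^esub> part A y (n - k))) \<in> carrier F" if "k \<le> n" for k
    proof -
      let ?z = "part A x k \<otimes>\<^bsub>A\<^esub> part A y (n - k)"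
      have z: "?z \<in> homog A n"
        using mult_homog[of "part A x k" k "part A y (n - k)" "n - k"] xy that by auto
      have "part quotient_dga (rep x) k \<otimes>\<^bsub>quotient_dga\<^esub> part quotient_dga (rep y) (n - k) = rep ?z"
        using xy quot.image_mult[of "part A x k" "part A y (n - k)"] by simp
      then show "\<kappa> (coh_class quotient_dga (part quotient_dga (rep x) k \<otimes>\<^bsub>quotient_dga\<^esub> part quotient_dga (rep y) (n - k))) =
          \<iota> (coh_class A ?z)"
        using \<kappa>(2)[of ?z] top_cocycle[OF z] xy by simp
      show "\<iota> (coh_class A ?z) \<in> carrier F"
        using functional_closed[OF z] .
    qed
    have "poincare_pairing F n quotient_dga \<kappa> (rep x) (rep y) = poincare_pairing F n A \<iota> x y"
      unfolding poincare_pairing_def pairing_def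
      by (rule R.finsum_cong') (simp_all add: summand del: subquotient_simps quot.part_image)
    then show ?thesis
      using xy by (simp add: poincare_pairing_eq)
  qed
  have "poincare_dgca F n quotient_dga \<kappa>"
    by (intro poincare_dgca.intro poincare_dgca_axioms.intro quot.dgca_image \<kappa>(1))
      (auto simp: homog_above)
  moreover have "nondegenerate_dgca F n quotient_dga \<kappa>"
    unfolding nondegenerate_dgca_def nondegenerate_pairing_def poincare_pairing_def[symmetric]
  proof (intro ballI impI)
    fix u assume u: "u \<in> carrier quotient_dga"
      "\<forall>v\<in>carrier quotient_dga. poincare_pairing F n quotient_dga \<kappa> u v = \<zero>\<^bsub>F\<^esub>"
    then obtain x where x: "x \<in> C" "u = rep x"
      using quotient_mem by blast
    have "integral (x \<otimes>\<^bsub>A\<^esub> y) = \<zero>\<^bsub>F\<^esub>" if "y \<in> C" for y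
      using u(2) pairing[OF x(1) that] x(2) that by simp
    then have "x \<in> radical"
      using x by (intro radicalI) auto
    then show "u = \<zero>\<^bsub>quotient_dga\<^esub>"
      using x rep_eq_zero_iff by simp
  qed
  moreover have "hodge_type F n quotient_dga \<kappa>"
    unfolding hodge_type_def using quotient_hodge_decomposition[of \<kappa>] pairing by blast
  ultimately show ?thesis by blast
qed

text \<open>A subspace of the quotient is pulled back to \<open>C\<close>, where the spanning
  property of \<open>G\<close> applies.\<close>

lemma quotient_fin_dim:
  assumes G: "finite G" "G \<subseteq> C" "\<And>S. VectorSpace.subspace F S A \<Longrightarrow> G \<subseteq> S \<Longrightarrow> C \<subseteq> S"
  shows "vectorspace.fin_dim F quotient_dga"
proof -
  interpret Q: graded_commutative_algebra F quotient_dga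
    by (rule quot.graded_commutative_image)
  have "carrier quotient_dga \<subseteq> S" if S: "VectorSpace.subspace F S quotient_dga" "rep ` G \<subseteq> S" for S
  proof -
    have "VectorSpace.subspace F {x \<in> C. rep x \<in> S} A"
      using S(1) unfolding Q.subspace_iff subspace_iff
      by (auto simp: quot.image_add quot.image_smult quot.image_zero simp del: subquotient_simps)
    moreover have "G \<subseteq> {x \<in> C. rep x \<in> S}"
      using G S(2) by auto
    ultimately have "C \<subseteq> {x \<in> C. rep x \<in> S}"
      by (rule G(3))
    then show ?thesis by auto
  qed
  then show ?thesis
    unfolding Q.fin_dim_iff using G(1,2) by (intro exI[of _ "rep ` G"]) auto
qed

end

section \<open>A finite dimensional subalgebra\<close>

context hodge_dgca
begin

text \<open>The degree bound alone places \<open>\<delta> x\<close> in degree 0, because of the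
  truncated subtraction. In the degree 1 part of the Hodge identity only d
  (\<open>\<delta> x\<close>) remains, so it vanishes, and \<open>d\<close> is injective on
  \<open>B\<close>.\<close>

lemma codifferential_degree_zero:
  assumes x: "x \<in> homog A 0"
  shows "\<delta> x = \<zero>\<^bsub>A\<^esub>"
proof -
  have xc: "x \<in> carrier A" using x by auto
  have d: "diff A (\<delta> x) \<in> homog A 1"
    using diff_homog[of "\<delta> x" 0] codifferential_homog[OF x] by simp
  have "\<delta> (diff A x) \<in> homog A 0"
    using codifferential_homog[of "diff A x" 1] diff_homog[OF x] by simp
  then have "part A (\<pi> x) 1 = \<zero>\<^bsub>A\<^esub>" "part A (\<delta> (diff A x)) 1 = \<zero>\<^bsub>A\<^esub>" "part A x 1 = \<zero>\<^bsub>A\<^esub>"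
    using x part_other[of _ 0 1] by auto
  then have "diff A (\<delta> x) = \<zero>\<^bsub>A\<^esub>"
    using arg_cong[OF hodge_identity[OF xc], of "\<lambda>u. part A u 1"] xc part_same[OF d] by simp
  then show ?thesis
    using xc codifferential_differential[of "\<delta> x"] by simp
qed

text \<open>The isomorphism with the field is linear and unital, so the class of \<open>w\<close> is
  a multiple of the unit class; the difference is exact of degree 0 and hence zero.\<close>

lemma harmonic_degree_zero:
  assumes "simply_connected F A" and w: "w \<in> W" "w \<in> homog A 0"
  shows "\<exists>a\<in>carrier F. w = a \<odot>\<^bsub>A\<^esub> \<one>\<^bsub>A\<^esub>"
proof -
  obtain h where h: "h \<in> ring_iso F ((cohomology A)\<lparr>carrier := homog (cohomology A) 0\<rparr>)"
    "\<And>a b. a \<in> carrier F \<Longrightarrow> b \<in> carrier F \<Longrightarrow> h (a \<otimes>\<^bsub>F\<^esub> b) = a \<odot>\<^bsub>cohomology A\<^esub> h b"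
    using assms(1) unfolding simply_connected_def by blast
  have "coh_class A w \<in> homog (cohomology A) 0"
    using w by simp
  then have "coh_class A w \<in> h ` carrier F"
    using h(1) by (simp add: ring_iso_def bij_betw_def)
  then obtain a where a: "a \<in> carrier F" "coh_class A w = h a"
    by auto
  have "h \<one>\<^bsub>F\<^esub> = coh_class A \<one>\<^bsub>A\<^esub>"
    using h(1) by (simp add: ring_iso_def ring_hom_def)
  then have "h a = coh_class A (a \<odot>\<^bsub>A\<^esub> \<one>\<^bsub>A\<^esub>)"
    using h(2)[of a "\<one>\<^bsub>F\<^esub>"] a(1) by simp
  then have "w \<ominus>\<^bsub>A\<^esub> a \<odot>\<^bsub>A\<^esub> \<one>\<^bsub>A\<^esub> \<in> coboundaries A"
    using a w(1) by (simp add: coh_class_eq_iff)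
  then obtain u where u: "u \<in> carrier A" "w \<ominus>\<^bsub>A\<^esub> a \<odot>\<^bsub>A\<^esub> \<one>\<^bsub>A\<^esub> = diff A u"
    by (auto simp: coboundaries_def)
  have "w \<ominus>\<^bsub>A\<^esub> a \<odot>\<^bsub>A\<^esub> \<one>\<^bsub>A\<^esub> \<in> homog A 0"
    using w a one_homog by auto
  then have "w \<ominus>\<^bsub>A\<^esub> a \<odot>\<^bsub>A\<^esub> \<one>\<^bsub>A\<^esub> = \<zero>\<^bsub>A\<^esub>"
    using part_differential(1)[OF u(1)] u(2) part_same by metis
  then show ?thesis
    using a(1) w(1) by (auto simp: minus_eq_zero_iff)
qed

lemma harmonic_degree_one:
  assumes "simply_connected F A" and w: "w \<in> W" "w \<in> homog A 1"
  shows "w = \<zero>\<^bsub>A\<^esub>"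
proof -
  have "coh_class A w \<in> homog (cohomology A) 1"
    using w by simp
  then have "coh_class A w = coh_class A \<zero>\<^bsub>A\<^esub>"
    using assms(1) unfolding simply_connected_def by simp
  then have "w \<in> coboundaries A"
    using w by (simp add: coh_class_eq_iff a_minus_def)
  then show ?thesis
    using w(1) by (rule harmonic_coboundary[rotated])
qed

text \<open>\<open>\<pi>\<close> carries cohomology onto \<open>W\<close>, so harmonic
  representatives of a finite spanning set span \<open>W\<close>. They are split into homogeneous
  parts because the later argument sorts generators by degree.\<close>

lemma finite_harmonic_generators:
  "\<exists>E. finite E \<and> E \<subseteq> W \<and> (\<forall>e\<in>E. \<exists>k. e \<in> homog A k) \<and>
     (\<forall>V. VectorSpace.subspace F V A \<longrightarrow> E \<subseteq> V \<longrightarrow> W \<subseteq> V)"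
proof -
  have coh: "graded_commutative_algebra F (cohomology A)" "vectorspace F (cohomology A)"
    "vectorspace.fin_dim F (cohomology A)"
    using cohomology_poincare cohomology.graded_commutative_image cohomology.vectorspace_image
    by (auto simp: poincare_algebra_def poincare_algebra_axioms_def)
  obtain S where S: "finite S" "S \<subseteq> carrier (cohomology A)"
    "\<And>V. VectorSpace.subspace F V (cohomology A) \<Longrightarrow> S \<subseteq> V \<Longrightarrow> carrier (cohomology A) \<subseteq> V"
    using coh(3) unfolding vectorspace.fin_dim_iff[OF coh(2)] by blast
  have "\<forall>X\<in>S. \<exists>x. x \<in> cocycles A \<and> X = coh_class A x"
    using S(2) by auto
  then obtain r where r: "\<And>X. X \<in> S \<Longrightarrow> r X \<in> cocycles A" "\<And>X. X \<in> S \<Longrightarrow> X = coh_class A (r X)"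
    by metis
  define E where "E = (\<lambda>(X, k). part A (\<pi> (r X)) k) ` (S \<times> {..n})"
  have "finite E" using S(1) by (simp add: E_def)
  moreover have "E \<subseteq> W" using r by (auto simp: E_def)
  moreover have "\<exists>k. e \<in> homog A k" if e: "e \<in> E" for e
  proof -
    obtain X k where "X \<in> S" "e = part A (\<pi> (r X)) k"
      using e by (auto simp: E_def)
    then have "e \<in> homog A k"
      using r(1) by simp
    then show ?thesis ..
  qed
  moreover have "W \<subseteq> V" if V: "VectorSpace.subspace F V A" "E \<subseteq> V" for V
  proof
    fix w assume w: "w \<in> W"
    have V': "V \<subseteq> carrier A" "\<zero>\<^bsub>A\<^esub> \<in> V" "\<And>x y. x \<in> V \<Longrightarrow> y \<in> V \<Longrightarrow> x \<oplus>\<^bsub>A\<^esub> y \<in> V"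
      "\<And>a x. a \<in> carrier F \<Longrightarrow> x \<in> V \<Longrightarrow> a \<odot>\<^bsub>A\<^esub> x \<in> V"
      using V(1) unfolding subspace_iff by auto
    \<comment> \<open>The classes whose harmonic representative lies in \<open>V\<close> form a
      subspace of the cohomology, to which the spanning property of \<open>S\<close>
      applies.\<close>
    let ?T = "coh_class A ` {y \<in> cocycles A. \<pi> y \<in> V}"
    have zero: "coh_class A \<zero>\<^bsub>A\<^esub> \<in> ?T"
      using V' by (intro imageI) (auto intro: cocyclesI)
    have add: "coh_class A (y \<oplus>\<^bsub>A\<^esub> z) \<in> ?T"
      if "y \<in> cocycles A" "\<pi> y \<in> V" "z \<in> cocycles A" "\<pi> z \<in> V" for y z
      using that V' by (intro imageI) (auto intro: cocyclesI)
    have smult: "coh_class A (a \<odot>\<^bsub>A\<^esub> y) \<in> ?T"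
      if "a \<in> carrier F" "y \<in> cocycles A" "\<pi> y \<in> V" for a y
      using that V' by (intro imageI) (auto intro: cocyclesI)
    have "VectorSpace.subspace F ?T (cohomology A)"
      unfolding graded_commutative_algebra.subspace_iff[OF coh(1)]
      using zero add smult by (auto simp del: image_iff)
    moreover have "S \<subseteq> ?T"
    proof
      fix X assume X: "X \<in> S"
      have "\<pi> (r X) \<in> V"
      proof (rule graded_induct[of "\<pi> (r X)"])
        fix k
        show "part A (\<pi> (r X)) k \<in> V"
        proof (cases "k \<le> n")
          case True
          then show ?thesis using V(2) X by (auto simp: E_def)
        next
          case False
          then show ?thesis using V' r(1)[OF X] by (simp add: part_above)
        qed
      qed (use r(1)[OF X] V' in auto)
      then show "X \<in> ?T"
        using r[OF X] by blast
    qed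
    ultimately have "carrier (cohomology A) \<subseteq> ?T"
      by (rule S(3))
    then obtain y where y: "y \<in> cocycles A" "\<pi> y \<in> V" "coh_class A w = coh_class A y"
      using w by auto
    then have "w \<ominus>\<^bsub>A\<^esub> y \<in> coboundaries A"
      using w by (simp add: coh_class_eq_iff)
    then have "\<pi> (w \<ominus>\<^bsub>A\<^esub> y) = \<zero>\<^bsub>A\<^esub>"
      by (auto simp: coboundaries_def)
    then have "w = \<pi> y"
      using w y(1) minus_eq_zero_iff[of w "\<pi> y"] by simp
    then show "w \<in> V" using y(2) by simp
  qed
  ultimately show ?thesis by blast
qed

text \<open>The degree is carried as an index rather than read off the element, since zero has every
  degree. \<open>\<delta>\<close> is applied only to products, being zero on harmonic elements and
  on its own values; harmonic elements below degree 2 are scalars or zero.\<close>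

inductive small_generator :: "'a set \<Rightarrow> nat \<Rightarrow> 'a \<Rightarrow> bool" for E where
  harmonic: "\<lbrakk>e \<in> E; e \<in> homog A k; 2 \<le> k\<rbrakk> \<Longrightarrow> small_generator E k e"
| mult: "\<lbrakk>small_generator E i x; small_generator E j y\<rbrakk> \<Longrightarrow> small_generator E (i + j) (x \<otimes>\<^bsub>A\<^esub> y)"
| codifferential: "\<lbrakk>small_generator E i x; small_generator E j y\<rbrakk> \<Longrightarrow>
    small_generator E (i + j - 1) (\<delta> (x \<otimes>\<^bsub>A\<^esub> y))"

lemma small_generator_homog:
  "small_generator E k x \<Longrightarrow> 2 \<le> k \<and> x \<in> homog A k"
  by (induction rule: small_generator.induct)
    (auto intro!: mult_homog codifferential_homog[unfolded One_nat_def])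

lemma finite_small_generators:
  assumes E: "finite E"
  shows "finite {x. small_generator E k x}"
proof (induction k rule: less_induct)
  case (less k)
  let ?G = "\<lambda>i. {x. small_generator E i x}"
  let ?P = "(\<lambda>(x, y). x \<otimes>\<^bsub>A\<^esub> y) ` ((\<Union>i<k. ?G i) \<times> (\<Union>j<k. ?G j))"
  have "x \<in> E \<union> ?P \<union> \<delta> ` ?P" if "small_generator E k x" for x
    using that
  proof cases
    case harmonic
    then show ?thesis by blast
  next
    case (mult i x j y)
    \<comment> \<open>Here k = i + j with both indices at least 2.\<close>
    then have "i < k" "j < k"
      using small_generator_homog[of E i x] small_generator_homog[of E j y] by auto
    then show ?thesis using mult by force
  next
    case (codifferential i x j y)
    \<comment> \<open>Here k = i + j - 1; that both indices are at least 2, and not merely at least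
      1, is exactly what keeps them below k.\<close>
    then have "i < k" "j < k"
      using small_generator_homog[of E i x] small_generator_homog[of E j y] by auto
    then have "x \<otimes>\<^bsub>A\<^esub> y \<in> ?P" using codifferential by force
    then show ?thesis using codifferential by blast
  qed
  moreover have "finite (E \<union> ?P \<union> \<delta> ` ?P)"
    using E less by auto
  ultimately show ?case
    using finite_subset[of "?G k" "E \<union> ?P \<union> \<delta> ` ?P"] by blast
qed

text \<open>\<open>C\<close> is just a linear span: the generators are closed under products and
  under \<open>\<delta>\<close> of products, so closure of the span follows from linearity, once the
  unit and the cases where \<open>\<delta>\<close> vanishes are treated.\<close>

lemma ex_finite_hodge_subalgebra:
  assumes sc: "simply_connected F A"
  shows "\<exists>C G. hodge_subalgebra F n A \<iota> W B C \<and> finite G \<and> G \<subseteq> C \<and>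
    (\<forall>V. VectorSpace.subspace F V A \<longrightarrow> G \<subseteq> V \<longrightarrow> C \<subseteq> V)"
proof -
  obtain E where E: "finite E" "E \<subseteq> W" "\<And>e. e \<in> E \<Longrightarrow> \<exists>k. e \<in> homog A k"
    "\<And>V. VectorSpace.subspace F V A \<Longrightarrow> E \<subseteq> V \<Longrightarrow> W \<subseteq> V"
    using finite_harmonic_generators by blast
  let ?gen = "small_generator E"
  \<comment> \<open>The unit is added because generators start in degree 2; cutting off at
    \<open>n\<close> keeps \<open>G\<close> finite and loses only zero.\<close>
  define G where "G = insert \<one>\<^bsub>A\<^esub> (\<Union>k\<le>n. {x. ?gen k x})"
  have gen: "x \<in> carrier A" "x \<in> homog A k" if "?gen k x" for k x
    using small_generator_homog[OF that] by auto
  have finite: "finite G"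
    unfolding G_def using finite_small_generators[OF E(1)] by simp
  have G_carrier: "G \<subseteq> carrier A"
    unfolding G_def using gen by auto
  define C where "C = span G"
  have C_least: "C \<subseteq> V" if "VectorSpace.subspace F V A" "G \<subseteq> V" for V
    unfolding C_def using that by (intro span_is_subset) (simp_all add: VectorSpace.subspace_def)
  have C_subspace: "VectorSpace.subspace F C A"
    unfolding C_def by (rule span_is_subspace[OF G_carrier])
  have G_sub: "G \<subseteq> C"
    unfolding C_def by (rule in_own_span[OF G_carrier])
  have C: "\<And>x. x \<in> C \<Longrightarrow> x \<in> carrier A" "\<zero>\<^bsub>A\<^esub> \<in> C" "\<And>x y. x \<in> C \<Longrightarrow> y \<in> C \<Longrightarrow> x \<oplus>\<^bsub>A\<^esub> y \<in> C"
    "\<And>a x. a \<in> carrier F \<Longrightarrow> x \<in> C \<Longrightarrow> a \<odot>\<^bsub>A\<^esub> x \<in> C"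
    using C_subspace unfolding subspace_iff by auto
  have C_minus: "\<ominus>\<^bsub>A\<^esub> x \<in> C" if "x \<in> C" for x
    using C(4)[of "\<ominus>\<^bsub>F\<^esub> \<one>\<^bsub>F\<^esub>" x] C(1)[OF that] that by (simp add: smult_l_minus)
  have C_diff: "x \<ominus>\<^bsub>A\<^esub> y \<in> C" if "x \<in> C" "y \<in> C" for x y
    unfolding a_minus_def using that C(3) C_minus by simp
  have gen_C: "x \<in> C" if "?gen k x" for k x
  proof (cases "k \<le> n")
    case True
    then show ?thesis using that G_sub by (auto simp: G_def)
  next
    case False
    then show ?thesis using gen(2)[OF that] homog_above[of k] C(2) by simp
  qed
  have one: "\<one>\<^bsub>A\<^esub> \<in> C"
    using G_sub by (auto simp: G_def)
  \<comment> \<open>Span induction: the elements of \<open>C\<close> with property \<open>P\<close>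
    form a subspace containing \<open>G\<close>.\<close>
  have C_induct: "P x" if x: "x \<in> C" and P: "P \<zero>\<^bsub>A\<^esub>" "P \<one>\<^bsub>A\<^esub>" "\<And>k x. ?gen k x \<Longrightarrow> P x"
    "\<And>x y. x \<in> C \<Longrightarrow> y \<in> C \<Longrightarrow> P x \<Longrightarrow> P y \<Longrightarrow> P (x \<oplus>\<^bsub>A\<^esub> y)"
    "\<And>a x. a \<in> carrier F \<Longrightarrow> x \<in> C \<Longrightarrow> P x \<Longrightarrow> P (a \<odot>\<^bsub>A\<^esub> x)" for P x
  proof -
    have "VectorSpace.subspace F {x \<in> C. P x} A"
      unfolding subspace_iff using C P by auto
    moreover have "G \<subseteq> {x \<in> C. P x}"
      using G_sub P(2,3) by (auto simp: G_def)
    ultimately show ?thesis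
      using C_least x by blast
  qed
  have W_C: "W \<subseteq> C"
  proof (rule E(4)[OF C_subspace], rule)
    fix e assume e: "e \<in> E"
    then obtain k where k: "e \<in> homog A k" using E(3) by blast
    consider "k = 0" | "k = 1" | "2 \<le> k" by linarith
    then show "e \<in> C"
    proof cases
      case 1
      then show ?thesis
        using harmonic_degree_zero[OF sc, of e] e E(2) k C(4) one by blast
    next
      case 2
      then have "e = \<zero>\<^bsub>A\<^esub>"
        using harmonic_degree_one[OF sc, of e] e E(2) k by blast
      then show ?thesis using C(2) by simp
    next
      case 3
      then show ?thesis
        using gen_C small_generator.harmonic e k by blast
    qed
  qed
  have C_part: "part A x k \<in> C" if "x \<in> C" for x k
    using that
  proof (rule C_induct)
    show "part A \<one>\<^bsub>A\<^esub> k \<in> C"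
      using part_homogeneous[OF one_homog] one C(2) by simp
    show "part A x k \<in> C" if "?gen j x" for j x
      using part_homogeneous[OF gen(2)[OF that]] gen_C[OF that] C(2) by simp
  qed (use C in auto)
  have C_mult: "x \<otimes>\<^bsub>A\<^esub> y \<in> C" if x: "x \<in> C" and y: "y \<in> C" for x y
    using x
  proof (rule C_induct)
    show "x \<otimes>\<^bsub>A\<^esub> y \<in> C" if g: "?gen i x" for i x
      using y
    proof (rule C_induct)
      show "x \<otimes>\<^bsub>A\<^esub> y \<in> C" if "?gen j y" for j y
        using gen_C[OF small_generator.mult[OF g that]] .
    qed (use gen(1)[OF g] gen_C[OF g] C in \<open>auto simp: r_distr smult_mult_right\<close>)
  qed (use y C in \<open>auto simp: l_distr smult_mult_left\<close>)
  \<comment> \<open>For a product, \<open>\<delta>\<close> gives a new generator; for a harmonic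
    generator and for a value of \<open>\<delta>\<close> it gives zero, and the unit is settled by
    its degree.\<close>
  have C_codifferential: "\<delta> x \<in> C" if "x \<in> C" for x
    using that
  proof (rule C_induct)
    show "\<delta> x \<in> C" if g: "?gen k x" for k x
      using g
    proof cases
      case harmonic
      then show ?thesis using E(2) C(2) by auto
    next
      case (mult i x j y)
      then show ?thesis using gen_C[OF small_generator.codifferential] by blast
    next
      case (codifferential i x j y)
      then show ?thesis using gen(1) C(2) by simp
    qed
  qed (use C in \<open>auto simp: codifferential_degree_zero one_homog\<close>)
  have gen_differential: "diff A x \<in> C" if "?gen k x" for k x
    using that
  proof induction
    case (harmonic e k)
    then have "diff A e = \<zero>\<^bsub>A\<^esub>" using E(2) by auto
    then show ?case using C(2) by simp
  next
    case (mult i x j y)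
    then show ?case
      using leibniz[OF gen(2)[OF mult(1)] gen(1)[OF mult(2)]] gen_C C(3) C_diff C_mult by auto
  next
    case (codifferential i x j y)
    let ?z = "x \<otimes>\<^bsub>A\<^esub> y"
    note g = codifferential(1,2)
    have z: "?z \<in> C" using gen_C[OF g(1)] gen_C[OF g(2)] by (rule C_mult)
    have dz: "diff A ?z \<in> C"
      using leibniz[OF gen(2)[OF g(1)] gen(1)[OF g(2)]] gen_C g codifferential C(3) C_diff C_mult by auto
    \<comment> \<open>Each term on the right is in \<open>C\<close>: the product itself, a harmonic
      element, and \<open>\<delta>\<close> of \<open>diff A ?z\<close>, which the Leibniz rule and
      the induction hypotheses place in \<open>C\<close>.\<close>
    have "diff A (\<delta> ?z) = ?z \<ominus>\<^bsub>A\<^esub> \<pi> ?z \<ominus>\<^bsub>A\<^esub> \<delta> (diff A ?z)"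
    proof -
      have "(a \<oplus>\<^bsub>A\<^esub> b \<oplus>\<^bsub>A\<^esub> c) \<ominus>\<^bsub>A\<^esub> b \<ominus>\<^bsub>A\<^esub> c = a" if "a \<in> carrier A" "b \<in> carrier A" "c \<in> carrier A" for a b c
        using that by algebra
      then show ?thesis
        using hodge_identity[OF C(1)[OF z]] C(1)[OF z]
        by (metis codifferential_closed differential_closed harmonic_part_closed)
    qed
    moreover have "\<pi> ?z \<in> C" using W_C C(1)[OF z] by auto
    ultimately show ?case
      using z dz C_diff C_codifferential by simp
  qed
  have C_differential: "diff A x \<in> C" if "x \<in> C" for x
    using that by (rule C_induct) (use C gen_differential in auto)
  have "graded_subalgebra F A C"
    unfolding graded_subalgebra_def graded_subspace_def
    using C_subspace C_part one C_mult by auto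
  then have "hodge_subalgebra F n A \<iota> W B C"
    using C_differential C_codifferential W_C
    by (intro hodge_subalgebra.intro hodge_subalgebra_axioms.intro hodge_dgca_axioms) auto
  then show ?thesis
    using finite G_sub C_least by blast
qed

end

theorem corollary3p5:
  fixes F :: "('f, 'm) ring_scheme" and A :: "('f, 'a) dga"
    and \<iota> :: "'a set \<Rightarrow> 'f" and n :: nat
  assumes "field F" and "\<forall>m::nat. m > 0 \<longrightarrow> [m] \<cdot>\<^bsub>F\<^esub> \<one>\<^bsub>F\<^esub> \<noteq> \<zero>\<^bsub>F\<^esub>"
    and "poincare_dgca F n A \<iota>"
    and "simply_connected F A"
    and "hodge_type F n A \<iota>"
  shows "\<exists>(B :: ('f, 'a) dga) (\<kappa> :: 'a set \<Rightarrow> 'f).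
    dgca_equivalent F A B \<and>
    poincare_dgca F n B \<kappa> \<and>
    vectorspace.fin_dim F B \<and>
    nondegenerate_dgca F n B \<kappa> \<and>
    hodge_type F n B \<kappa>"
proof -
  obtain W B where "hodge_decomposition F n A \<iota> W B"
    using assms(5) unfolding hodge_type_def by blast
  then interpret hodge_dgca F n A \<iota> W B
    using assms(3) by (intro hodge_dgca.intro hodge_dgca_axioms.intro)
  obtain C G where C: "hodge_subalgebra F n A \<iota> W B C" and G: "finite G" "G \<subseteq> C"
    "\<And>V. VectorSpace.subspace F V A \<Longrightarrow> G \<subseteq> V \<Longrightarrow> C \<subseteq> V"
    using ex_finite_hodge_subalgebra[OF assms(4)] by blast
  interpret hodge_subalgebra F n A \<iota> W B C by (rule C)
  \<comment> \<open>The zig-zag has two arrows out of the small algebra: the inclusion into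
    \<open>A\<close>, traversed backwards, and the projection onto the quotient.\<close>
  have "dgca_equivalent F A small_dga"
    using dgca_equivalent.refl[OF dgca_axioms] inclusion_quasi_isomorphism
    by (rule dgca_equivalent.backward)
  then have "dgca_equivalent F A quotient_dga"
    using projection_quasi_isomorphism by (rule dgca_equivalent.forward)
  then show ?thesis
    using quotient_nondegenerate_hodge quotient_fin_dim[OF G] by blast
qed

end
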